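(* There exists an absolute constant $c>0$ such that for all integers $d\ge1$ and $p\ge1$ and all Borel probability measures $\mu,\nu$ on $\mathbb{R}^d$ supported on the unit ball $\{x\in\mathbb{R}^d:|x|\le1\}$, $$\zeta_p(\mu,\nu)\;\le\;(cd)^p\,\sup_{|\theta|=1}\zeta_p(\mu_\theta,\nu_\theta)^{\beta},\qquad \beta=\frac{2}{2+d/p}.$$
   Context: $|x|$ is the Euclidean norm on $\mathbb{R}^d$. For $\theta\in\mathbb{R}^d$ with $|\theta|=1$, $\mu_\theta$ denotes the image (pushforward) of $\mu$ under the linear map $x\mapsto\langle x,\theta\rangle$ from $\mathbb{R}^d$ to $\mathbb{R}$; similarly $\nu_\theta$. For an integer $p\ge1$ and probability measures $\mu,\nu$ on $\mathbb{R}^d$ (any dimension $d\ge1$, in particular $d=1$) with finite $p$-th absolute moments, the Zolotarev distance of order $p$ is $$\zeta_p(\mu,\nu)=\sup\Big|\int_{\mathbb{R}^d}u\,d\mu-\int_{\mathbb{R}^d}u\,d\nu\Big|\in[0,\infty],$$ where the supremum is over all $p$ times differentiable (or equivalently, $C^\infty$-smooth) functions $u:\mathbb{R}^d\to\mathbb{R}$ all of whose partial derivatives of order $p$ are bounded by $1$ in absolute value. The value may be $+\infty$; it is finite exactly when $\mu$ and $\nu$ have equal mixed moments up to order $p-1$. "Absolute constant" means a constant independent of $d,p,\mu,\nu$. *)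

theory Defs
  imports "HOL-Probability.Probability"
begin

text \<open>
  The dimension has to be quantified inside the scope of a constant, so \<open>\<real>\<^sup>d\<close> is not a type here:
  its points are the functions \<open>nat \<Rightarrow> real\<close> with (extensional) domain \<open>{..<d}\<close>, its
  \<open>\<sigma>\<close>-algebra is the product of the Borel algebras, which is the Borel algebra of \<open>\<real>\<^sup>d\<close>, and its
  Euclidean norm is \<^const>\<open>L2_set\<close>. The measure that \<^const>\<open>PiM\<close> puts on this space is not used.
\<close>

abbreviation Rd :: "nat \<Rightarrow> (nat \<Rightarrow> real) measure" where
  "Rd d \<equiv> PiM {..<d} (\<lambda>_. borel)"

abbreviation norm_Rd :: "nat \<Rightarrow> (nat \<Rightarrow> real) \<Rightarrow> real" where
  "norm_Rd d x \<equiv> L2_set x {..<d}"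

definition unit_sphere :: "nat \<Rightarrow> (nat \<Rightarrow> real) set" where
  "unit_sphere d = {\<theta> \<in> space (Rd d). norm_Rd d \<theta> = 1}"

definition unit_ball :: "nat \<Rightarrow> (nat \<Rightarrow> real) set" where
  "unit_ball d = {x \<in> space (Rd d). norm_Rd d x \<le> 1}"

definition differentiable_Rd :: "nat \<Rightarrow> ((nat \<Rightarrow> real) \<Rightarrow> real) \<Rightarrow> (nat \<Rightarrow> real) \<Rightarrow> bool" where
  "differentiable_Rd d u x \<longleftrightarrow>
     (\<exists>g :: nat \<Rightarrow> real. \<forall>\<epsilon>>0. \<exists>\<delta>>0. \<forall>y\<in>space (Rd d). norm_Rd d (\<lambda>i. y i - x i) < \<delta> \<longrightarrow>
        \<bar>u y - u x - (\<Sum>i<d. g i * (y i - x i))\<bar> \<le> \<epsilon> * norm_Rd d (\<lambda>i. y i - x i))"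

definition partial_deriv :: "nat \<Rightarrow> ((nat \<Rightarrow> real) \<Rightarrow> real) \<Rightarrow> (nat \<Rightarrow> real) \<Rightarrow> real" where
  "partial_deriv i u = (\<lambda>x. deriv (\<lambda>t. u (x(i := t))) (x i))"

text \<open>
  The derivative \<open>x \<mapsto> Du(x)\<close> is \<open>k\<close> times (Frechet) differentiable iff each of its components, the
  partial derivatives of \<open>u\<close>, is.
\<close>

primrec times_differentiable :: "nat \<Rightarrow> nat \<Rightarrow> ((nat \<Rightarrow> real) \<Rightarrow> real) \<Rightarrow> bool" where
  "times_differentiable d 0 u \<longleftrightarrow> True"
| "times_differentiable d (Suc k) u \<longleftrightarrow>
     (\<forall>x\<in>space (Rd d). differentiable_Rd d u x) \<and>
     (\<forall>i<d. times_differentiable d k (partial_deriv i u))"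

definition zolotarev_test :: "nat \<Rightarrow> nat \<Rightarrow> ((nat \<Rightarrow> real) \<Rightarrow> real) set" where
  "zolotarev_test d p = {u. times_differentiable d p u \<and>
     (\<forall>js. set js \<subseteq> {..<d} \<and> length js = p \<longrightarrow>
        (\<forall>x\<in>space (Rd d). \<bar>foldr partial_deriv js u x\<bar> \<le> 1))}"

text \<open>
  Meaningful for \<open>p \<ge> 1\<close> and probability measures with finite absolute \<open>p\<close>-th moments, for which
  every test function is integrable (it grows at most like \<open>1 + \<bar>x\<bar>\<^sup>p\<close>).
\<close>

definition zolotarev :: "nat \<Rightarrow> nat \<Rightarrow> (nat \<Rightarrow> real) measure \<Rightarrow> (nat \<Rightarrow> real) measure \<Rightarrow> ennreal" where
  "zolotarev d p \<mu> \<nu> =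
     (SUP u\<in>zolotarev_test d p. ennreal \<bar>(\<integral>x. u x \<partial>\<mu>) - (\<integral>x. u x \<partial>\<nu>)\<bar>)"

text \<open>
  The image of a measure under \<open>x \<mapsto> \<langle>x, \<theta>\<rangle>\<close>; the target \<open>\<real>\<close> is the one-dimensional space \<open>Rd 1\<close>, so
  that the distance above applies to it.
\<close>

definition proj_measure :: "nat \<Rightarrow> (nat \<Rightarrow> real) \<Rightarrow> (nat \<Rightarrow> real) measure \<Rightarrow> (nat \<Rightarrow> real) measure" where
  "proj_measure d \<theta> \<mu> = distr \<mu> (Rd 1) (\<lambda>x. \<lambda>i\<in>{..<1}. \<Sum>j<d. x j * \<theta> j)"

text \<open>Powers with exponent \<open>a > 0\<close> on \<open>[0, \<infinity>]\<close>; in particular \<open>\<infinity>\<^sup>a = \<infinity>\<close> and \<open>0\<^sup>a = 0\<close>.\<close>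

definition ennreal_powr :: "ennreal \<Rightarrow> real \<Rightarrow> ennreal" where
  "ennreal_powr z a = (if z = \<infinity> then \<infinity> else ennreal (enn2real z powr a))"

end

theory Submission
  imports Defs
begin

text \<open>
  The characteristic functions of \<open>\<mu>\<close> and \<open>\<nu>\<close> differ at frequency \<open>m\<close> by at most \<open>Z |m|\<^sup>p\<close>, where \<open>Z\<close>
  bounds the distances of the projections: \<open>cos\<close> is a test function on each line up to the factor
  \<open>|m|\<^sup>p\<close>. Finiteness of \<open>Z\<close> also makes the moments of order below \<open>p\<close> agree, so the Taylor
  polynomial of a test function \<open>u\<close> at the origin can be subtracted. The remainder is multiplied by a
  radial cutoff whose first \<open>p\<close> derivatives cost only a factor \<open>C\<^sup>p\<close>, and extended to a
  \<open>2\<pi>\<close>-periodic function \<open>v\<close>. With the averaging operator \<open>A\<close> of a product Jackson kernel of degree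
  about \<open>n\<close>, the function \<open>v - (I - A)\<^sup>p v\<close> is a trigonometric polynomial with at most \<open>(5n)\<^sup>d\<close>
  frequencies and \<open>|(I - A)\<^sup>p v| \<le> (C d / n)\<^sup>p\<close>, since each factor \<open>I - A\<close> trades one derivative
  for a first moment of the kernel. Bessel's inequality for the \<open>p\<close>-th differences of \<open>v\<close> and the
  Cauchy-Schwarz inequality bound the integral of the trigonometric polynomial by
  \<open>Z (5n)\<^sup>d\<^sup>/\<^sup>2 (C d)\<^sup>p\<close>, and it remains to optimise over \<open>n\<close>. The Fourier analysis is carried out on
  a fine finite grid, where it is a matter of finite sums.
\<close>

section \<open>Bounded directional derivatives\<close>

text \<open>All constants must stay geometric in p and may carry the dimension only as d^p; this
  dictates the tools. The derivatives of one fixed compactly supported cutoff outgrow every C^j j!,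
  so the cutoff depends on p and its j-th derivative may cost p^j: in the Leibniz rule this meets
  the 1/j! of the Taylor remainder, and p^j / j! \<le> e^p. A positive kernel does not approximate
  to order p in one application, whereas p applications of I - A gain n^-p with the p-th power of a
  single constant. The factor d^p is made of two factors sqrt(d)^p: one for passing from partial to
  directional derivatives, the other from the first moment of the kernel or from comparing |m|^p
  with the coordinates of m. Working with directions weighted by their Euclidean norm avoids
  multi-indices. Vectors are total functions \<open>nat \<Rightarrow> real\<close>, so that they can
  be added freely; \<open>trunc\<close> leads back to the extensional domain.\<close>

definition dird :: "((nat \<Rightarrow> real) \<Rightarrow> real) \<Rightarrow> (nat \<Rightarrow> real) \<Rightarrow> ((nat \<Rightarrow> real) \<Rightarrow> real) \<Rightarrow> bool" where
  "dird g h g' \<longleftrightarrow> (\<forall>x. ((\<lambda>t. g (\<lambda>i. x i + t * h i)) has_real_derivative g' x) (at 0))"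

lemma dird_at:
  assumes "dird g h g'"
  shows "((\<lambda>t. g (\<lambda>i. x i + t * h i)) has_real_derivative g' (\<lambda>i. x i + s * h i)) (at s)"
proof -
  have "((\<lambda>t. g (\<lambda>i. (x i + s * h i) + t * h i)) has_real_derivative g' (\<lambda>i. x i + s * h i)) (at 0)"
    using spec[OF assms[unfolded dird_def], of "\<lambda>i. x i + s * h i"] .
  also have "(\<lambda>t. g (\<lambda>i. (x i + s * h i) + t * h i)) = (\<lambda>t. g (\<lambda>i. x i + (t + s) * h i))"
    by (simp add: algebra_simps)
  finally show ?thesis
    using DERIV_shift[of "\<lambda>t. g (\<lambda>i. x i + t * h i)" _ 0 s] by simp
qed

lemma dird_const: "dird (\<lambda>x. c) h (\<lambda>x. 0)"
  unfolding dird_def by simp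

lemma dird_add: "dird f h f' \<Longrightarrow> dird g h g' \<Longrightarrow> dird (\<lambda>x. f x + g x) h (\<lambda>x. f' x + g' x)"
  unfolding dird_def by (auto intro: DERIV_add)

lemma dird_diff: "dird f h f' \<Longrightarrow> dird g h g' \<Longrightarrow> dird (\<lambda>x. f x - g x) h (\<lambda>x. f' x - g' x)"
  unfolding dird_def by (auto intro: DERIV_diff)

lemma dird_cmult: "dird f h f' \<Longrightarrow> dird (\<lambda>x. c * f x) h (\<lambda>x. c * f' x)"
  unfolding dird_def by (auto intro: DERIV_cmult)

lemma dird_mult:
  "dird f h f' \<Longrightarrow> dird g h g' \<Longrightarrow> dird (\<lambda>x. f x * g x) h (\<lambda>x. f' x * g x + f x * g' x)"
  unfolding dird_def by (auto intro!: derivative_eq_intros)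

lemma dird_sum:
  "(\<And>j. j \<in> J \<Longrightarrow> dird (f j) h (f' j)) \<Longrightarrow> dird (\<lambda>x. \<Sum>j\<in>J. f j x) h (\<lambda>x. \<Sum>j\<in>J. f' j x)"
  unfolding dird_def by (auto intro!: DERIV_sum)

lemma dird_coord: "dird (\<lambda>x. x j) h (\<lambda>x. h j)"
  unfolding dird_def by (auto intro!: derivative_eq_intros)

lemma dird_compose:
  assumes "dird g h g'" "\<And>s. (f has_real_derivative f' s) (at s)"
  shows "dird (\<lambda>x. f (g x)) h (\<lambda>x. f' (g x) * g' x)"
  unfolding dird_def
proof
  fix x
  have "((\<lambda>t. g (\<lambda>i. x i + t * h i)) has_real_derivative g' x) (at 0)"
    using assms(1) unfolding dird_def by blast
  from DERIV_chain2[where f = f and g = "\<lambda>t. g (\<lambda>i. x i + t * h i)", OF assms(2) this]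
  show "((\<lambda>t. f (g (\<lambda>i. x i + t * h i))) has_real_derivative f' (g x) * g' x) (at 0)"
    by simp
qed

lemma norm_Rd_scale: "norm_Rd d (\<lambda>i. t * x i) = \<bar>t\<bar> * norm_Rd d x"
proof -
  have "norm_Rd d (\<lambda>i. t * x i) = sqrt (t\<^sup>2 * (\<Sum>i<d. (x i)\<^sup>2))"
    by (simp add: L2_set_def power_mult_distrib sum_distrib_left)
  also have "\<dots> = \<bar>t\<bar> * norm_Rd d x"
    by (simp add: L2_set_def real_sqrt_mult)
  finally show ?thesis .
qed

lemma dot_le_norm_Rd: "\<bar>\<Sum>i<d. x i * y i\<bar> \<le> norm_Rd d x * norm_Rd d y"
proof -
  have "\<bar>\<Sum>i<d. x i * y i\<bar> \<le> (\<Sum>i<d. \<bar>x i\<bar> * \<bar>y i\<bar>)"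
    by (rule order_trans[OF sum_abs]) (simp add: abs_mult)
  also have "\<dots> \<le> norm_Rd d x * norm_Rd d y"
    by (rule L2_set_mult_ineq)
  finally show ?thesis .
qed

lemma sum_abs_le_norm_Rd: "(\<Sum>i<d. \<bar>x i\<bar>) \<le> sqrt (real d) * norm_Rd d x"
proof -
  have "(\<Sum>i<d. \<bar>1\<bar> * \<bar>x i\<bar>) \<le> norm_Rd d (\<lambda>_. 1) * norm_Rd d x"
    by (rule L2_set_mult_ineq)
  then show ?thesis by (simp add: L2_set_def)
qed

text \<open>\<open>C n\<close> majorises the n-fold directional derivatives on \<open>S\<close>,
  each direction contributing its Euclidean norm as a factor. Existence is required everywhere, the
  bounds only on \<open>S\<close>. The derivative is a separate witness for every direction:
  linearity in the direction is not demanded, which keeps sums and products easy.\<close>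

primrec bdd_derivs ::
    "nat \<Rightarrow> (nat \<Rightarrow> real) set \<Rightarrow> nat \<Rightarrow> (nat \<Rightarrow> real) \<Rightarrow> ((nat \<Rightarrow> real) \<Rightarrow> real) \<Rightarrow> bool" where
  "bdd_derivs d S 0 C g \<longleftrightarrow> (\<forall>x\<in>S. \<bar>g x\<bar> \<le> C 0)"
| "bdd_derivs d S (Suc k) C g \<longleftrightarrow> (\<forall>x\<in>S. \<bar>g x\<bar> \<le> C 0) \<and>
     (\<forall>h. \<exists>g'. dird g h g' \<and> bdd_derivs d S k (\<lambda>n. C (Suc n) * norm_Rd d h) g')"

lemma bdd_derivs_0: "bdd_derivs d S k C g \<Longrightarrow> x \<in> S \<Longrightarrow> \<bar>g x\<bar> \<le> C 0"
  by (cases k) auto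

lemma bdd_derivs_mono:
  "bdd_derivs d S k C g \<Longrightarrow> (\<And>n. n \<le> k \<Longrightarrow> C n \<le> D n) \<Longrightarrow> bdd_derivs d S k D g"
proof (induction k arbitrary: C D g)
  case 0
  then show ?case by force
next
  case (Suc k)
  have "\<exists>g'. dird g h g' \<and> bdd_derivs d S k (\<lambda>n. D (Suc n) * norm_Rd d h) g'" for h
  proof -
    obtain g' where g': "dird g h g'" "bdd_derivs d S k (\<lambda>n. C (Suc n) * norm_Rd d h) g'"
      using Suc.prems(1) by auto
    have "bdd_derivs d S k (\<lambda>n. D (Suc n) * norm_Rd d h) g'"
      by (rule Suc.IH[OF g'(2)]) (simp add: Suc.prems(2) mult_right_mono)
    with g' show ?thesis by blast
  qed
  moreover have "C 0 \<le> D 0" using Suc.prems(2) by simp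
  ultimately show ?case using Suc.prems(1) by fastforce
qed

lemma bdd_derivs_Suc: "bdd_derivs d S (Suc k) C g \<Longrightarrow> bdd_derivs d S k C g"
proof (induction k arbitrary: C g)
  case 0
  then show ?case by simp
next
  case (Suc k)
  then show ?case by (subst bdd_derivs.simps) (metis bdd_derivs.simps(2))
qed

lemma bdd_derivs_add:
  "bdd_derivs d S k C f \<Longrightarrow> bdd_derivs d S k D g \<Longrightarrow>
     bdd_derivs d S k (\<lambda>n. C n + D n) (\<lambda>x. f x + g x)"
proof (induction k arbitrary: C D f g)
  case 0
  then show ?case by (auto intro!: order_trans[OF abs_triangle_ineq] add_mono)
next
  case (Suc k)
  have "\<exists>k'. dird (\<lambda>x. f x + g x) h k' \<and>
      bdd_derivs d S k (\<lambda>n. (C (Suc n) + D (Suc n)) * norm_Rd d h) k'" for h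
  proof -
    obtain f' where f': "dird f h f'" "bdd_derivs d S k (\<lambda>n. C (Suc n) * norm_Rd d h) f'"
      using Suc.prems(1) by auto
    obtain g' where g': "dird g h g'" "bdd_derivs d S k (\<lambda>n. D (Suc n) * norm_Rd d h) g'"
      using Suc.prems(2) by auto
    show ?thesis
      using dird_add[OF f'(1) g'(1)] Suc.IH[OF f'(2) g'(2)] by (auto simp: distrib_right)
  qed
  moreover have "\<forall>x\<in>S. \<bar>f x + g x\<bar> \<le> C 0 + D 0"
    using Suc.prems by (auto intro!: order_trans[OF abs_triangle_ineq] add_mono)
  ultimately show ?case by simp
qed

text \<open>Pascal's rule, read as the Leibniz rule for majorants: differentiating a product shifts
  either \<open>C\<close> or \<open>D\<close> by one.\<close>

lemma binomial_convolution_Suc: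
  fixes C D :: "nat \<Rightarrow> real"
  shows "(\<Sum>i\<le>Suc n. real (Suc n choose i) * C i * D (Suc n - i)) =
    (\<Sum>i\<le>n. real (n choose i) * C (Suc i) * D (n - i)) +
    (\<Sum>i\<le>n. real (n choose i) * C i * D (Suc (n - i)))"
proof -
  have "(\<Sum>i\<le>n. real (n choose i) * C i * D (Suc (n - i))) =
      (\<Sum>i\<le>Suc n. real (n choose i) * C i * D (Suc n - i))"
    by (simp add: Suc_diff_le)
  also have "\<dots> = C 0 * D (Suc n) +
      (\<Sum>i\<le>n. real (n choose Suc i) * C (Suc i) * D (n - i))"
    by (subst sum.atMost_Suc_shift) simp
  finally have *: "(\<Sum>i\<le>n. real (n choose i) * C i * D (Suc (n - i))) = \<dots>" .
  show ?thesis
    by (subst *, subst sum.atMost_Suc_shift) (simp add: sum.distrib[symmetric] algebra_simps)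
qed

text \<open>The binomial weights are kept, because the later estimate plays the order of one factor
  off against the complementary order of the other.\<close>

lemma bdd_derivs_mult:
  "bdd_derivs d S k C f \<Longrightarrow> bdd_derivs d S k D g \<Longrightarrow>
     bdd_derivs d S k (\<lambda>n. \<Sum>i\<le>n. real (n choose i) * C i * D (n - i)) (\<lambda>x. f x * g x)"
proof (induction k arbitrary: C D f g)
  case 0
  then show ?case by (auto simp: abs_mult intro!: mult_mono order_trans[OF abs_ge_zero])
next
  case (Suc k)
  have *: "\<exists>k'. dird (\<lambda>x. f x * g x) h k' \<and>
      bdd_derivs d S k (\<lambda>n. (\<Sum>i\<le>Suc n. real (Suc n choose i) * C i * D (Suc n - i)) * norm_Rd d h) k'"
    for h
  proof -
    obtain f' where f': "dird f h f'" "bdd_derivs d S k (\<lambda>n. C (Suc n) * norm_Rd d h) f'"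
      using Suc.prems(1) by auto
    obtain g' where g': "dird g h g'" "bdd_derivs d S k (\<lambda>n. D (Suc n) * norm_Rd d h) g'"
      using Suc.prems(2) by auto
    have 1: "bdd_derivs d S k C f" "bdd_derivs d S k D g"
      using Suc.prems by (auto intro: bdd_derivs_Suc)
    have "bdd_derivs d S k (\<lambda>n. (\<Sum>i\<le>n. real (n choose i) * (C (Suc i) * norm_Rd d h) * D (n - i)) +
         (\<Sum>i\<le>n. real (n choose i) * C i * (D (Suc (n - i)) * norm_Rd d h)))
        (\<lambda>x. f' x * g x + f x * g' x)"
      using bdd_derivs_add[OF Suc.IH[OF f'(2) 1(2)] Suc.IH[OF 1(1) g'(2)]] .
    also have "(\<lambda>n. (\<Sum>i\<le>n. real (n choose i) * (C (Suc i) * norm_Rd d h) * D (n - i)) +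
         (\<Sum>i\<le>n. real (n choose i) * C i * (D (Suc (n - i)) * norm_Rd d h))) =
        (\<lambda>n. (\<Sum>i\<le>Suc n. real (Suc n choose i) * C i * D (Suc n - i)) * norm_Rd d h)"
      unfolding binomial_convolution_Suc by (simp add: distrib_right sum_distrib_left sum_distrib_right distrib_left mult_ac)
    finally show ?thesis using dird_mult[OF f'(1) g'(1)] by blast
  qed
  have "\<forall>x\<in>S. \<bar>f x * g x\<bar> \<le> C 0 * D 0"
    using Suc.prems by (auto simp: abs_mult intro!: mult_mono order_trans[OF abs_ge_zero])
  with * show ?case by (simp only: bdd_derivs.simps) simp
qed

lemma bdd_derivs_const:
  "\<bar>c\<bar> \<le> C 0 \<Longrightarrow> (\<And>n. 0 \<le> C n) \<Longrightarrow> bdd_derivs d S k C (\<lambda>x. c)"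
proof (induction k arbitrary: c C)
  case 0
  then show ?case by simp
next
  case (Suc k)
  have "bdd_derivs d S k (\<lambda>n. C (Suc n) * norm_Rd d h) (\<lambda>x. 0)" for h
    by (rule Suc.IH) (simp_all add: Suc.prems)
  then show ?case using dird_const[of c] Suc.prems by auto
qed

text \<open>A derivative along \<open>h\<close> produces \<open>\<Psi> (Suc j)\<close> times the
  linear form 2<x,h>. So the induction runs over all \<open>j\<close> at once, and each step is a
  Leibniz rule whose second factor has only two non-zero orders.\<close>

lemma bdd_derivs_compose_norm_square:
  fixes R a :: real
  assumes deriv: "\<And>j s. j < p \<Longrightarrow> (\<Psi> j has_real_derivative \<Psi> (Suc j) s) (at s)"
    and bound: "\<And>j s. j \<le> p \<Longrightarrow> \<bar>\<Psi> j s\<bar> \<le> a ^ j"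
    and a: "real p \<le> a" and R: "1 \<le> R"
  shows "j + k \<le> p \<Longrightarrow> bdd_derivs d {x. norm_Rd d x \<le> R} k (\<lambda>n. a ^ j * (4 * a * R) ^ n)
           (\<lambda>x. \<Psi> j (\<Sum>i<d. (x i)\<^sup>2))"
proof (induction k arbitrary: j)
  case 0
  then show ?case using bound by simp
next
  case (Suc k)
  let ?S = "{x. norm_Rd d x \<le> R}" and ?q = "\<lambda>x::nat \<Rightarrow> real. \<Sum>i<d. (x i)\<^sup>2"
  have a0: "0 \<le> a" using a by simp
  have "\<exists>g'. dird (\<lambda>x. \<Psi> j (?q x)) h g' \<and>
      bdd_derivs d ?S k (\<lambda>n. a ^ j * (4 * a * R) ^ Suc n * norm_Rd d h) g'" for h
  proof (intro exI conjI)
    have "dird ?q h (\<lambda>x. \<Sum>i<d. 2 * x i * h i)"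
      unfolding power2_eq_square
    proof (rule dird_sum)
      fix i show "dird (\<lambda>x. x i * x i) h (\<lambda>x. 2 * x i * h i)"
        using dird_mult[OF dird_coord[of i] dird_coord[of i], of h] by (simp add: algebra_simps)
    qed
    then show "dird (\<lambda>x. \<Psi> j (?q x)) h (\<lambda>x. \<Psi> (Suc j) (?q x) * (\<Sum>i<d. 2 * x i * h i))"
      using Suc.prems by (intro dird_compose deriv) auto
    let ?L = "\<lambda>n. if n = 0 then 2 * R * norm_Rd d h else if n = 1 then 2 * norm_Rd d h else 0"
    have L: "bdd_derivs d ?S k ?L (\<lambda>x. \<Sum>i<d. 2 * x i * h i)"
    proof -
      have lin: "\<bar>\<Sum>i<d. 2 * x i * h i\<bar> \<le> ?L 0" if "x \<in> ?S" for x
      proof -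
        have "\<bar>\<Sum>i<d. 2 * x i * h i\<bar> = 2 * \<bar>\<Sum>i<d. x i * h i\<bar>"
          by (simp add: sum_distrib_left[symmetric] mult.assoc abs_mult)
        also have "\<dots> \<le> 2 * (norm_Rd d x * norm_Rd d h)"
          using dot_le_norm_Rd by simp
        also have "\<dots> \<le> 2 * (R * norm_Rd d h)"
          using that by (intro mult_left_mono mult_right_mono) auto
        finally show ?thesis by simp
      qed
      show ?thesis
      proof (cases k)
        case 0
        then show ?thesis using lin by simp
      next
        case (Suc m)
        have "\<exists>g'. dird (\<lambda>x. \<Sum>i<d. 2 * x i * h i) e g' \<and>
            bdd_derivs d ?S m (\<lambda>n. ?L (Suc n) * norm_Rd d e) g'" for e
        proof (intro exI conjI)
          show "dird (\<lambda>x. \<Sum>i<d. 2 * x i * h i) e (\<lambda>x. \<Sum>i<d. 2 * e i * h i)"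
          proof (rule dird_sum)
            fix i show "dird (\<lambda>x. 2 * x i * h i) e (\<lambda>x. 2 * e i * h i)"
              using dird_cmult[OF dird_coord[of i], of "2 * h i" e] by (simp add: mult_ac)
          qed
          have "\<bar>\<Sum>i<d. 2 * e i * h i\<bar> = 2 * \<bar>\<Sum>i<d. e i * h i\<bar>"
            by (simp add: sum_distrib_left[symmetric] mult.assoc abs_mult)
          also have "\<dots> \<le> 2 * (norm_Rd d e * norm_Rd d h)"
            using dot_le_norm_Rd by simp
          finally show "bdd_derivs d ?S m (\<lambda>n. ?L (Suc n) * norm_Rd d e) (\<lambda>x. \<Sum>i<d. 2 * e i * h i)"
            by (intro bdd_derivs_const) (auto simp: mult_ac)
        qed
        then show ?thesis using lin unfolding Suc bdd_derivs.simps by blast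
      qed
    qed
    have "bdd_derivs d ?S k (\<lambda>n. a ^ Suc j * (4 * a * R) ^ n) (\<lambda>x. \<Psi> (Suc j) (?q x))"
      by (rule Suc.IH) (use Suc.prems in simp)
    from bdd_derivs_mult[OF this L]
    show "bdd_derivs d ?S k (\<lambda>n. a ^ j * (4 * a * R) ^ Suc n * norm_Rd d h)
        (\<lambda>x. \<Psi> (Suc j) (?q x) * (\<Sum>i<d. 2 * x i * h i))"
    proof (rule bdd_derivs_mono)
      fix n assume n: "n \<le> k"
      let ?b = "4 * a * R" and ?f = "\<lambda>i. real (n choose i) * (a ^ Suc j * (4 * a * R) ^ i) * ?L (n - i)"
      have b0: "0 \<le> ?b" using a0 R by simp
      show "(\<Sum>i\<le>n. ?f i) \<le> a ^ j * ?b ^ Suc n * norm_Rd d h"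
      proof (cases n)
        case 0
        have "a * (2 * R) \<le> 4 * a * R" using a0 R by simp
        then have "a ^ j * (a * (2 * R)) * norm_Rd d h \<le> a ^ j * (4 * a * R) * norm_Rd d h"
          using a0 by (intro mult_right_mono mult_left_mono) auto
        then show ?thesis using 0 by (simp add: mult_ac)
      next
        case (Suc m)
        have "(\<Sum>i\<le>n. ?f i) = ?f n + ?f m + (\<Sum>i<m. ?f i)"
          unfolding Suc by (simp add: lessThan_Suc_atMost[symmetric])
        also have "(\<Sum>i<m. ?f i) = 0"
          by (rule sum.neutral) (auto simp: Suc)
        finally have "(\<Sum>i\<le>n. ?f i) = a ^ j * ?b ^ m * norm_Rd d h * (2 * a * R * ?b + real n * 2 * a)"
          unfolding Suc by (simp add: algebra_simps)
        \<comment> \<open>Only i = n and i = n - 1 survive. With n \<le> p \<le> a and 1 \<le> R the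
          left side is at most 10 a^2 R^2, the right side is 16 a^2 R^2; this is the room provided
          by the factor 4 in \<open>4 * a * R\<close>.\<close>
        moreover have "2 * a * R * ?b + real n * 2 * a \<le> ?b * ?b"
        proof -
          have "real n \<le> a" using n Suc.prems a \<open>n = Suc m\<close> by simp
          then have "real n * 2 * a \<le> 2 * (a * a)" using a0 by (simp add: mult_right_mono)
          also have "\<dots> \<le> 2 * (a * a) * (R * R)"
            using mult_left_mono[of 1 "R * R" "2 * (a * a)"] R mult_mono[of 1 R 1 R] by simp
          moreover have "0 \<le> (a * a) * (R * R)" by simp
          ultimately show ?thesis by (simp add: algebra_simps)
        qed
        ultimately have "(\<Sum>i\<le>n. ?f i) \<le> a ^ j * ?b ^ m * norm_Rd d h * (?b * ?b)"
          using a0 b0 by (simp add: mult_left_mono)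
        then show ?thesis using Suc by (simp add: mult_ac)
      qed
    qed
  qed
  moreover have "\<forall>x\<in>?S. \<bar>\<Psi> j (?q x)\<bar> \<le> a ^ j * (4 * a * R) ^ 0"
    using bound Suc.prems by simp
  ultimately show ?case unfolding bdd_derivs.simps by blast
qed

section \<open>Functions vanishing to a given order at the origin\<close>

text \<open>The Taylor polynomial of order below \<open>k\<close> at the origin is zero and the k-th
  derivatives are bounded globally; directions again enter only through their norms.\<close>

primrec vanishing :: "nat \<Rightarrow> nat \<Rightarrow> real \<Rightarrow> ((nat \<Rightarrow> real) \<Rightarrow> real) \<Rightarrow> bool" where
  "vanishing d 0 M g \<longleftrightarrow> (\<forall>x. \<bar>g x\<bar> \<le> M)"
| "vanishing d (Suc k) M g \<longleftrightarrow> g (\<lambda>_. 0) = 0 \<and>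
     (\<forall>h. \<exists>g'. dird g h g' \<and> vanishing d k (M * norm_Rd d h) g')"

text \<open>Induction on the order along the segment t x: the derivative is bounded by that of M
  r^(k+1) t^(k+1) / (k+1)!, so subtracting this function gives a decreasing function on [0,1] and
  adding it an increasing one.\<close>

lemma vanishing_bound: "vanishing d k M g \<Longrightarrow> \<bar>g x\<bar> \<le> M * norm_Rd d x ^ k / fact k"
proof (induction k arbitrary: g M x)
  case 0
  then show ?case by simp
next
  case (Suc k)
  let ?r = "norm_Rd d x"
  obtain g' where g': "dird g x g'" "vanishing d k (M * ?r) g'"
    using Suc.prems by auto
  let ?\<phi> = "\<lambda>t. g (\<lambda>i. t * x i)" and ?\<psi> = "\<lambda>t. M * ?r ^ Suc k / fact (Suc k) * t ^ Suc k"
  have d\<phi>: "(?\<phi> has_real_derivative g' (\<lambda>i. t * x i)) (at t)" for t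
    using dird_at[OF g'(1), of "\<lambda>_. 0"] by simp
  have d\<psi>: "(?\<psi> has_real_derivative M * ?r * (t * ?r) ^ k / fact k) (at t)" for t
  proof -
    have "(?\<psi> has_real_derivative M * ?r ^ Suc k / fact (Suc k) * (real (Suc k) * t ^ k)) (at t)"
      by (rule derivative_eq_intros refl)+ simp
    moreover have "M * ?r ^ Suc k / fact (Suc k) * (real (Suc k) * t ^ k) = M * ?r * (t * ?r) ^ k / fact k"
      unfolding fact_Suc power_mult_distrib by (simp del: of_nat_Suc)
    ultimately show ?thesis by (simp only:)
  qed
  have b: "\<bar>g' (\<lambda>i. t * x i)\<bar> \<le> M * ?r * (t * ?r) ^ k / fact k" if "0 \<le> t" for t
    using Suc.IH[OF g'(2), of "\<lambda>i. t * x i"] that by (simp add: norm_Rd_scale)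
  have "?\<phi> 1 - ?\<psi> 1 \<le> ?\<phi> 0 - ?\<psi> 0"
  proof (rule DERIV_nonpos_imp_nonincreasing[of 0 1 "\<lambda>t. ?\<phi> t - ?\<psi> t"])
    fix t :: real assume "0 \<le> t" "t \<le> 1"
    have "((\<lambda>t. ?\<phi> t - ?\<psi> t) has_real_derivative g' (\<lambda>i. t * x i) - M * ?r * (t * ?r) ^ k / fact k) (at t)"
      by (rule DERIV_diff[OF d\<phi> d\<psi>])
    moreover have "(g' (\<lambda>i. t * x i) - M * ?r * (t * ?r) ^ k / fact k) \<le> 0"
      using b[OF \<open>0 \<le> t\<close>] by simp
    ultimately show "\<exists>y. ((\<lambda>t. ?\<phi> t - ?\<psi> t) has_real_derivative y) (at t) \<and> y \<le> 0"
      by blast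
  qed simp
  moreover have "?\<phi> 0 + ?\<psi> 0 \<le> ?\<phi> 1 + ?\<psi> 1"
  proof (rule DERIV_nonneg_imp_nondecreasing[of 0 1 "\<lambda>t. ?\<phi> t + ?\<psi> t"])
    fix t :: real assume "0 \<le> t" "t \<le> 1"
    have "((\<lambda>t. ?\<phi> t + ?\<psi> t) has_real_derivative g' (\<lambda>i. t * x i) + M * ?r * (t * ?r) ^ k / fact k) (at t)"
      by (rule DERIV_add[OF d\<phi> d\<psi>])
    moreover have "0 \<le> (g' (\<lambda>i. t * x i) + M * ?r * (t * ?r) ^ k / fact k)"
      using b[OF \<open>0 \<le> t\<close>] by simp
    ultimately show "\<exists>y. ((\<lambda>t. ?\<phi> t + ?\<psi> t) has_real_derivative y) (at t) \<and> 0 \<le> y"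
      by blast
  qed simp
  ultimately show ?case using Suc.prems by simp
qed

text \<open>An n-fold derivative still vanishes to order k - n and so inherits 1/(k - n)!; these
  factorials later absorb the growth of the derivatives of the cutoff.\<close>

lemma vanishing_imp_bdd_derivs:
  "vanishing d k M g \<Longrightarrow> 0 \<le> M \<Longrightarrow>
    bdd_derivs d {x. norm_Rd d x \<le> R} k (\<lambda>n. M * R ^ (k - n) / fact (k - n)) g"
proof (induction k arbitrary: g M)
  case 0
  then show ?case by simp
next
  case (Suc k)
  have "\<bar>g x\<bar> \<le> M * R ^ Suc k / fact (Suc k)" if "norm_Rd d x \<le> R" for x
    using that Suc.prems(2)
    by (intro order_trans[OF vanishing_bound[OF Suc.prems(1)]] divide_right_mono mult_left_mono power_mono)
      auto
  moreover have "\<exists>g'. dird g h g' \<and> bdd_derivs d {x. norm_Rd d x \<le> R} k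
      (\<lambda>n. M * R ^ (k - n) / fact (k - n) * norm_Rd d h) g'" for h
  proof -
    obtain g' where g': "dird g h g'" "vanishing d k (M * norm_Rd d h) g'"
      using Suc.prems by auto
    then show ?thesis using Suc.IH[OF g'(2)] Suc.prems(2) by (auto simp: mult_ac)
  qed
  ultimately show ?case by simp
qed

section \<open>Cutoff and periodisation\<close>

text \<open>A ramp from 1 to 0 on [2,3] is smoothed p times by a moving average of half-width h =
  1/p. The derivative of an average is a central difference quotient, so j derivatives of a function
  with values in [-1,1] cost (1/h)^j = p^j. The p averages blur each corner by p h = 1, which widens
  [2,3] to [1,4].\<close>

lemma exists_cutoff:
  assumes "1 \<le> p"
  obtains \<Psi> :: "nat \<Rightarrow> real \<Rightarrow> real" where
    "\<And>j s. j < p \<Longrightarrow> (\<Psi> j has_real_derivative \<Psi> (Suc j) s) (at s)"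
    "\<And>j s. j \<le> p \<Longrightarrow> \<bar>\<Psi> j s\<bar> \<le> real p ^ j"
    "\<And>s. s \<le> 1 \<Longrightarrow> \<Psi> 0 s = 1"
    "\<And>s. 4 \<le> s \<Longrightarrow> \<Psi> 0 s = 0"
proof -
  define h where "h = 1 / real p"
  have h: "0 < h" "real p * h = 1" using assms by (auto simp: h_def)
  define \<delta> :: "(real \<Rightarrow> real) \<Rightarrow> real \<Rightarrow> real" where "\<delta> = (\<lambda>f s. (f (s + h) - f (s - h)) / (2 * h))"
  define P :: "nat \<Rightarrow> (real \<Rightarrow> real) \<Rightarrow> bool" where
    "P = (\<lambda>n f. continuous_on UNIV f \<and> (\<forall>s. \<bar>f s\<bar> \<le> 1 \<and> (s \<le> 2 - real n * h \<longrightarrow> f s = 1) \<and>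
       (3 + real n * h \<le> s \<longrightarrow> f s = 0)))"
  have "\<exists>f. P 0 f"
    by (rule exI[of _ "\<lambda>s. max 0 (min 1 (3 - s))"]) (auto simp: P_def intro!: continuous_intros)
  moreover have "\<exists>g. P (Suc n) g \<and> (\<forall>s. (g has_real_derivative \<delta> f s) (at s))" if "P n f" for n f
  proof -
    have "continuous_on UNIV f" using that by (simp add: P_def)
    then have "\<exists>F. \<forall>x::real. -\<infinity> < ereal x \<longrightarrow> ereal x < \<infinity> \<longrightarrow> (F has_vector_derivative f x) (at x)"
      by (intro einterval_antiderivative) (auto simp: continuous_on_eq_continuous_at)
    then obtain G where G: "\<And>s. (G has_real_derivative f s) (at s)"
      by (auto simp: has_real_derivative_iff_has_vector_derivative)
    define g where "g = (\<lambda>s. (G (s + h) - G (s - h)) / (2 * h))"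
    have g': "(g has_real_derivative \<delta> f s) (at s)" for s
    proof -
      have 1: "((\<lambda>s. G (s + h)) has_real_derivative f (s + h)) (at s)"
        using G[of "s + h"] by (subst (asm) DERIV_shift)
      have 2: "((\<lambda>s. G (s - h)) has_real_derivative f (s - h)) (at s)"
        using G[of "s + (- h)"] by (subst (asm) DERIV_shift) simp
      show ?thesis
        unfolding g_def \<delta>_def by (rule DERIV_cdivide[OF DERIV_diff[OF 1 2]])
    qed
    \<comment> \<open>An average is a value of \<open>f\<close> at some point within distance h, so
      the bound persists and each plateau recedes by only h.\<close>
    have mvt: "\<exists>\<xi>. s - h < \<xi> \<and> \<xi> < s + h \<and> g s = f \<xi>" for s
    proof -
      have "\<exists>z. s - h < z \<and> z < s + h \<and> G (s + h) - G (s - h) = (s + h - (s - h)) * f z"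
        using h by (intro MVT2 G) auto
      then obtain z where "s - h < z" "z < s + h" "G (s + h) - G (s - h) = 2 * h * f z" by auto
      then show ?thesis using h by (intro exI[of _ z]) (simp add: g_def)
    qed
    have "continuous_on UNIV g"
      using g' by (meson DERIV_continuous_on)
    moreover have "\<bar>g s\<bar> \<le> 1 \<and> (s \<le> 2 - real (Suc n) * h \<longrightarrow> g s = 1) \<and>
       (3 + real (Suc n) * h \<le> s \<longrightarrow> g s = 0)" for s
    proof -
      obtain \<xi> where "s - h < \<xi>" "\<xi> < s + h" "g s = f \<xi>" using mvt by blast
      with that show ?thesis unfolding P_def by (auto simp: algebra_simps)
    qed
    ultimately show ?thesis using g' unfolding P_def by blast
  qed
  ultimately obtain F where F: "\<And>n. P n (F n)"
      "\<And>n s. (F (Suc n) has_real_derivative \<delta> (F n) s) (at s)"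
    using dependent_nat_choice[of P "\<lambda>_ f g. \<forall>s. (g has_real_derivative \<delta> f s) (at s)"] by metis
  \<comment> \<open>Each derivative of \<open>F p\<close> replaces one average by one difference
    quotient, leaving p - j averages.\<close>
  define \<Psi> where "\<Psi> = (\<lambda>j. (\<delta> ^^ j) (F (p - j)))"
  have step: "((\<delta> ^^ j) f has_real_derivative (\<delta> ^^ j) f' s) (at s)"
    if "\<And>s. (f has_real_derivative f' s) (at s)" for f f' j s
  proof (induction j arbitrary: s)
    case 0
    then show ?case using that by simp
  next
    case (Suc j)
    have 1: "((\<lambda>s. (\<delta> ^^ j) f (s + h)) has_real_derivative (\<delta> ^^ j) f' (s + h)) (at s)"
      using Suc[of "s + h"] by (subst (asm) DERIV_shift)
    have 2: "((\<lambda>s. (\<delta> ^^ j) f (s - h)) has_real_derivative (\<delta> ^^ j) f' (s - h)) (at s)"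
      using Suc[of "s + (- h)"] by (subst (asm) DERIV_shift) simp
    have "((\<lambda>s. ((\<delta> ^^ j) f (s + h) - (\<delta> ^^ j) f (s - h)) / (2 * h)) has_real_derivative
        ((\<delta> ^^ j) f' (s + h) - (\<delta> ^^ j) f' (s - h)) / (2 * h)) (at s)"
      by (rule DERIV_cdivide[OF DERIV_diff[OF 1 2]])
    then show ?case by (simp add: \<delta>_def)
  qed
  have bound: "\<bar>(\<delta> ^^ j) f s\<bar> \<le> real p ^ j" if "\<And>s. \<bar>f s\<bar> \<le> 1" for f j s
  proof (induction j arbitrary: s)
    case 0
    then show ?case using that by simp
  next
    case (Suc j)
    have "\<bar>(\<delta> ^^ j) f (s + h) - (\<delta> ^^ j) f (s - h)\<bar> \<le> real p ^ j + real p ^ j"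
      by (rule order_trans[OF abs_triangle_ineq4 add_mono[OF Suc Suc]])
    then have "\<bar>(\<delta> ^^ j) f (s + h) - (\<delta> ^^ j) f (s - h)\<bar> / (2 * h) \<le> (2 * real p ^ j) / (2 * h)"
      using h by (intro divide_right_mono) auto
    also have "\<dots> = real p ^ Suc j" by (simp add: h_def)
    finally show ?case using h by (simp add: \<delta>_def abs_divide)
  qed
  show ?thesis
  proof (rule that[of \<Psi>])
    fix j s assume "j < p"
    then have "p - j = Suc (p - Suc j)" by simp
    then show "(\<Psi> j has_real_derivative \<Psi> (Suc j) s) (at s)"
      using step[OF F(2)[of "p - Suc j"], of j s] by (simp add: \<Psi>_def funpow_swap1)
  next
    fix j s assume "j \<le> p"
    show "\<bar>\<Psi> j s\<bar> \<le> real p ^ j"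
      unfolding \<Psi>_def by (rule bound) (use F(1) in \<open>simp add: P_def\<close>)
  next
    fix s :: real assume "s \<le> 1"
    then show "\<Psi> 0 s = 1" using F(1)[of p] h by (simp add: \<Psi>_def P_def)
  next
    fix s :: real assume "4 \<le> s"
    then show "\<Psi> 0 s = 0" using F(1)[of p] h by (simp add: \<Psi>_def P_def)
  qed
qed

section \<open>Periodisation of functions supported in a ball of radius below \<pi>\<close>

definition depends_on :: "nat \<Rightarrow> ((nat \<Rightarrow> real) \<Rightarrow> real) \<Rightarrow> bool" where
  "depends_on d g \<longleftrightarrow> (\<forall>x y. (\<forall>i<d. x i = y i) \<longrightarrow> g x = g y)"

lemma dird_depends_on:
  assumes "dird g h g'" "depends_on d g"
  shows "depends_on d g'"
  unfolding depends_on_def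
proof (intro allI impI)
  fix x y :: "nat \<Rightarrow> real" assume "\<forall>i<d. x i = y i"
  then have "(\<lambda>t. g (\<lambda>i. x i + t * h i)) = (\<lambda>t. g (\<lambda>i. y i + t * h i))"
    using assms(2) unfolding depends_on_def by (intro ext) simp
  moreover have "((\<lambda>t. g (\<lambda>i. x i + t * h i)) has_real_derivative g' x) (at 0)"
      "((\<lambda>t. g (\<lambda>i. y i + t * h i)) has_real_derivative g' y) (at 0)"
    using assms(1) unfolding dird_def by blast+
  ultimately show "g' x = g' y" by (simp add: DERIV_unique)
qed

lemma dird_vanishing_outside:
  assumes "dird g h g'" "\<And>x. r < norm_Rd d x \<Longrightarrow> g x = 0" "r < norm_Rd d x"
  shows "g' x = 0"
proof -
  have "((\<lambda>t. norm_Rd d (\<lambda>i. x i + t * h i)) \<longlongrightarrow> norm_Rd d (\<lambda>i. x i + 0 * h i)) (nhds (0::real))"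
    unfolding L2_set_def by (auto intro!: tendsto_eq_intros filterlim_ident)
  then have "eventually (\<lambda>t. r < norm_Rd d (\<lambda>i. x i + t * h i)) (nhds (0::real))"
    using assms(3) by (intro order_tendstoD(1)) auto
  then have ev: "eventually (\<lambda>t. g (\<lambda>i. x i + t * h i) = 0) (nhds (0::real))"
    by eventually_elim (use assms(2) in auto)
  have "((\<lambda>t::real. 0::real) has_real_derivative 0) (at 0)" by simp
  then have "((\<lambda>t. g (\<lambda>i. x i + t * h i)) has_real_derivative 0) (at 0)"
    using DERIV_cong_ev[OF refl ev refl] by blast
  moreover have "((\<lambda>t. g (\<lambda>i. x i + t * h i)) has_real_derivative g' x) (at 0)"
    using assms(1) unfolding dird_def by blast
  ultimately show ?thesis by (metis DERIV_unique)
qed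

text \<open>The representative of t modulo 2 \<pi> in [-\<pi>, \<pi>).\<close>

definition wrap :: "real \<Rightarrow> real" where
  "wrap t = t - 2 * pi * of_int \<lfloor>(t + pi) / (2 * pi)\<rfloor>"

lemma wrap_eq: "- pi \<le> y \<Longrightarrow> y < pi \<Longrightarrow> wrap (y + 2 * pi * of_int z) = y"
proof -
  assume "- pi \<le> y" "y < pi"
  then have "\<lfloor>(y + 2 * pi * of_int z + pi) / (2 * pi)\<rfloor> = z"
    by (intro floor_unique) (auto simp: field_simps)
  then show ?thesis by (simp add: wrap_def)
qed

lemma wrap_decomp: obtains z where "t = wrap t + 2 * pi * of_int z"
  by (simp add: wrap_def)

lemma wrap_bounds: "- pi \<le> wrap t" "wrap t < pi"
proof -
  have "of_int \<lfloor>(t + pi) / (2 * pi)\<rfloor> \<le> (t + pi) / (2 * pi)"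
    "(t + pi) / (2 * pi) < of_int \<lfloor>(t + pi) / (2 * pi)\<rfloor> + 1" by linarith+
  then have "of_int \<lfloor>(t + pi) / (2 * pi)\<rfloor> * (2 * pi) \<le> t + pi"
    "t + pi < (of_int \<lfloor>(t + pi) / (2 * pi)\<rfloor> + 1) * (2 * pi)"
    by (simp_all only: pos_le_divide_eq pos_divide_less_eq pi_gt_zero zero_less_mult_iff zero_less_numeral simp_thms)
  then show "- pi \<le> wrap t" "wrap t < pi" by (simp_all add: wrap_def algebra_simps)
qed

lemma wrap_periodic: "wrap (t + 2 * pi * of_int z) = wrap t"
proof -
  obtain w where w: "t = wrap t + 2 * pi * of_int w" by (rule wrap_decomp)
  have "wrap (wrap t + 2 * pi * of_int (w + z)) = wrap t"
    by (intro wrap_eq wrap_bounds)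
  moreover have "wrap t + 2 * pi * of_int (w + z) = t + 2 * pi * of_int z"
    using w by (simp add: algebra_simps)
  ultimately show ?thesis by simp
qed

lemma coord_le_norm_Rd: "i < d \<Longrightarrow> \<bar>x i\<bar> \<le> norm_Rd d x"
  using member_le_L2_set[of "{..<d}" i "\<lambda>i. \<bar>x i\<bar>"] by (simp add: L2_set_def)

text \<open>Away from the seam \<open>wrap\<close> is locally a translation. If some coordinate of
  the wrapped point is -\<pi>, that coordinate jumps, but on both sides its absolute value stays
  above \<open>r\<close>, so the function vanishes nearby and the derivatives are zero.\<close>

lemma dird_wrap:
  assumes g: "dird g h g'" and dep: "depends_on d g"
    and zero: "\<And>x. r < norm_Rd d x \<Longrightarrow> g x = 0" and r: "r < pi"
  shows "dird (\<lambda>x. g (\<lambda>i. wrap (x i))) h (\<lambda>x. g' (\<lambda>i. wrap (x i)))"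
  unfolding dird_def
proof
  fix x :: "nat \<Rightarrow> real"
  let ?y = "\<lambda>i. wrap (x i)"
  have lim: "((\<lambda>t. c + t * h i) \<longlongrightarrow> c + 0 * h i) (nhds (0::real))" for c and i :: nat
    by (auto intro!: tendsto_eq_intros filterlim_ident)
  show "((\<lambda>t. g (\<lambda>i. wrap (x i + t * h i))) has_real_derivative g' ?y) (at 0)"
  proof (cases "\<forall>i<d. ?y i \<noteq> - pi")
    case True
    have "eventually (\<lambda>t. wrap (x i + t * h i) = ?y i + t * h i) (nhds 0)" if "i < d" for i
    proof -
      have "- pi < ?y i + 0 * h i" "?y i + 0 * h i < pi"
        using wrap_bounds[of "x i"] True that by (auto simp: less_le)
      then have "eventually (\<lambda>t. - pi < ?y i + t * h i \<and> ?y i + t * h i < pi) (nhds 0)"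
        using lim by (intro eventually_conj order_tendstoD[where y = "?y i + 0 * h i"])
      then show ?thesis
      proof eventually_elim
        case (elim t)
        obtain z where z: "x i = ?y i + 2 * pi * of_int z" by (rule wrap_decomp)
        have "wrap ((?y i + t * h i) + 2 * pi * of_int z) = ?y i + t * h i"
          using elim by (intro wrap_eq) auto
        moreover have "(?y i + t * h i) + 2 * pi * of_int z = x i + t * h i"
          using z by linarith
        ultimately show ?case by simp
      qed
    qed
    then have "eventually (\<lambda>t. \<forall>i\<in>{..<d}. wrap (x i + t * h i) = ?y i + t * h i) (nhds 0)"
      by (intro eventually_ball_finite) auto
    then have "eventually (\<lambda>t. g (\<lambda>i. wrap (x i + t * h i)) = g (\<lambda>i. ?y i + t * h i)) (nhds 0)"
      by eventually_elim (use dep in \<open>auto simp: depends_on_def\<close>)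
    moreover have "((\<lambda>t. g (\<lambda>i. ?y i + t * h i)) has_real_derivative g' ?y) (at 0)"
      using spec[OF g[unfolded dird_def], of ?y] .
    ultimately show ?thesis by (subst DERIV_cong_ev[OF refl _ refl])
  next
    case False
    then obtain i where i: "i < d" "?y i = - pi" by blast
    obtain z where z: "x i = ?y i + 2 * pi * of_int z" by (rule wrap_decomp)
    have "eventually (\<lambda>t. - (pi - r) < 0 + t * h i \<and> 0 + t * h i < pi - r \<and> 0 + t * h i < pi \<and> - pi < 0 + t * h i) (nhds 0)"
      using r by (intro eventually_conj order_tendstoD[OF lim]) auto
    then have ev: "eventually (\<lambda>t. g (\<lambda>i. wrap (x i + t * h i)) = 0) (nhds 0)"
    proof eventually_elim
      case (elim t)
      have "r < \<bar>wrap (x i + t * h i)\<bar>"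
      proof (cases "0 \<le> t * h i")
        case True
        have "wrap ((- pi + t * h i) + 2 * pi * of_int z) = - pi + t * h i"
          using elim True by (intro wrap_eq) auto
        moreover have "(- pi + t * h i) + 2 * pi * of_int z = x i + t * h i"
          using z i by simp
        ultimately have "wrap (x i + t * h i) = - pi + t * h i" by metis
        then show ?thesis using elim by simp
      next
        case False
        have "wrap ((pi + t * h i) + 2 * pi * of_int (z - 1)) = pi + t * h i"
          using elim False by (intro wrap_eq) auto
        moreover have "(pi + t * h i) + 2 * pi * of_int (z - 1) = x i + t * h i"
          using z i by (simp add: algebra_simps)
        ultimately have "wrap (x i + t * h i) = pi + t * h i" by metis
        then show ?thesis using elim by simp
      qed
      also have "\<dots> \<le> norm_Rd d (\<lambda>i. wrap (x i + t * h i))"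
        using coord_le_norm_Rd[OF i(1), of "\<lambda>i. wrap (x i + t * h i)"] .
      finally show ?case by (rule zero)
    qed
    have "r < norm_Rd d ?y"
      using coord_le_norm_Rd[OF i(1), of ?y] i(2) r by simp
    then have "g' ?y = 0" using dird_vanishing_outside[OF g zero] by blast
    moreover have "((\<lambda>t::real. 0::real) has_real_derivative 0) (at 0)" by simp
    ultimately show ?thesis by (simp add: DERIV_cong_ev[OF refl ev refl])
  qed
qed

lemma bdd_derivs_wrap:
  assumes "r < pi" "r \<le> R"
  shows "bdd_derivs d {x. norm_Rd d x \<le> R} k C g \<Longrightarrow> depends_on d g \<Longrightarrow>
    (\<And>x. r < norm_Rd d x \<Longrightarrow> g x = 0) \<Longrightarrow> (\<And>n. 0 \<le> C n) \<Longrightarrow>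
    bdd_derivs d UNIV k C (\<lambda>x. g (\<lambda>i. wrap (x i)))"
proof (induction k arbitrary: C g)
  case 0
  have "\<bar>g x\<bar> \<le> C 0" for x
    using 0(1,4) 0(3)[of x] assms(2) by (cases "norm_Rd d x \<le> R") auto
  then show ?case by simp
next
  case (Suc k)
  have "\<bar>g x\<bar> \<le> C 0" for x
    using bdd_derivs_0[OF Suc.prems(1), of x] Suc.prems(3)[of x] Suc.prems(4)[of 0] assms(2)
    by (cases "norm_Rd d x \<le> R") auto
  moreover have "\<exists>g'. dird (\<lambda>x. g (\<lambda>i. wrap (x i))) h g' \<and>
      bdd_derivs d UNIV k (\<lambda>n. C (Suc n) * norm_Rd d h) g'" for h
  proof -
    obtain g' where g': "dird g h g'"
        "bdd_derivs d {x. norm_Rd d x \<le> R} k (\<lambda>n. C (Suc n) * norm_Rd d h) g'"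
      using Suc.prems(1) by auto
    have "bdd_derivs d UNIV k (\<lambda>n. C (Suc n) * norm_Rd d h) (\<lambda>x. g' (\<lambda>i. wrap (x i)))"
      by (rule Suc.IH[OF g'(2) dird_depends_on[OF g'(1) Suc.prems(2)]
            dird_vanishing_outside[OF g'(1) Suc.prems(3)]])
        (auto simp: Suc.prems(4))
    with dird_wrap[OF g'(1) Suc.prems(2,3) assms(1)] show ?thesis by blast
  qed
  ultimately show ?case by simp
qed

section \<open>From derivatives to iterated differences\<close>

text \<open>Only the top order is bounded, and through differences: this form survives restriction
  to a grid and commutes with averaging over shifts.\<close>

primrec bdd_diffs :: "nat \<Rightarrow> nat \<Rightarrow> real \<Rightarrow> ((nat \<Rightarrow> real) \<Rightarrow> real) \<Rightarrow> bool" where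
  "bdd_diffs d 0 M g \<longleftrightarrow> (\<forall>x. \<bar>g x\<bar> \<le> M)"
| "bdd_diffs d (Suc k) M g \<longleftrightarrow>
     (\<forall>h. bdd_diffs d k (M * norm_Rd d h) (\<lambda>x. g (\<lambda>i. x i + h i) - g x))"

lemma bdd_derivs_lipschitz:
  assumes "bdd_derivs d UNIV (Suc k) C g"
  shows "\<bar>g (\<lambda>i. x i + h i) - g x\<bar> \<le> C 1 * norm_Rd d h"
proof -
  obtain g' where g': "dird g h g'" "bdd_derivs d UNIV k (\<lambda>n. C (Suc n) * norm_Rd d h) g'"
    using assms by auto
  have "\<exists>z::real. 0 < z \<and> z < 1 \<and> g (\<lambda>i. x i + 1 * h i) - g (\<lambda>i. x i + 0 * h i) =
      (1 - 0) * g' (\<lambda>i. x i + z * h i)"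
    by (rule MVT2) (auto intro: dird_at[OF g'(1)])
  then show ?thesis using bdd_derivs_0[OF g'(2)] by auto
qed

lemma dird_shift: "dird g h g' \<Longrightarrow> dird (\<lambda>x. g (\<lambda>i. x i + e i)) h (\<lambda>x. g' (\<lambda>i. x i + e i))"
  unfolding dird_def
proof
  fix x assume "\<forall>x. ((\<lambda>t. g (\<lambda>i. x i + t * h i)) has_real_derivative g' x) (at 0)"
  from spec[OF this, of "\<lambda>i. x i + e i"]
  show "((\<lambda>t. g (\<lambda>i. x i + t * h i + e i)) has_real_derivative g' (\<lambda>i. x i + e i)) (at 0)"
    by (simp add: algebra_simps)
qed

text \<open>Differencing along \<open>e\<close> commutes with directional derivatives, so the mean
  value theorem applies at every order and uses up one derivative.\<close>

lemma bdd_derivs_difference: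
  "bdd_derivs d UNIV (Suc k) C g \<Longrightarrow>
    bdd_derivs d UNIV k (\<lambda>n. C (Suc n) * norm_Rd d e) (\<lambda>x. g (\<lambda>i. x i + e i) - g x)"
proof (induction k arbitrary: C g)
  case 0
  then show ?case using bdd_derivs_lipschitz[OF 0] by simp
next
  case (Suc k)
  have "\<exists>g'. dird (\<lambda>x. g (\<lambda>i. x i + e i) - g x) h g' \<and>
      bdd_derivs d UNIV k (\<lambda>n. C (Suc (Suc n)) * norm_Rd d e * norm_Rd d h) g'" for h
  proof -
    obtain g' where g': "dird g h g'" "bdd_derivs d UNIV (Suc k) (\<lambda>n. C (Suc n) * norm_Rd d h) g'"
      using Suc.prems by (metis bdd_derivs.simps(2))
    from dird_diff[OF dird_shift[OF g'(1)] g'(1)] Suc.IH[OF g'(2)]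
    show ?thesis by (auto simp: mult_ac)
  qed
  then show ?case using bdd_derivs_lipschitz[OF Suc.prems] by simp
qed

lemma bdd_derivs_imp_bdd_diffs: "bdd_derivs d UNIV k C g \<Longrightarrow> bdd_diffs d k (C k) g"
proof (induction k arbitrary: C g)
  case 0
  then show ?case by simp
next
  case (Suc k)
  show ?case using Suc.IH[OF bdd_derivs_difference[OF Suc.prems]] by simp
qed

section \<open>Jets and Taylor polynomials\<close>

abbreviation trunc :: "nat \<Rightarrow> (nat \<Rightarrow> real) \<Rightarrow> nat \<Rightarrow> real" where
  "trunc d x \<equiv> restrict x {..<d}"

lemma trunc_in_space: "trunc d x \<in> space (Rd d)"
  by (simp add: space_PiM)

lemma trunc_space: "x \<in> space (Rd d) \<Longrightarrow> trunc d x = x"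
  by (simp add: space_PiM extensional_restrict PiE_def)

lemma norm_Rd_cong: "(\<And>i. i < d \<Longrightarrow> x i = y i) \<Longrightarrow> norm_Rd d x = norm_Rd d y"
  by (simp add: L2_set_def)

lemma differentiable_Rd_line:
  assumes "differentiable_Rd d u x" "x \<in> space (Rd d)"
  obtains G where "\<And>h. ((\<lambda>t. u (trunc d (\<lambda>i. x i + t * h i))) has_real_derivative (\<Sum>i<d. G i * h i)) (at 0)"
proof -
  obtain G where G: "\<And>\<epsilon>. \<epsilon> > 0 \<Longrightarrow> \<exists>\<delta>>0. \<forall>y\<in>space (Rd d). norm_Rd d (\<lambda>i. y i - x i) < \<delta> \<longrightarrow>
        \<bar>u y - u x - (\<Sum>i<d. G i * (y i - x i))\<bar> \<le> \<epsilon> * norm_Rd d (\<lambda>i. y i - x i)"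
    using assms(1) unfolding differentiable_Rd_def by blast
  have "((\<lambda>t. u (trunc d (\<lambda>i. x i + t * h i))) has_real_derivative (\<Sum>i<d. G i * h i)) (at 0)" for h
    unfolding DERIV_def LIM_def
  proof (intro allI impI)
    fix e :: real assume e: "0 < e"
    \<comment> \<open>Adding 1 keeps the divisor positive also for h = 0.\<close>
    let ?n = "norm_Rd d h + 1"
    have n: "0 < ?n" by (rule add_nonneg_pos) auto
    obtain \<delta> where \<delta>: "0 < \<delta>" "\<And>y. y \<in> space (Rd d) \<Longrightarrow> norm_Rd d (\<lambda>i. y i - x i) < \<delta> \<Longrightarrow>
        \<bar>u y - u x - (\<Sum>i<d. G i * (y i - x i))\<bar> \<le> e / ?n * norm_Rd d (\<lambda>i. y i - x i)"
      using G[of "e / ?n"] e n by auto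
    show "\<exists>s>0. \<forall>t. t \<noteq> 0 \<and> dist t 0 < s \<longrightarrow>
        dist ((u (trunc d (\<lambda>i. x i + (0 + t) * h i)) - u (trunc d (\<lambda>i. x i + 0 * h i))) / t)
          (\<Sum>i<d. G i * h i) < e"
    proof (intro exI[of _ "\<delta> / ?n"] conjI allI impI)
      show "0 < \<delta> / ?n" using \<delta> n by simp
    next
      fix t :: real assume t: "t \<noteq> 0 \<and> dist t 0 < \<delta> / ?n"
      let ?y = "trunc d (\<lambda>i. x i + t * h i)"
      have nm: "norm_Rd d (\<lambda>i. ?y i - x i) = \<bar>t\<bar> * norm_Rd d h"
        by (subst norm_Rd_scale[symmetric]) (auto intro: norm_Rd_cong)
      have "\<bar>t\<bar> * norm_Rd d h \<le> \<bar>t\<bar> * ?n" by (simp add: mult_left_mono)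
      also have "\<dots> < \<delta>" using t n by (simp add: pos_less_divide_eq)
      finally have "\<bar>u ?y - u x - (\<Sum>i<d. G i * (?y i - x i))\<bar> \<le> e / ?n * (\<bar>t\<bar> * norm_Rd d h)"
        using \<delta>(2)[of ?y] trunc_in_space nm by simp
      moreover have "(\<Sum>i<d. G i * (?y i - x i)) = t * (\<Sum>i<d. G i * h i)"
        by (simp add: sum_distrib_left mult_ac)
      ultimately have "\<bar>u ?y - u x - t * (\<Sum>i<d. G i * h i)\<bar> \<le> \<bar>t\<bar> * (e * (norm_Rd d h / ?n))"
        by (simp add: mult_ac)
      also have "\<dots> < \<bar>t\<bar> * (e * 1)"
        using t e n by (intro mult_strict_left_mono) auto
      finally have "\<bar>u ?y - u x - t * (\<Sum>i<d. G i * h i)\<bar> / \<bar>t\<bar> < e"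
        using t by (simp add: pos_divide_less_eq mult.commute)
      also have "\<bar>u ?y - u x - t * (\<Sum>i<d. G i * h i)\<bar> / \<bar>t\<bar> = \<bar>(u ?y - u x) / t - (\<Sum>i<d. G i * h i)\<bar>"
        using t by (simp add: abs_divide[symmetric] diff_divide_distrib)
      finally show "dist ((u (trunc d (\<lambda>i. x i + (0 + t) * h i)) - u (trunc d (\<lambda>i. x i + 0 * h i))) / t)
          (\<Sum>i<d. G i * h i) < e"
        using trunc_space[OF assms(2)] by (simp add: dist_real_def)
    qed
  qed
  then show ?thesis by (rule that)
qed

text \<open>Testing along unit vectors identifies the anonymous gradient in
  \<open>differentiable_Rd\<close> with the partial derivatives, which are defined by updating one
  coordinate.\<close>

lemma partial_deriv_line:
  assumes "differentiable_Rd d u x" "x \<in> space (Rd d)"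
  shows "((\<lambda>t. u (trunc d (\<lambda>i. x i + t * h i))) has_real_derivative
    (\<Sum>i<d. h i * partial_deriv i u x)) (at 0)"
proof -
  obtain G where G: "\<And>h. ((\<lambda>t. u (trunc d (\<lambda>i. x i + t * h i))) has_real_derivative (\<Sum>i<d. G i * h i)) (at 0)"
    using differentiable_Rd_line[OF assms] by blast
  have "partial_deriv j u x = G j" if j: "j < d" for j
  proof -
    let ?e = "\<lambda>i. if i = j then 1 else 0 :: real"
    have "trunc d (\<lambda>i. x i + t * ?e i) = x(j := x j + t)" for t
    proof
      fix i show "trunc d (\<lambda>i. x i + t * ?e i) i = (x(j := x j + t)) i"
        using fun_cong[OF trunc_space[OF assms(2)], of i] j by (cases "i < d") auto
    qed
    moreover have "(\<Sum>i<d. G i * ?e i) = G j"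
      using j by (simp add: if_distrib cong: if_cong)
    ultimately have "((\<lambda>t. u (x(j := x j + t))) has_real_derivative G j) (at 0)"
      using G[of ?e] by simp
    then have "((\<lambda>t. u (x(j := t))) has_real_derivative G j) (at (x j))"
      using DERIV_shift[of "\<lambda>t. u (x(j := t))" _ 0 "x j"] by (simp add: add.commute)
    then show ?thesis unfolding partial_deriv_def by (rule DERIV_imp_deriv)
  qed
  then have "(\<Sum>i<d. G i * h i) = (\<Sum>i<d. h i * partial_deriv i u x)"
    by (intro sum.cong) auto
  with G[of h] show ?thesis by simp
qed

text \<open>Continuity refers to the product topology on \<open>nat \<Rightarrow> real\<close>,
  where convergence of the first \<open>d\<close> coordinates suffices. It serves both the symmetry
  of mixed derivatives and the measurability of test functions.\<close>

lemma continuous_on_trunc: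
  assumes "\<And>x. x \<in> space (Rd d) \<Longrightarrow> differentiable_Rd d u x"
  shows "continuous_on UNIV (\<lambda>x::nat \<Rightarrow> real. u (trunc d x))"
proof -
  have "((\<lambda>x. u (trunc d x)) \<longlongrightarrow> u (trunc d a)) (at a)" for a :: "nat \<Rightarrow> real"
    unfolding tendsto_iff
  proof (intro allI impI)
    fix e :: real assume e: "0 < e"
    let ?a = "trunc d a"
    obtain G where "\<And>\<epsilon>. \<epsilon> > 0 \<Longrightarrow> \<exists>\<delta>>0. \<forall>y\<in>space (Rd d). norm_Rd d (\<lambda>i. y i - ?a i) < \<delta> \<longrightarrow>
        \<bar>u y - u ?a - (\<Sum>i<d. G i * (y i - ?a i))\<bar> \<le> \<epsilon> * norm_Rd d (\<lambda>i. y i - ?a i)"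
      using assms[OF trunc_in_space, of a] unfolding differentiable_Rd_def by blast
    from this[of 1] obtain \<delta> where \<delta>: "0 < \<delta>" "\<And>y. y \<in> space (Rd d) \<Longrightarrow> norm_Rd d (\<lambda>i. y i - ?a i) < \<delta> \<Longrightarrow>
        \<bar>u y - u ?a - (\<Sum>i<d. G i * (y i - ?a i))\<bar> \<le> norm_Rd d (\<lambda>i. y i - ?a i)"
      by auto
    let ?g = "norm_Rd d G + 1"
    have g: "0 < ?g" by (rule add_nonneg_pos) auto
    have "((\<lambda>x. norm_Rd d (\<lambda>i. trunc d x i - ?a i)) \<longlongrightarrow> norm_Rd d (\<lambda>i. ?a i - ?a i)) (at a)"
    proof -
      have "((\<lambda>x. x i) \<longlongrightarrow> a i) (at a)" for i
      proof -
        have "continuous_on UNIV (\<lambda>x::nat \<Rightarrow> real. x i)"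
          by (rule continuous_on_product_coordinates)
        then show ?thesis by (simp add: continuous_on_def)
      qed
      then have "((\<lambda>x. sqrt (\<Sum>i<d. (x i - a i)\<^sup>2)) \<longlongrightarrow> sqrt (\<Sum>i<d. (a i - a i)\<^sup>2)) (at a)"
        by (intro tendsto_intros)
      then show ?thesis by (simp add: L2_set_def)
    qed
    then have "((\<lambda>x. norm_Rd d (\<lambda>i. trunc d x i - ?a i)) \<longlongrightarrow> 0) (at a)"
      by (simp add: L2_set_def)
    then have "eventually (\<lambda>x. norm_Rd d (\<lambda>i. trunc d x i - ?a i) < \<delta> \<and>
        norm_Rd d (\<lambda>i. trunc d x i - ?a i) < e / ?g) (at a)"
      using \<delta>(1) e g by (intro eventually_conj order_tendstoD(2)) auto
    then show "eventually (\<lambda>x. dist (u (trunc d x)) (u ?a) < e) (at a)"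
    proof eventually_elim
      case (elim x)
      let ?r = "norm_Rd d (\<lambda>i. trunc d x i - ?a i)"
      have "\<bar>u (trunc d x) - u ?a - (\<Sum>i<d. G i * (trunc d x i - ?a i))\<bar> \<le> ?r"
        using \<delta>(2)[OF trunc_in_space] elim by blast
      moreover have "\<bar>\<Sum>i<d. G i * (trunc d x i - ?a i)\<bar> \<le> norm_Rd d G * ?r"
        by (rule dot_le_norm_Rd)
      ultimately have "\<bar>u (trunc d x) - u ?a\<bar> \<le> ?r * ?g"
        by (simp add: algebra_simps abs_le_iff)
      also have "\<dots> < e" using elim g by (simp add: pos_less_divide_eq)
      finally show ?case by (simp add: dist_real_def)
    qed
  qed
  then show ?thesis by (simp add: continuous_on_def)
qed

lemma depends_on_trunc: "depends_on d (\<lambda>x. u (trunc d x))"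
  unfolding depends_on_def by (metis restrict_ext lessThan_iff)

text \<open>Mimics the derivatives of one function, indexed by lists with the newest direction at
  the end, as \<open>fold\<close> has it. Abstracting from \<open>partial_deriv\<close> lets the
  derivatives of \<open>u\<close> and those of its Taylor polynomial be subtracted before anything
  is estimated.\<close>

definition jet :: "nat \<Rightarrow> nat \<Rightarrow> (nat list \<Rightarrow> (nat \<Rightarrow> real) \<Rightarrow> real) \<Rightarrow> bool" where
  "jet d k c \<longleftrightarrow> (\<forall>js h. length js < k \<longrightarrow> set js \<subseteq> {..<d} \<longrightarrow>
     dird (c js) h (\<lambda>x. \<Sum>j<d. h j * c (js @ [j]) x))"

lemma times_differentiable_fold:
  "times_differentiable d k u \<Longrightarrow> set js \<subseteq> {..<d} \<Longrightarrow> length js \<le> k \<Longrightarrow>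
    times_differentiable d (k - length js) (fold partial_deriv js u)"
proof (induction js arbitrary: k u)
  case Nil
  then show ?case by simp
next
  case (Cons j js)
  then show ?case by (cases k) auto
qed

lemma times_differentiable_imp_differentiable_fold:
  assumes "times_differentiable d k u" "set js \<subseteq> {..<d}" "length js < k" "x \<in> space (Rd d)"
  shows "differentiable_Rd d (fold partial_deriv js u) x"
proof -
  have "times_differentiable d (Suc (k - Suc (length js))) (fold partial_deriv js u)"
    using times_differentiable_fold[OF assms(1,2)] assms(3) by (simp add: Suc_diff_Suc)
  then show ?thesis using assms(4) by simp
qed

lemma jet_partial_deriv:
  assumes "times_differentiable d k u"
  shows "jet d k (\<lambda>js x. fold partial_deriv js u (trunc d x))"
  unfolding jet_def dird_def
proof (intro allI impI)
  fix js :: "nat list" and h x :: "nat \<Rightarrow> real"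
  assume js: "length js < k" "set js \<subseteq> {..<d}"
  let ?u = "fold partial_deriv js u"
  have "((\<lambda>t. ?u (trunc d (\<lambda>i. trunc d x i + t * h i))) has_real_derivative
      (\<Sum>i<d. h i * partial_deriv i ?u (trunc d x))) (at 0)"
    by (intro partial_deriv_line trunc_in_space
        times_differentiable_imp_differentiable_fold[OF assms js(2,1)])
  moreover have "trunc d (\<lambda>i. trunc d x i + t * h i) = trunc d (\<lambda>i. x i + t * h i)" for t
    by (rule restrict_ext) simp
  ultimately show "((\<lambda>t. ?u (trunc d (\<lambda>i. x i + t * h i))) has_real_derivative
      (\<Sum>j<d. h j * fold partial_deriv (js @ [j]) u (trunc d x))) (at 0)"
    by simp
qed

section \<open>Symmetry of mixed derivatives\<close>

text \<open>Schwarz's theorem: the second difference of \<open>f\<close> over the parallelogram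
  spanned by e h and e k is e^2 times either mixed derivative at some point of it; continuity lets e
  tend to 0.\<close>

lemma dird_commute:
  assumes h: "dird f h fh" and k: "dird f k fk" and hk: "dird fh k fhk" and kh: "dird fk h fkh"
    and cont: "continuous_on UNIV fhk" "continuous_on UNIV fkh"
  shows "fhk x = fkh x"
proof -
  let ?P = "\<lambda>s t i. x i + s * h i + t * k i"
  have mvt: "\<exists>s t. 0 < s \<and> s < e \<and> 0 < t \<and> t < e \<and>
      f (\<lambda>i. x i + e * h i + e * k i) - f (\<lambda>i. x i + e * h i + 0 * k i)
        - f (\<lambda>i. x i + 0 * h i + e * k i) + f (\<lambda>i. x i + 0 * h i + 0 * k i) =
       e * (e * fhk (\<lambda>i. x i + s * h i + t * k i))"
    if e: "0 < e" and h: "dird f h fh" and hk: "dird fh k fhk" for f fh fhk h k and e :: real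
  proof -
    let ?P = "\<lambda>s t i. x i + s * h i + t * k i"
    have 1: "((\<lambda>s. f (?P s t)) has_real_derivative fh (?P s t)) (at s)" for s t
    proof -
      have "((\<lambda>s. f (\<lambda>i. (x i + t * k i) + s * h i)) has_real_derivative
          fh (\<lambda>i. (x i + t * k i) + s * h i)) (at s)"
        using dird_at[OF h, of "\<lambda>i. x i + t * k i" s] .
      then show ?thesis by (simp add: add_ac)
    qed
    have 2: "((\<lambda>t. fh (?P s t)) has_real_derivative fhk (?P s t)) (at t)" for s t
      using dird_at[OF hk, of "\<lambda>i. x i + s * h i" t] .
    obtain s where s: "0 < s" "s < e"
        "(f (?P e e) - f (?P e 0)) - (f (?P 0 e) - f (?P 0 0)) = (e - 0) * (fh (?P s e) - fh (?P s 0))"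
      using MVT2[OF e DERIV_diff[OF 1 1], of e 0] by blast
    obtain t where t: "0 < t" "t < e" "fh (?P s e) - fh (?P s 0) = (e - 0) * fhk (?P s t)"
      using MVT2[OF e 2] by blast
    have "f (?P e e) - f (?P e 0) - f (?P 0 e) + f (?P 0 0) = e * (e * fhk (?P s t))"
      using s(3) t(3) by simp
    with s(1,2) t(1,2) have "0 < s \<and> s < e \<and> 0 < t \<and> t < e \<and>
      f (?P e e) - f (?P e 0) - f (?P 0 e) + f (?P 0 0) = e * (e * fhk (?P s t))" by simp
    then show ?thesis by - (rule exI[of _ s], rule exI[of _ t])
  qed
  have *: "\<exists>y y'. (\<forall>i. \<bar>y i - x i\<bar> \<le> e * (\<bar>h i\<bar> + \<bar>k i\<bar>)) \<and>
      (\<forall>i. \<bar>y' i - x i\<bar> \<le> e * (\<bar>h i\<bar> + \<bar>k i\<bar>)) \<and> fhk y = fkh y'" if e: "0 < e" for e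
  proof -
    obtain s t where st: "0 < s" "s < e" "0 < t" "t < e"
        "f (?P e e) - f (?P e 0) - f (?P 0 e) + f (?P 0 0) = e * (e * fhk (?P s t))"
      using mvt[OF e h hk] by blast
    obtain t' s' where st': "0 < s'" "s' < e" "0 < t'" "t' < e"
        "f (\<lambda>i. x i + e * k i + e * h i) - f (\<lambda>i. x i + e * k i + 0 * h i)
          - f (\<lambda>i. x i + 0 * k i + e * h i) + f (\<lambda>i. x i + 0 * k i + 0 * h i) =
         e * (e * fkh (\<lambda>i. x i + t' * k i + s' * h i))"
      using mvt[OF e k kh] by blast
    have "e * (e * fhk (?P s t)) = e * (e * fkh (?P s' t'))"
    proof -
      have swap: "(\<lambda>i. x i + a * k i + b * h i) = ?P b a" for a b by (rule ext) simp
      show ?thesis using st(5) st'(5)[unfolded swap] by linarith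
    qed
    then have eq: "fhk (?P s t) = fkh (?P s' t')" using e by simp
    have near: "\<bar>?P s t i - x i\<bar> \<le> e * (\<bar>h i\<bar> + \<bar>k i\<bar>)"
      if "0 < s" "s < e" "0 < t" "t < e" for s t i
    proof -
      have "\<bar>?P s t i - x i\<bar> \<le> \<bar>s * h i\<bar> + \<bar>t * k i\<bar>" by linarith
      also have "\<dots> \<le> e * \<bar>h i\<bar> + e * \<bar>k i\<bar>"
        using that by (auto simp: abs_mult intro!: add_mono mult_right_mono)
      finally show ?thesis by (simp add: algebra_simps)
    qed
    show ?thesis
    proof (rule exI[of _ "?P s t"], rule exI[of _ "?P s' t'"], intro conjI allI)
      show "\<bar>?P s t i - x i\<bar> \<le> e * (\<bar>h i\<bar> + \<bar>k i\<bar>)"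
        "\<bar>?P s' t' i - x i\<bar> \<le> e * (\<bar>h i\<bar> + \<bar>k i\<bar>)" for i
        using near st(1-4) st'(1-4) by blast+
    qed (rule eq)
  qed
  have "\<forall>n. \<exists>y y'. (\<forall>i. \<bar>y i - x i\<bar> \<le> 1 / real (Suc n) * (\<bar>h i\<bar> + \<bar>k i\<bar>)) \<and>
      (\<forall>i. \<bar>y' i - x i\<bar> \<le> 1 / real (Suc n) * (\<bar>h i\<bar> + \<bar>k i\<bar>)) \<and> fhk y = fkh y'"
    by (intro allI) (rule *, simp)
  then obtain y y' where y: "\<And>n i. \<bar>y n i - x i\<bar> \<le> 1 / real (Suc n) * (\<bar>h i\<bar> + \<bar>k i\<bar>)"
      "\<And>n i. \<bar>y' n i - x i\<bar> \<le> 1 / real (Suc n) * (\<bar>h i\<bar> + \<bar>k i\<bar>)" "\<And>n. fhk (y n) = fkh (y' n)"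
    by metis
  have lim: "(\<lambda>n. g (y n)) \<longlonglongrightarrow> g x"
    if "continuous_on UNIV g" "\<And>n i. \<bar>y n i - x i\<bar> \<le> 1 / real (Suc n) * (\<bar>h i\<bar> + \<bar>k i\<bar>)"
    for g :: "(nat \<Rightarrow> real) \<Rightarrow> real" and y
  proof -
    have "y \<longlonglongrightarrow> x"
    proof -
      have "(\<lambda>n. y n i) \<longlonglongrightarrow> x i" for i
      proof -
      have lim0: "(\<lambda>n. 1 / real (Suc n) * (\<bar>h i\<bar> + \<bar>k i\<bar>)) \<longlonglongrightarrow> 0 * (\<bar>h i\<bar> + \<bar>k i\<bar>)"
        by (intro tendsto_mult_right LIMSEQ_Suc[OF lim_1_over_n])
      have "(\<lambda>n. y n i - x i) \<longlonglongrightarrow> 0"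
      proof (rule Lim_null_comparison[rotated])
        show "(\<lambda>n. 1 / real (Suc n) * (\<bar>h i\<bar> + \<bar>k i\<bar>)) \<longlonglongrightarrow> 0"
          using lim0 unfolding mult_zero_left .
        show "\<forall>\<^sub>F n in sequentially. norm (y n i - x i) \<le> 1 / real (Suc n) * (\<bar>h i\<bar> + \<bar>k i\<bar>)"
          using that(2) unfolding real_norm_def by (intro always_eventually allI)
      qed
      then show "(\<lambda>n. y n i) \<longlonglongrightarrow> x i" by (rule LIM_zero_cancel)
      qed
      then have "limitin (product_topology (\<lambda>_. euclidean) UNIV) y x sequentially"
        by (subst limitin_componentwise) auto
      then show ?thesis by (simp add: euclidean_product_topology)
    qed
    then show ?thesis
      using that(1) by (intro continuous_on_tendsto_compose[of UNIV g]) auto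
  qed
  have "(\<lambda>n. fhk (y n)) \<longlonglongrightarrow> fhk x" "(\<lambda>n. fkh (y' n)) \<longlonglongrightarrow> fkh x"
    using lim[OF cont(1) y(1)] lim[OF cont(2) y(2)] .
  then show ?thesis using y(3) LIMSEQ_unique by simp
qed

lemma partial_deriv_cong:
  assumes "\<And>x. x \<in> space (Rd d) \<Longrightarrow> f x = g x" "i < d" "x \<in> space (Rd d)"
  shows "partial_deriv i f x = partial_deriv i g x"
proof -
  have "x(i := t) \<in> space (Rd d)" for t
    using assms(2,3) by (auto simp: space_PiM PiE_def extensional_def)
  then show ?thesis using assms(1) by (simp add: partial_deriv_def)
qed

lemma fold_partial_deriv_cong:
  "(\<And>x. x \<in> space (Rd d) \<Longrightarrow> f x = g x) \<Longrightarrow> set js \<subseteq> {..<d} \<Longrightarrow> x \<in> space (Rd d) \<Longrightarrow>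
    fold partial_deriv js f x = fold partial_deriv js g x"
proof (induction js arbitrary: f g)
  case Nil
  then show ?case by simp
next
  case (Cons j js)
  show ?case
    using Cons.IH[of "partial_deriv j f" "partial_deriv j g"] partial_deriv_cong[OF Cons.prems(1)]
      Cons.prems(2,3) by auto
qed

text \<open>The bound on the length is strict: symmetry is derived from continuous mixed
  derivatives, and those of order \<open>n\<close> itself are not known to be continuous. A Taylor
  polynomial of degree below \<open>n\<close> needs no more.\<close>

definition symmetric_upto :: "nat \<Rightarrow> nat \<Rightarrow> (nat list \<Rightarrow> real) \<Rightarrow> bool" where
  "symmetric_upto d n c \<longleftrightarrow> (\<forall>as i j bs. length (as @ i # j # bs) < n \<longrightarrow>
     set (as @ i # j # bs) \<subseteq> {..<d} \<longrightarrow> c (as @ i # j # bs) = c (as @ j # i # bs))"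

text \<open>Schwarz's theorem is applied to the function already differentiated along
  \<open>as\<close>; the remaining \<open>bs\<close> then act on two functions that agree on the
  whole space.\<close>

lemma symmetric_partial_deriv:
  assumes td: "times_differentiable d n u"
  shows "symmetric_upto d n (\<lambda>js. fold partial_deriv js u (trunc d x))"
  unfolding symmetric_upto_def
proof (intro allI impI)
  fix as i j bs
  assume *: "length (as @ i # j # bs) < n" "set (as @ i # j # bs) \<subseteq> {..<d}"
  let ?c = "\<lambda>js x. fold partial_deriv js u (trunc d x)"
  let ?e = "\<lambda>j i. if i = j then 1 else 0 :: real"
  have d1: "dird (?c js) (?e j) (?c (js @ [j]))"
    if "length js < n" "set js \<subseteq> {..<d}" "j < d" for js j
  proof -
    have "dird (?c js) (?e j) (\<lambda>x. \<Sum>i<d. ?e j i * ?c (js @ [i]) x)"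
      using jet_partial_deriv[OF td] that unfolding jet_def by blast
    moreover have "(\<Sum>i<d. ?e j i * ?c (js @ [i]) x) = ?c (js @ [j]) x" for x
    proof -
      have "(\<Sum>i<d. ?e j i * ?c (js @ [i]) x) = (\<Sum>i<d. if i = j then ?c (js @ [i]) x else 0)"
        by (rule sum.cong) auto
      also have "\<dots> = ?c (js @ [j]) x" using that(3) by (subst sum.delta) auto
      finally show ?thesis .
    qed
    ultimately show ?thesis by simp
  qed
  have cont: "continuous_on UNIV (?c js)" if "length js < n" "set js \<subseteq> {..<d}" for js
    using times_differentiable_imp_differentiable_fold[OF td that(2,1)] by (rule continuous_on_trunc)
  have "?c ((as @ [i]) @ [j]) y = ?c ((as @ [j]) @ [i]) y" for y
    by (rule dird_commute[OF d1 d1 d1 d1 cont cont]) (use * in auto)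
  then have "fold partial_deriv ((as @ [i]) @ [j]) u y = fold partial_deriv ((as @ [j]) @ [i]) u y"
    if "y \<in> space (Rd d)" for y
    using trunc_space[OF that] by metis
  from fold_partial_deriv_cong[OF this, where js = bs and x = "trunc d x"] * trunc_in_space[of x d]
  show "?c (as @ i # j # bs) x = ?c (as @ j # i # bs) x" by simp
qed

section \<open>Taylor polynomials as sums over index lists\<close>

text \<open>The diagonal of the k-linear form with coefficients \<open>c\<close>. All orderings of
  the indices are summed, which replaces multinomial coefficients, so \<open>taylor\<close> divides
  by k! only.\<close>

primrec hom_poly :: "nat \<Rightarrow> nat \<Rightarrow> (nat list \<Rightarrow> real) \<Rightarrow> (nat \<Rightarrow> real) \<Rightarrow> real" where
  "hom_poly d 0 c x = c []"
| "hom_poly d (Suc k) c x = (\<Sum>j<d. x j * hom_poly d k (\<lambda>js. c (j # js)) x)"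

definition taylor :: "nat \<Rightarrow> nat \<Rightarrow> (nat list \<Rightarrow> real) \<Rightarrow> (nat \<Rightarrow> real) \<Rightarrow> real" where
  "taylor d n c x = (\<Sum>k<n. hom_poly d k c x / fact k)"

lemma hom_poly_cong:
  "(\<And>js. length js = k \<Longrightarrow> set js \<subseteq> {..<d} \<Longrightarrow> c js = c' js) \<Longrightarrow> hom_poly d k c x = hom_poly d k c' x"
proof (induction k arbitrary: c c')
  case 0
  then show ?case by simp
next
  case (Suc k)
  have "hom_poly d k (\<lambda>js. c (j # js)) x = hom_poly d k (\<lambda>js. c' (j # js)) x" if "j < d" for j
    by (rule Suc.IH) (use Suc.prems that in auto)
  then show ?case by simp
qed

text \<open>By the product rule the direction \<open>h\<close> may land in any of the k + 1 slots;
  symmetry of \<open>c\<close> moves it to the front, so all slots contribute equally.\<close>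

lemma dird_hom_poly:
  "symmetric_upto d n c \<Longrightarrow> Suc k < n \<Longrightarrow>
    dird (hom_poly d (Suc k) c) h
      (\<lambda>x. real (Suc k) * (\<Sum>j<d. h j * hom_poly d k (\<lambda>js. c (j # js)) x))"
proof (induction k arbitrary: c n)
  case 0
  have "dird (\<lambda>x. \<Sum>j<d. x j * c [j]) h (\<lambda>x. \<Sum>j<d. h j * c [j])"
  proof (rule dird_sum)
    fix j show "dird (\<lambda>x. x j * c [j]) h (\<lambda>x. h j * c [j])"
      using dird_cmult[OF dird_coord[of j], of "c [j]" h] by (simp add: mult.commute)
  qed
  then show ?case by (simp add: fun_eq_iff cong: if_cong)
next
  case (Suc k)
  let ?H = "\<lambda>m c. hom_poly d m c"
  have sym: "symmetric_upto d (n - 1) (\<lambda>js. c (j # js))" if "j < d" for j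
    unfolding symmetric_upto_def
  proof (intro allI impI)
    fix as i k bs
    assume "length (as @ i # k # bs) < n - 1" "set (as @ i # k # bs) \<subseteq> {..<d}"
    with that have "length ((j # as) @ i # k # bs) < n" "set ((j # as) @ i # k # bs) \<subseteq> {..<d}" by auto
    then have "c ((j # as) @ i # k # bs) = c ((j # as) @ k # i # bs)"
      using Suc.prems(1) unfolding symmetric_upto_def by blast
    then show "c (j # as @ i # k # bs) = c (j # as @ k # i # bs)" by simp
  qed
  have "dird (\<lambda>x. \<Sum>j<d. x j * ?H (Suc k) (\<lambda>js. c (j # js)) x) h
     (\<lambda>x. \<Sum>j<d. h j * ?H (Suc k) (\<lambda>js. c (j # js)) x +
        x j * (real (Suc k) * (\<Sum>i<d. h i * ?H k (\<lambda>js. c (j # i # js)) x)))"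
    using Suc.prems(2) by (intro dird_sum dird_mult dird_coord Suc.IH[OF sym]) auto
  moreover have "(\<Sum>j<d. x j * (real (Suc k) * (\<Sum>i<d. h i * ?H k (\<lambda>js. c (j # i # js)) x))) =
      real (Suc k) * (\<Sum>i<d. h i * ?H (Suc k) (\<lambda>js. c (i # js)) x)" for x
  proof -
    have "(\<Sum>j<d. x j * (real (Suc k) * (\<Sum>i<d. h i * ?H k (\<lambda>js. c (j # i # js)) x))) =
        (\<Sum>j<d. \<Sum>i<d. real (Suc k) * (h i * (x j * ?H k (\<lambda>js. c (j # i # js)) x)))"
      by (simp add: sum_distrib_left mult_ac)
    also have "\<dots> = (\<Sum>i<d. \<Sum>j<d. real (Suc k) * (h i * (x j * ?H k (\<lambda>js. c (j # i # js)) x)))"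
      by (rule sum.swap)
    also have "\<dots> = (\<Sum>i<d. \<Sum>j<d. real (Suc k) * (h i * (x j * ?H k (\<lambda>js. c (i # j # js)) x)))"
    proof (intro sum.cong refl)
      fix i j assume ij: "i \<in> {..<d}" "j \<in> {..<d}"
      have "?H k (\<lambda>js. c (j # i # js)) x = ?H k (\<lambda>js. c (i # j # js)) x"
      proof (rule hom_poly_cong)
        fix js assume "length js = k" "set js \<subseteq> {..<d}"
        with ij Suc.prems(2) have "length ([] @ j # i # js) < n" "set ([] @ j # i # js) \<subseteq> {..<d}" by auto
        then have "c ([] @ j # i # js) = c ([] @ i # j # js)"
          using Suc.prems(1) unfolding symmetric_upto_def by blast
        then show "c (j # i # js) = c (i # j # js)" by simp
      qed
      then show "real (Suc k) * (h i * (x j * ?H k (\<lambda>js. c (j # i # js)) x)) =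
          real (Suc k) * (h i * (x j * ?H k (\<lambda>js. c (i # j # js)) x))" by simp
    qed
    also have "\<dots> = real (Suc k) * (\<Sum>i<d. h i * ?H (Suc k) (\<lambda>js. c (i # js)) x)"
      by (simp add: sum_distrib_left mult_ac)
    finally show ?thesis .
  qed
  ultimately have "dird (\<lambda>x. \<Sum>j<d. x j * ?H (Suc k) (\<lambda>js. c (j # js)) x) h
     (\<lambda>x. (\<Sum>j<d. h j * ?H (Suc k) (\<lambda>js. c (j # js)) x) +
        real (Suc k) * (\<Sum>i<d. h i * ?H (Suc k) (\<lambda>js. c (i # js)) x))"
    by (simp add: sum.distrib)
  moreover have "s + real (Suc k) * s = real (Suc (Suc k)) * s" for s :: real
    by (simp add: algebra_simps)
  moreover have "hom_poly d (Suc (Suc k)) c = (\<lambda>x. \<Sum>j<d. x j * ?H (Suc k) (\<lambda>js. c (j # js)) x)"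
    by (rule ext) (rule hom_poly.simps(2))
  ultimately show ?case by (simp only:)
qed

text \<open>The factor k + 1 from \<open>dird_hom_poly\<close> turns 1/(k+1)! into 1/k!, so
  differentiation shifts the lists and lowers the degree.\<close>

lemma dird_taylor:
  assumes "symmetric_upto d (Suc n) c"
  shows "dird (taylor d (Suc n) c) h (\<lambda>x. \<Sum>j<d. h j * taylor d n (\<lambda>js. c (j # js)) x)"
proof -
  have "dird (\<lambda>x. c [] + (\<Sum>k<n. 1 / fact (Suc k) * hom_poly d (Suc k) c x)) h
    (\<lambda>x. 0 + (\<Sum>k<n. 1 / fact (Suc k) * (real (Suc k) * (\<Sum>j<d. h j * hom_poly d k (\<lambda>js. c (j # js)) x))))"
    by (intro dird_add dird_const dird_sum dird_cmult dird_hom_poly[OF assms]) auto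
  moreover have "(\<lambda>x. c [] + (\<Sum>k<n. 1 / fact (Suc k) * hom_poly d (Suc k) c x)) = taylor d (Suc n) c"
    by (rule ext) (simp add: taylor_def sum.lessThan_Suc_shift del: hom_poly.simps(2) fact_Suc sum.lessThan_Suc)
  moreover have "0 + (\<Sum>k<n. 1 / fact (Suc k) * (real (Suc k) * (\<Sum>j<d. h j * hom_poly d k (\<lambda>js. c (j # js)) x))) =
      (\<Sum>j<d. h j * taylor d n (\<lambda>js. c (j # js)) x)" for x
  proof -
    have "1 / fact (Suc k) * (real (Suc k) * s) = s / fact k" for k and s :: real
      unfolding fact_Suc by (simp del: of_nat_Suc)
    then have "0 + (\<Sum>k<n. 1 / fact (Suc k) * (real (Suc k) * (\<Sum>j<d. h j * hom_poly d k (\<lambda>js. c (j # js)) x))) =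
      (\<Sum>k<n. \<Sum>j<d. h j * (hom_poly d k (\<lambda>js. c (j # js)) x / fact k))"
      by (simp add: sum_divide_distrib)
    also have "\<dots> = (\<Sum>j<d. \<Sum>k<n. h j * (hom_poly d k (\<lambda>js. c (j # js)) x / fact k))"
      by (rule sum.swap)
    finally show ?thesis by (simp add: taylor_def sum_distrib_left)
  qed
  ultimately show ?thesis by (simp only:)
qed

lemma taylor_zero: "taylor d (Suc n) c (\<lambda>_. 0) = c []"
  unfolding taylor_def by (subst sum.lessThan_Suc_shift) simp

lemma symmetric_upto_append:
  assumes "symmetric_upto d n c" "set js \<subseteq> {..<d}"
  shows "symmetric_upto d (n - length js) (\<lambda>ks. c (js @ ks))"
  unfolding symmetric_upto_def
proof (intro allI impI)
  fix as i k bs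
  assume "length (as @ i # k # bs) < n - length js" "set (as @ i # k # bs) \<subseteq> {..<d}"
  with assms(2) have "length ((js @ as) @ i # k # bs) < n" "set ((js @ as) @ i # k # bs) \<subseteq> {..<d}" by auto
  then have "c ((js @ as) @ i # k # bs) = c ((js @ as) @ k # i # bs)"
    using assms(1) unfolding symmetric_upto_def by blast
  then show "c (js @ as @ i # k # bs) = c (js @ as @ k # i # bs)" by simp
qed

lemma jet_taylor:
  assumes "symmetric_upto d p c"
  shows "jet d p (\<lambda>js. taylor d (p - length js) (\<lambda>ks. c (js @ ks)))"
  unfolding jet_def
proof (intro allI impI)
  fix js :: "nat list" and h assume js: "length js < p" "set js \<subseteq> {..<d}"
  have eq: "p - length js = Suc (p - Suc (length js))" using js by simp
  have "symmetric_upto d (Suc (p - Suc (length js))) (\<lambda>ks. c (js @ ks))"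
    using symmetric_upto_append[OF assms js(2)] by (simp only: eq)
  from dird_taylor[OF this, of h]
  show "dird (taylor d (p - length js) (\<lambda>ks. c (js @ ks))) h
      (\<lambda>x. \<Sum>j<d. h j * taylor d (p - length (js @ [j])) (\<lambda>ks. c ((js @ [j]) @ ks)) x)"
    unfolding eq by simp
qed

lemma jet_diff: "jet d k c \<Longrightarrow> jet d k c' \<Longrightarrow> jet d k (\<lambda>js x. c js x - c' js x)"
  unfolding jet_def right_diff_distrib sum_subtractf by (auto intro: dird_diff)

text \<open>Contracting with a direction \<open>h\<close> costs its l1-norm, at most sqrt(d) times
  the Euclidean norm; over \<open>k\<close> orders this makes sqrt(d)^k.\<close>

lemma jet_vanishing:
  "jet d k \<omega> \<Longrightarrow> (\<And>js. length js < k \<Longrightarrow> set js \<subseteq> {..<d} \<Longrightarrow> \<omega> js (\<lambda>_. 0) = 0) \<Longrightarrow>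
    (\<And>js x. length js = k \<Longrightarrow> set js \<subseteq> {..<d} \<Longrightarrow> \<bar>\<omega> js x\<bar> \<le> B) \<Longrightarrow>
    vanishing d k (B * sqrt (real d) ^ k) (\<omega> [])"
proof (induction k arbitrary: \<omega> B)
  case 0
  then show ?case by simp
next
  case (Suc k)
  have "\<exists>g'. dird (\<omega> []) h g' \<and> vanishing d k (B * sqrt (real d) ^ Suc k * norm_Rd d h) g'" for h
  proof -
    \<comment> \<open>The contraction uses the first index while differentiation appends at the end,
      so the result is again a jet and no symmetry is invoked.\<close>
    let ?\<omega> = "\<lambda>js x. \<Sum>j<d. h j * \<omega> (j # js) x"
    have B: "0 \<le> B" if "0 < d"
    proof -
      have "set (replicate (Suc k) 0) \<subseteq> {..<d}" using that by auto
      then have "\<bar>\<omega> (replicate (Suc k) 0) (\<lambda>_. 0)\<bar> \<le> B" by (intro Suc.prems(3)) auto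
      then show ?thesis using abs_ge_zero order_trans by blast
    qed
    have d1: "dird (\<omega> []) h (?\<omega> [])"
      using Suc.prems(1)[unfolded jet_def, rule_format, of "[]" h] by simp
    have "jet d k ?\<omega>"
      unfolding jet_def
    proof (intro allI impI)
      fix js :: "nat list" and e assume js: "length js < k" "set js \<subseteq> {..<d}"
      have "dird (?\<omega> js) e (\<lambda>x. \<Sum>j<d. h j * (\<Sum>i<d. e i * \<omega> ((j # js) @ [i]) x))"
        using js by (intro dird_sum dird_cmult Suc.prems(1)[unfolded jet_def, rule_format]) auto
      moreover have "(\<Sum>j<d. h j * (\<Sum>i<d. e i * \<omega> ((j # js) @ [i]) x)) = (\<Sum>i<d. e i * ?\<omega> (js @ [i]) x)" for x
      proof -
        have "(\<Sum>j<d. h j * (\<Sum>i<d. e i * \<omega> ((j # js) @ [i]) x)) =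
            (\<Sum>j<d. \<Sum>i<d. e i * (h j * \<omega> (j # js @ [i]) x))"
          by (simp add: sum_distrib_left mult_ac)
        also have "\<dots> = (\<Sum>i<d. \<Sum>j<d. e i * (h j * \<omega> (j # js @ [i]) x))" by (rule sum.swap)
        finally show ?thesis by (simp add: sum_distrib_left)
      qed
      ultimately show "dird (?\<omega> js) e (\<lambda>x. \<Sum>i<d. e i * ?\<omega> (js @ [i]) x)" by (simp only:)
    qed
    moreover have "?\<omega> js (\<lambda>_. 0) = 0" if "length js < k" "set js \<subseteq> {..<d}" for js
      using that Suc.prems(2) by (intro sum.neutral) auto
    moreover have "\<bar>?\<omega> js x\<bar> \<le> B * (sqrt (real d) * norm_Rd d h)"
      if "length js = k" "set js \<subseteq> {..<d}" for js x
    proof -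
      have "\<bar>?\<omega> js x\<bar> \<le> (\<Sum>j<d. \<bar>h j\<bar> * B)"
        using that Suc.prems(3)
        by (intro order_trans[OF sum_abs] sum_mono) (auto simp: abs_mult intro!: mult_left_mono)
      also have "\<dots> = B * (\<Sum>j<d. \<bar>h j\<bar>)" by (simp add: sum_distrib_left mult.commute)
      also have "\<dots> \<le> B * (sqrt (real d) * norm_Rd d h)"
        using B sum_abs_le_norm_Rd[of h d] by (cases "d = 0") (auto intro: mult_left_mono)
      finally show ?thesis .
    qed
    ultimately have "vanishing d k (B * (sqrt (real d) * norm_Rd d h) * sqrt (real d) ^ k) (?\<omega> [])"
      by (rule Suc.IH)
    then show ?thesis using d1 by (auto simp: mult_ac)
  qed
  then show ?case using Suc.prems(2)[of "[]"] by simp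
qed

lemma zolotarev_test_taylor:
  assumes "u \<in> zolotarev_test d p"
  obtains c where "vanishing d p (sqrt (real d) ^ p) (\<lambda>x. u (trunc d x) - taylor d p c x)"
proof -
  have td: "times_differentiable d p u"
    and bound: "\<And>js x. set js \<subseteq> {..<d} \<Longrightarrow> length js = p \<Longrightarrow> x \<in> space (Rd d) \<Longrightarrow>
      \<bar>foldr partial_deriv js u x\<bar> \<le> 1"
    using assms by (auto simp: zolotarev_test_def)
  define c where "c = (\<lambda>js. fold partial_deriv js u (trunc d (\<lambda>_. 0)))"
  let ?\<omega> = "\<lambda>js x. fold partial_deriv js u (trunc d x) - taylor d (p - length js) (\<lambda>ks. c (js @ ks)) x"
  have "jet d p ?\<omega>"
    unfolding c_def by (intro jet_diff jet_partial_deriv td jet_taylor symmetric_partial_deriv)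
  moreover have "?\<omega> js (\<lambda>_. 0) = 0" if "length js < p" "set js \<subseteq> {..<d}" for js
  proof -
    have "p - length js = Suc (p - Suc (length js))" using that by simp
    then show ?thesis by (simp only: taylor_zero) (simp add: c_def)
  qed
  \<comment> \<open>At order p the Taylor part is an empty sum, so the defining bound of test
    functions applies; \<open>foldr\<close> reads the list from the other end.\<close>
  moreover have "\<bar>?\<omega> js x\<bar> \<le> 1" if "length js = p" "set js \<subseteq> {..<d}" for js x
    using bound[of "rev js" "trunc d x"] that trunc_in_space[of x d] by (simp add: taylor_def foldr_conv_fold)
  ultimately have "vanishing d p (1 * sqrt (real d) ^ p) (?\<omega> [])"
    by (rule jet_vanishing)
  then show ?thesis using that by simp
qed

lemma power_div_fact_le_exp:
  fixes x :: real
  assumes "0 \<le> x"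
  shows "x ^ i / fact i \<le> exp x"
proof -
  have "(\<lambda>n. x ^ n / fact n) sums exp x"
    using exp_converges[of x] by (simp add: divide_inverse mult.commute scaleR_conv_of_real)
  moreover from this have "(\<Sum>n\<in>{i}. x ^ n / fact n) \<le> (\<Sum>n. x ^ n / fact n)"
    using assms by (intro sum_le_suminf) (auto simp: sums_iff)
  ultimately show ?thesis by (simp add: sums_iff)
qed

lemma bdd_diffs_mono: "bdd_diffs d k B g \<Longrightarrow> B \<le> B' \<Longrightarrow> bdd_diffs d k B' g"
proof (induction k arbitrary: B B' g)
  case 0
  have "\<bar>g x\<bar> \<le> B'" for x using 0(1)[unfolded bdd_diffs.simps, rule_format, of x] 0(2) by linarith
  then show ?case by simp
next
  case (Suc k)
  have "bdd_diffs d k (B' * norm_Rd d h) (\<lambda>x. g (\<lambda>i. x i + h i) - g x)" for h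
  proof -
    have "bdd_diffs d k (B * norm_Rd d h) (\<lambda>x. g (\<lambda>i. x i + h i) - g x)"
      using Suc.prems(1) by simp
    then show ?thesis by (rule Suc.IH) (rule mult_right_mono[OF Suc.prems(2)], simp)
  qed
  then show ?case by simp
qed

lemma depends_on_hom_poly: "depends_on d (hom_poly d k c)"
proof (induction k arbitrary: c)
  case 0
  then show ?case by (simp add: depends_on_def)
next
  case (Suc k)
  show ?case
    unfolding depends_on_def
  proof (intro allI impI)
    fix x y :: "nat \<Rightarrow> real" assume "\<forall>i<d. x i = y i"
    moreover from this have "hom_poly d k c x = hom_poly d k c y" for c
      using Suc[of c] unfolding depends_on_def by blast
    ultimately show "hom_poly d (Suc k) c x = hom_poly d (Suc k) c y" by simp
  qed
qed

lemma depends_on_taylor: "depends_on d (taylor d n c)"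
  unfolding depends_on_def taylor_def
  by (intro allI impI sum.cong refl arg_cong2[of _ _ _ _ "(/)"])
    (use depends_on_hom_poly in \<open>auto simp: depends_on_def\<close>)

text \<open>As only coordinates below \<open>d\<close> are compared, this also makes
  \<open>v\<close> independent of all others.\<close>

definition periodic_2pi :: "nat \<Rightarrow> ((nat \<Rightarrow> real) \<Rightarrow> real) \<Rightarrow> bool" where
  "periodic_2pi d v \<longleftrightarrow>
    (\<forall>x y. (\<forall>i<d. \<exists>z::int. x i = y i + 2 * pi * of_int z) \<longrightarrow> v x = v y)"

text \<open>The Taylor polynomial is removed because the cutoff needs control of the lower order derivatives.\<close>

lemma periodic_extension_of_test_function:
  assumes u: "u \<in> zolotarev_test d p" and p: "1 \<le> p"
  obtains c v L V where
    "\<And>x. norm_Rd d x \<le> 1 \<Longrightarrow> v x = u (trunc d x) - taylor d p c x"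
    "\<And>x. norm_Rd d x \<le> 1 \<Longrightarrow> \<bar>v x\<bar> \<le> sqrt (real d) ^ p"
    "periodic_2pi d v"
    "bdd_diffs d p ((51 * sqrt (real d)) ^ p) v"
    "\<And>x h. \<bar>v (\<lambda>i. x i + h i) - v x\<bar> \<le> L * norm_Rd d h"
    "\<And>x. \<bar>v x\<bar> \<le> V"
proof -
  obtain c where van: "vanishing d p (sqrt (real d) ^ p) (\<lambda>x. u (trunc d x) - taylor d p c x)"
    using zolotarev_test_taylor[OF u] .
  let ?w = "\<lambda>x. u (trunc d x) - taylor d p c x" and ?M = "sqrt (real d) ^ p"
  obtain \<Psi> where \<Psi>: "\<And>j s. j < p \<Longrightarrow> (\<Psi> j has_real_derivative \<Psi> (Suc j) s) (at s)"
    "\<And>j s. j \<le> p \<Longrightarrow> \<bar>\<Psi> j s\<bar> \<le> real p ^ j"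
    "\<And>s. s \<le> 1 \<Longrightarrow> \<Psi> 0 s = 1" "\<And>s. 4 \<le> s \<Longrightarrow> \<Psi> 0 s = 0"
    using exists_cutoff[OF p] by blast
  \<comment> \<open>Radius 2 because the cutoff vanishes once |x|^2 \<ge> 4, and 2 < \<pi> leaves
    room for the periodic copies.\<close>
  let ?S = "{x. norm_Rd d x \<le> 2}" and ?q = "\<lambda>x. \<Sum>i<d. (x i)\<^sup>2"
  have sq: "?q x = (norm_Rd d x)\<^sup>2" for x
    by (simp add: L2_set_def sum_nonneg)
  let ?g = "\<lambda>x. \<Psi> 0 (?q x) * ?w x"
  let ?C = "\<lambda>n. \<Sum>i\<le>n. real (n choose i) * (8 * real p) ^ i * (?M * 2 ^ (p - (n - i)) / fact (p - (n - i)))"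
  have "bdd_derivs d ?S p (\<lambda>n. real p ^ 0 * (4 * real p * 2) ^ n) (\<lambda>x. \<Psi> 0 (?q x))"
    by (rule bdd_derivs_compose_norm_square[OF \<Psi>(1,2)]) auto
  then have "bdd_derivs d ?S p (\<lambda>n. (8 * real p) ^ n) (\<lambda>x. \<Psi> 0 (?q x))" by simp
  from bdd_derivs_mult[OF this vanishing_imp_bdd_derivs[OF van]]
  have bdC: "bdd_derivs d ?S p ?C ?g" by simp
  have dep: "depends_on d ?g"
    unfolding depends_on_def
  proof (intro allI impI)
    fix x y :: "nat \<Rightarrow> real" assume xy: "\<forall>i<d. x i = y i"
    have "u (trunc d x) = u (trunc d y)" "taylor d p c x = taylor d p c y" "?q x = ?q y"
      using xy depends_on_trunc[of d u] depends_on_taylor[of d p c] unfolding depends_on_def by auto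
    then show "?g x = ?g y" by simp
  qed
  have zero: "?g x = 0" if "2 < norm_Rd d x" for x
  proof -
    have "2\<^sup>2 \<le> (norm_Rd d x)\<^sup>2" using that by (intro power_mono) auto
    then show ?thesis using \<Psi>(4) by (simp add: sq)
  qed
  have C0: "0 \<le> ?C n" for n by (intro sum_nonneg) auto
  have bd: "bdd_derivs d UNIV p ?C (\<lambda>x. ?g (\<lambda>i. wrap (x i)))"
    using pi_gt3 by (intro bdd_derivs_wrap[OF _ _ bdC dep zero C0]) simp_all
  define v where "v = (\<lambda>x. ?g (\<lambda>i. wrap (x i)))"
  \<comment> \<open>Order i of the cutoff contributes (8p)^i, the matching order of the remainder
    2^i / i!. With p^i / i! \<le> e^p \<le> 3^p, the binomial sum of 16^i gives 17^p, and 51 = 3 x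
    17.\<close>
  have Cp: "?C p \<le> (51 * sqrt (real d)) ^ p"
  proof -
    have "?C p = ?M * (\<Sum>i\<le>p. real (p choose i) * 16 ^ i * (real p ^ i / fact i))"
      unfolding sum_distrib_left
    proof (rule sum.cong[OF refl])
      fix i assume "i \<in> {..p}"
      then have "p - (p - i) = i" by simp
      have "(8 * real p) ^ i * 2 ^ i = 16 ^ i * real p ^ i"
        by (simp only: power_mult_distrib[symmetric]) simp
      show "real (p choose i) * (8 * real p) ^ i * (?M * 2 ^ (p - (p - i)) / fact (p - (p - i))) =
          ?M * (real (p choose i) * 16 ^ i * (real p ^ i / fact i))"
      proof -
        have "b * A * (m * t / f) = m * (b * ((A * t) / f))" for b A m t f :: real by simp
        then show ?thesis
          unfolding \<open>p - (p - i) = i\<close>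
          by (simp only: \<open>(8 * real p) ^ i * 2 ^ i = 16 ^ i * real p ^ i\<close>) simp
      qed
    qed
    also have "\<dots> \<le> ?M * (\<Sum>i\<le>p. real (p choose i) * 16 ^ i * exp (real p))"
      by (intro mult_left_mono sum_mono power_div_fact_le_exp) auto
    also have "\<dots> = ?M * (exp (real p) * (16 + 1) ^ p)"
      by (subst binomial_ring) (simp add: sum_distrib_left sum_distrib_right mult_ac)
    also have "exp (real p) = exp 1 ^ p" by (simp add: exp_of_nat_mult[symmetric])
    also have "?M * (exp 1 ^ p * (16 + 1) ^ p) \<le> ?M * (3 ^ p * (16 + 1) ^ p)"
      using exp_le by (intro mult_left_mono mult_right_mono power_mono) auto
    also have "\<dots> = (51 * sqrt (real d)) ^ p"
      unfolding power_mult_distrib[symmetric] by (simp add: mult.commute)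
    finally show ?thesis .
  qed
  obtain p' where p': "p = Suc p'" using p not0_implies_Suc[of p] by auto
  have in_ball: "wrap (x i) = x i" if "norm_Rd d x \<le> 1" "i < d" for x i
    using coord_le_norm_Rd[OF that(2), of x] that(1) pi_gt3 wrap_eq[of "x i" 0] by simp
  have v_eq: "v x = ?w x" if "norm_Rd d x \<le> 1" for x
  proof -
    have "?g (\<lambda>i. wrap (x i)) = ?g x"
      using dep[unfolded depends_on_def, rule_format, of "\<lambda>i. wrap (x i)" x] in_ball[OF that] by simp
    moreover have "?q x \<le> 1" unfolding sq using that by (intro power_le_one) auto
    ultimately show ?thesis using \<Psi>(3) by (simp add: v_def)
  qed
  show ?thesis
  \<comment> \<open>\<open>L\<close> and \<open>V\<close> need no good dependence on p or d: they
    enter only an error that is made arbitrarily small by refining the grid.\<close>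
  proof (rule that[of v c "?C 1" "?C 0"])
    fix x assume x: "norm_Rd d x \<le> 1"
    show "v x = ?w x" by (rule v_eq[OF x])
    have "\<bar>?w x\<bar> \<le> ?M * norm_Rd d x ^ p / fact p" by (rule vanishing_bound[OF van])
    also have "\<dots> \<le> ?M * 1 / 1"
      using x by (intro frac_le mult_left_mono power_le_one) auto
    finally show "\<bar>v x\<bar> \<le> ?M" by (simp add: v_eq[OF x])
  next
    show "periodic_2pi d v"
      unfolding periodic_2pi_def
    proof (intro allI impI)
      fix x y :: "nat \<Rightarrow> real" assume xy: "\<forall>i<d. \<exists>z::int. x i = y i + 2 * pi * of_int z"
      have "wrap (x i) = wrap (y i)" if "i < d" for i
        using xy that wrap_periodic by auto
      then show "v x = v y"
        using dep unfolding depends_on_def v_def by simp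
    qed
  next
    show "bdd_diffs d p ((51 * sqrt (real d)) ^ p) v"
      using bdd_diffs_mono[OF bdd_derivs_imp_bdd_diffs[OF bd] Cp] by (simp add: v_def)
  next
    fix x h show "\<bar>v (\<lambda>i. x i + h i) - v x\<bar> \<le> ?C 1 * norm_Rd d h"
    proof (rule bdd_derivs_lipschitz[of d p'])
      show "bdd_derivs d UNIV (Suc p') ?C v"
        by (subst p'[symmetric]) (rule bd[folded v_def])
    qed
  next
    fix x show "\<bar>v x\<bar> \<le> ?C 0"
      unfolding v_def by (rule bdd_derivs_0[OF bd]) simp
  qed
qed

section \<open>Fourier analysis on a finite torus\<close>

locale grid =
  fixes d H :: nat
begin

text \<open>An odd number of points per axis makes the box symmetric about 0, with all its angles in
  [-\<pi>, \<pi>].\<close>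

definition N :: int where "N = 2 * int H + 1"

lemma N_pos: "0 < N" by (simp add: N_def)

definition box :: "(nat \<Rightarrow> int) set" where
  "box = PiE {..<d} (\<lambda>_. {- int H..int H})"

lemma finite_box: "finite box"
  by (auto simp: box_def intro!: finite_PiE)

lemma card_box_pos: "0 < card box"
  using finite_box by (auto simp: card_gt_0_iff box_def PiE_eq_empty_iff)

definition avg :: "((nat \<Rightarrow> int) \<Rightarrow> 'a::real_normed_field) \<Rightarrow> 'a" where
  "avg f = (\<Sum>k\<in>box. f k) / of_nat (card box)"

lemma avg_const: "avg (\<lambda>_. c) = c"
  using card_box_pos by (simp add: avg_def)

lemma avg_add: "avg (\<lambda>k. f k + g k) = avg f + avg g"
  by (simp add: avg_def sum.distrib add_divide_distrib)

lemma avg_diff: "avg (\<lambda>k. f k - g k) = avg f - avg g"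
  by (simp add: avg_def sum_subtractf diff_divide_distrib)

lemma avg_cmult: "avg (\<lambda>k. c * f k) = c * avg f"
  by (simp add: avg_def sum_distrib_left)

lemma avg_sum: "avg (\<lambda>k. \<Sum>i\<in>I. f i k) = (\<Sum>i\<in>I. avg (f i))"
  by (simp add: avg_def sum.swap[of _ I] sum_divide_distrib)

lemma avg_cnj: "avg (\<lambda>k. cnj (f k)) = cnj (avg f)"
  by (simp add: avg_def)

lemma avg_Re: "Re (avg f) = avg (\<lambda>k. Re (f k))"
  by (simp add: avg_def Re_divide_of_nat)

lemma avg_of_real: "avg (\<lambda>k. of_real (f k)) = of_real (avg f)"
  by (simp add: avg_def)

lemma avg_mono: "(\<And>k. k \<in> box \<Longrightarrow> f k \<le> g k) \<Longrightarrow> avg f \<le> (avg g :: real)"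
  by (simp add: avg_def divide_right_mono sum_mono)

lemma norm_avg_le: "(\<And>k. k \<in> box \<Longrightarrow> norm (f k) \<le> g k) \<Longrightarrow> norm (avg f) \<le> avg g"
  by (simp add: avg_def norm_divide divide_right_mono sum_norm_le)

definition periodic :: "((nat \<Rightarrow> int) \<Rightarrow> 'a) \<Rightarrow> bool" where
  "periodic \<gamma> \<longleftrightarrow> (\<forall>k k'. (\<forall>i<d. k i mod N = k' i mod N) \<longrightarrow> \<gamma> k = \<gamma> k')"

lemma periodicD: "periodic \<gamma> \<Longrightarrow> (\<And>i. i < d \<Longrightarrow> k i mod N = k' i mod N) \<Longrightarrow> \<gamma> k = \<gamma> k'"
  unfolding periodic_def by blast

lemma periodicI: "(\<And>k k'. (\<And>i. i < d \<Longrightarrow> k i mod N = k' i mod N) \<Longrightarrow> \<gamma> k = \<gamma> k') \<Longrightarrow> periodic \<gamma>"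
  unfolding periodic_def by blast

lemma periodic_shift: "periodic \<gamma> \<Longrightarrow> periodic (\<lambda>k. \<gamma> (\<lambda>i. k i + a i))"
proof (rule periodicI)
  fix k k' assume "periodic \<gamma>" "\<And>i. i < d \<Longrightarrow> k i mod N = k' i mod N"
  then show "\<gamma> (\<lambda>i. k i + a i) = \<gamma> (\<lambda>i. k' i + a i)"
    by (intro periodicD[of \<gamma>] mod_add_cong refl)
qed

lemma periodic_binop:
  assumes "periodic f" "periodic g"
  shows "periodic (\<lambda>k. h (f k) (g k))"
proof (rule periodicI)
  fix k k' assume *: "\<And>i. i < d \<Longrightarrow> k i mod N = k' i mod N"
  show "h (f k) (g k) = h (f k') (g k')"
    using periodicD[OF assms(1) *] periodicD[OF assms(2) *] by simp
qed

text \<open>Translation followed by reduction to the centred residue is injective on the finite box,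
  hence a permutation of it.\<close>

lemma avg_shift:
  assumes "periodic \<gamma>"
  shows "avg (\<lambda>k. \<gamma> (\<lambda>i. k i + a i)) = avg \<gamma>"
proof -
  define c where "c = (\<lambda>z. (z + int H) mod N - int H)"
  have c_range: "c z \<in> {- int H..int H}" for z
    using pos_mod_bound[OF N_pos, of "z + int H"] pos_mod_sign[OF N_pos, of "z + int H"]
    by (auto simp: c_def N_def)
  have c_mod: "c z mod N = z mod N" for z
    by (simp add: c_def mod_diff_left_eq)
  let ?f = "\<lambda>k. \<lambda>i\<in>{..<d}. c (k i + a i)"
  have into: "?f ` box \<subseteq> box" using c_range by (auto simp: box_def)
  have "inj_on ?f box"
  proof (rule inj_onI)
    fix k k' assume k: "k \<in> box" "k' \<in> box" and eq: "?f k = ?f k'"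
    have "k i = k' i" if "i < d" for i
    proof -
      have "c (k i + a i) = c (k' i + a i)" using fun_cong[OF eq, of i] that by simp
      then have "(k i + a i) mod N = (k' i + a i) mod N" by (metis c_mod)
      then have "N dvd (k i + a i) - (k' i + a i)" by (simp add: mod_eq_dvd_iff)
      then have dvd: "N dvd k i - k' i" by simp
      have "k i \<in> {- int H..int H}" "k' i \<in> {- int H..int H}"
        using k that by (auto simp: box_def PiE_iff)
      then have "\<bar>k i - k' i\<bar> < N" by (auto simp: N_def)
      with dvd show ?thesis using dvd_imp_le_int[of "k i - k' i" N] by force
    qed
    then show "k = k'" using PiE_ext[OF k[unfolded box_def]] by simp
  qed
  then have bij: "bij_betw ?f box box"
    using into finite_box by (simp add: bij_betw_def endo_inj_surj)
  have "(\<Sum>k\<in>box. \<gamma> (\<lambda>i. k i + a i)) = (\<Sum>k\<in>box. \<gamma> (?f k))"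
    using assms unfolding periodic_def by (intro sum.cong refl) (simp add: c_mod)
  also have "\<dots> = (\<Sum>k\<in>box. \<gamma> k)" by (rule sum.reindex_bij_betw[OF bij])
  finally show ?thesis by (simp add: avg_def)
qed

section \<open>Characters, coefficients and Bessel's inequality\<close>

definition chr :: "(nat \<Rightarrow> int) \<Rightarrow> (nat \<Rightarrow> int) \<Rightarrow> complex" where
  "chr m k = cis (2 * pi / of_int N * (\<Sum>i<d. of_int (m i) * of_int (k i)))"

lemma chr_add: "chr m (\<lambda>i. k i + a i) = chr m k * chr m a"
  by (simp add: chr_def cis_mult sum.distrib distrib_left)

lemma chr_add_left: "chr (\<lambda>i. m i + m' i) k = chr m k * chr m' k"
  by (simp add: chr_def cis_mult sum.distrib distrib_left distrib_right)

lemma cnj_chr: "cnj (chr m k) = chr (\<lambda>i. - m i) k"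
  by (simp add: chr_def cis_cnj sum_negf)

lemma norm_chr: "norm (chr m k) = 1"
  by (simp add: chr_def)

lemma chr_cnj: "chr m k * cnj (chr m k) = 1"
  by (simp add: complex_norm_square[symmetric] norm_chr)

lemma periodic_chr: "periodic (chr m)"
  unfolding periodic_def
proof (intro allI impI)
  fix k k' :: "nat \<Rightarrow> int" assume "\<forall>i<d. k i mod N = k' i mod N"
  then have "N dvd k i - k' i" if "i < d" for i
    using that by (simp add: mod_eq_dvd_iff)
  then have "N dvd (\<Sum>i<d. m i * (k i - k' i))"
    by (intro dvd_sum) auto
  then obtain z where z: "(\<Sum>i<d. m i * (k i - k' i)) = N * z" by (elim dvdE)
  have "(\<Sum>i<d. of_int (m i) * of_int (k i)) - (\<Sum>i<d. of_int (m i) * of_int (k' i)) =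
      (of_int (\<Sum>i<d. m i * (k i - k' i)) :: real)"
    by (simp add: sum_subtractf right_diff_distrib)
  then have "(\<Sum>i<d. of_int (m i) * of_int (k i)) =
      (\<Sum>i<d. of_int (m i) * of_int (k' i)) + of_int N * (of_int z :: real)"
    using z by simp
  then have "chr m k = chr m k' * cis (2 * pi / of_int N * (of_int N * of_int z))"
    by (simp add: chr_def distrib_left cis_mult)
  also have "2 * pi / of_int N * (of_int N * of_int z) = 2 * pi * of_int z"
    using N_pos by simp
  finally show "chr m k = chr m k'" by simp
qed

lemma chr_unit: "i < d \<Longrightarrow> chr m (\<lambda>j. if j = i then 1 else 0) = cis (2 * pi / of_int N * of_int (m i))"
  by (simp add: chr_def if_distrib cong: if_cong)

text \<open>A unit shift along coordinate \<open>i\<close> leaves the average unchanged but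
  multiplies it by a root of unity other than 1.\<close>

lemma avg_chr_eq_0:
  assumes i: "i < d" and ndvd: "\<not> N dvd m i"
  shows "avg (chr m) = 0"
proof -
  let ?e = "\<lambda>j. if j = i then 1 else 0 :: int"
  let ?c = "chr m ?e"
  have "avg (chr m) = avg (\<lambda>k. chr m (\<lambda>i. k i + ?e i))"
    by (rule avg_shift[OF periodic_chr, symmetric])
  also have "\<dots> = ?c * avg (chr m)"
    by (simp only: chr_add mult.commute[of _ ?c] avg_cmult)
  finally have "avg (chr m) * (?c - 1) = 0" by (simp add: algebra_simps)
  moreover have "?c \<noteq> 1"
  proof
    assume "?c = 1"
    then have "cos (2 * pi / of_int N * of_int (m i)) = 1"
      unfolding chr_unit[OF i] by (simp add: complex_eq_iff)
    then obtain z :: int where "2 * pi / of_int N * of_int (m i) = of_int z * 2 * pi"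
      by (auto simp: cos_one_2pi_int)
    then have "(of_int (m i) :: real) = of_int z * of_int N"
      using N_pos by (simp add: field_simps)
    then have "m i = z * N" by (simp only: of_int_mult[symmetric] of_int_eq_iff)
    with ndvd show False by simp
  qed
  ultimately show ?thesis by simp
qed

text \<open>The character is not conjugated here, so synthesis has to use
  \<open>cnj (chr m)\<close>.\<close>

definition coef :: "((nat \<Rightarrow> int) \<Rightarrow> complex) \<Rightarrow> (nat \<Rightarrow> int) \<Rightarrow> complex" where
  "coef \<gamma> m = avg (\<lambda>k. \<gamma> k * chr m k)"

text \<open>Averaging the shifts against a character projects \<open>\<gamma>\<close> onto one
  frequency; this makes the averaging operator of a kernel diagonal.\<close>

lemma avg_chr_mult_shift:
  assumes "periodic \<gamma>"
  shows "avg (\<lambda>a. chr m a * \<gamma> (\<lambda>i. k i + a i)) = coef \<gamma> m * cnj (chr m k)"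
proof -
  have "chr m a * \<gamma> (\<lambda>i. k i + a i) = cnj (chr m k) * (\<gamma> (\<lambda>i. a i + k i) * chr m (\<lambda>i. a i + k i))" for a
  proof -
    have pull: "cnj (chr m k) * (z * chr m (\<lambda>i. a i + k i)) = chr m a * z" for z
      unfolding chr_add using chr_cnj[of m k] by (simp add: mult_ac)
    have swap: "(\<lambda>i. k i + a i) = (\<lambda>i. a i + k i)" by (simp add: add.commute)
    show ?thesis unfolding swap by (rule pull[symmetric])
  qed
  then have "avg (\<lambda>a. chr m a * \<gamma> (\<lambda>i. k i + a i)) =
      cnj (chr m k) * avg (\<lambda>a. \<gamma> (\<lambda>i. a i + k i) * chr m (\<lambda>i. a i + k i))"
    by (simp only: avg_cmult)
  also have "avg (\<lambda>a. \<gamma> (\<lambda>i. a i + k i) * chr m (\<lambda>i. a i + k i)) = coef \<gamma> m"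
    unfolding coef_def
    by (rule avg_shift[where \<gamma> = "\<lambda>k. \<gamma> k * chr m k"]) (rule periodic_binop[OF assms periodic_chr])
  finally show ?thesis by (simp only: mult.commute)
qed

lemma coef_difference:
  assumes "periodic \<gamma>"
  shows "coef (\<lambda>k. \<gamma> (\<lambda>i. k i + a i) - \<gamma> k) m = coef \<gamma> m * (cnj (chr m a) - 1)"
proof -
  have "avg (\<lambda>k. \<gamma> (\<lambda>i. k i + a i) * chr m k) = coef \<gamma> m * cnj (chr m a)"
    using avg_chr_mult_shift[OF assms, of m a] by (simp add: mult.commute add.commute)
  then show ?thesis
    by (simp add: coef_def left_diff_distrib avg_diff algebra_simps)
qed

definition orthogonal_frequencies :: "(nat \<Rightarrow> int) set \<Rightarrow> bool" where
  "orthogonal_frequencies B \<longleftrightarrow> finite B \<and>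
    (\<forall>m\<in>B. \<forall>m'\<in>B. avg (\<lambda>k. cnj (chr m k) * chr m' k) = (if m = m' then 1 else 0))"

text \<open>Expands the mean square distance of \<open>\<gamma>\<close> from its partial sum over
  \<open>B\<close>; by orthogonality the three averages involving the partial sum all equal the sum
  of squared coefficients.\<close>

lemma bessel:
  assumes B: "orthogonal_frequencies B"
  shows "(\<Sum>m\<in>B. (norm (coef \<gamma> m))\<^sup>2) \<le> avg (\<lambda>k. (norm (\<gamma> k))\<^sup>2)"
proof -
  let ?c = "coef \<gamma>"
  let ?s = "\<lambda>k. \<Sum>m\<in>B. ?c m * cnj (chr m k)"
  let ?S = "\<Sum>m\<in>B. ?c m * cnj (?c m)"
  have fin: "finite B" using B by (simp add: orthogonal_frequencies_def)
  have 1: "avg (\<lambda>k. \<gamma> k * cnj (?s k)) = ?S"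
  proof -
    have "avg (\<lambda>k. \<gamma> k * cnj (?s k)) = avg (\<lambda>k. \<Sum>m\<in>B. cnj (?c m) * (\<gamma> k * chr m k))"
      by (simp add: sum_distrib_left mult_ac)
    also have "\<dots> = (\<Sum>m\<in>B. cnj (?c m) * ?c m)"
      by (simp only: avg_sum avg_cmult coef_def)
    finally show ?thesis by (simp add: mult.commute)
  qed
  have 2: "avg (\<lambda>k. cnj (\<gamma> k) * ?s k) = ?S"
  proof -
    have "avg (\<lambda>k. cnj (\<gamma> k) * ?s k) = avg (\<lambda>k. cnj (\<gamma> k * cnj (?s k)))" by simp
    also have "\<dots> = cnj ?S" unfolding avg_cnj 1 ..
    finally show ?thesis by (simp add: mult.commute)
  qed
  have 3: "avg (\<lambda>k. ?s k * cnj (?s k)) = ?S"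
  proof -
    have "avg (\<lambda>k. ?s k * cnj (?s k)) =
        avg (\<lambda>k. \<Sum>m\<in>B. \<Sum>m'\<in>B. ?c m * cnj (?c m') * (cnj (chr m k) * chr m' k))"
      unfolding cnj_sum complex_cnj_mult complex_cnj_cnj sum_product by (simp only: mult_ac)
    also have "\<dots> = (\<Sum>m\<in>B. \<Sum>m'\<in>B. ?c m * cnj (?c m') * (if m = m' then 1 else 0))"
      unfolding avg_sum avg_cmult
      using B by (intro sum.cong refl) (auto simp: orthogonal_frequencies_def)
    also have "\<dots> = ?S" using fin by (simp add: if_distrib cong: if_cong)
    finally show ?thesis .
  qed
  have "0 \<le> avg (\<lambda>k. (norm (\<gamma> k - ?s k))\<^sup>2)"
    by (simp add: avg_def sum_nonneg)
  also have "of_real (avg (\<lambda>k. (norm (\<gamma> k - ?s k))\<^sup>2)) =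
      avg (\<lambda>k. \<gamma> k * cnj (\<gamma> k) - \<gamma> k * cnj (?s k) - cnj (\<gamma> k) * ?s k + ?s k * cnj (?s k))"
    unfolding avg_of_real[symmetric]
    by (intro arg_cong[of _ _ avg] ext) (simp only: complex_norm_square complex_cnj_diff, simp add: algebra_simps)
  then have "complex_of_real (avg (\<lambda>k. (norm (\<gamma> k - ?s k))\<^sup>2)) =
      avg (\<lambda>k. \<gamma> k * cnj (\<gamma> k)) - ?S - ?S + ?S"
    unfolding avg_add avg_diff 1 2 3 by simp
  then have "complex_of_real (avg (\<lambda>k. (norm (\<gamma> k - ?s k))\<^sup>2)) =
      of_real (avg (\<lambda>k. (norm (\<gamma> k))\<^sup>2) - (\<Sum>m\<in>B. (norm (?c m))\<^sup>2))"
    by (simp add: complex_norm_square[symmetric] avg_of_real[symmetric])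
  then have "avg (\<lambda>k. (norm (\<gamma> k - ?s k))\<^sup>2) = avg (\<lambda>k. (norm (\<gamma> k))\<^sup>2) - (\<Sum>m\<in>B. (norm (?c m))\<^sup>2)"
    by (simp only: of_real_eq_iff)
  finally show ?thesis by simp
qed

definition width :: "(nat \<Rightarrow> int) \<Rightarrow> real" where
  "width a = norm_Rd d (\<lambda>i. 2 * pi / of_int N * of_int (a i))"

lemma width_nonneg: "0 \<le> width a" by (simp add: width_def)

primrec grid_diffs :: "nat \<Rightarrow> real \<Rightarrow> ((nat \<Rightarrow> int) \<Rightarrow> complex) \<Rightarrow> bool" where
  "grid_diffs 0 M \<gamma> \<longleftrightarrow> (\<forall>k. norm (\<gamma> k) \<le> M)"
| "grid_diffs (Suc j) M \<gamma> \<longleftrightarrow> (\<forall>a. grid_diffs j (M * width a) (\<lambda>k. \<gamma> (\<lambda>i. k i + a i) - \<gamma> k))"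

text \<open>Every difference along \<open>a\<close> multiplies the coefficient at \<open>m\<close>
  by \<open>cnj (chr m a) - 1\<close>, and Bessel's inequality is applied to the p-th difference. An
  l2 bound instead of a bound on each coefficient is what leads to n^(d/2) rather than n^d.\<close>

lemma coef_power_difference:
  assumes B: "orthogonal_frequencies B"
  shows "periodic \<gamma> \<Longrightarrow> grid_diffs p M \<gamma> \<Longrightarrow>
    (\<Sum>m\<in>B. (norm (coef \<gamma> m) * norm (chr m a - 1) ^ p)\<^sup>2) \<le> (M * width a ^ p)\<^sup>2"
proof (induction p arbitrary: \<gamma> M)
  case 0
  have "avg (\<lambda>k. (norm (\<gamma> k))\<^sup>2) \<le> avg (\<lambda>_. M\<^sup>2)"
    using 0(2) by (intro avg_mono power_mono) auto
  with bessel[OF B, of \<gamma>] show ?case by (simp add: avg_const)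
next
  case (Suc p)
  let ?\<delta> = "\<lambda>k. \<gamma> (\<lambda>i. k i + a i) - \<gamma> k"
  have "periodic ?\<delta>"
    by (rule periodic_binop[where h = "(-)", OF periodic_shift[OF Suc.prems(1)] Suc.prems(1)])
  moreover have "grid_diffs p (M * width a) ?\<delta>" using Suc.prems(2) by simp
  ultimately have "(\<Sum>m\<in>B. (norm (coef ?\<delta> m) * norm (chr m a - 1) ^ p)\<^sup>2) \<le> (M * width a * width a ^ p)\<^sup>2"
    by (rule Suc.IH)
  moreover have "norm (coef ?\<delta> m) * norm (chr m a - 1) ^ p = norm (coef \<gamma> m) * norm (chr m a - 1) ^ Suc p" for m
  proof -
    have "norm (cnj (chr m a) - 1) = norm (chr m a - 1)"
      by (metis complex_cnj_diff complex_cnj_one complex_mod_cnj)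
    then show ?thesis by (simp only: coef_difference[OF Suc.prems(1)] norm_mult power_Suc mult.assoc)
  qed
  ultimately show ?case by (simp only: power_Suc mult.assoc)
qed

end

section \<open>Powers of the residual operator of a kernel\<close>

text \<open>What is needed of the Jackson kernel: an approximate identity with spectrum in
  \<open>B\<close> and multipliers in [0,1], so that the filter 1 - (1 - \<kappa>)^p never enlarges
  a coefficient.\<close>

locale kernel = grid +
  fixes K :: "(nat \<Rightarrow> int) \<Rightarrow> real" and \<kappa> :: "(nat \<Rightarrow> int) \<Rightarrow> real" and B :: "(nat \<Rightarrow> int) set" and e :: real
  assumes orth: "orthogonal_frequencies B"
    and nonneg: "0 \<le> K a"
    and mean: "avg K = 1"
    and first_moment: "avg (\<lambda>a. K a * width a) \<le> e"
    and expansion: "of_real (K a) = (\<Sum>m\<in>B. of_real (\<kappa> m) * chr m a)"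
    and \<kappa>_bounds: "0 \<le> \<kappa> m" "\<kappa> m \<le> 1"
begin

definition residual :: "((nat \<Rightarrow> int) \<Rightarrow> complex) \<Rightarrow> (nat \<Rightarrow> int) \<Rightarrow> complex" where
  "residual \<gamma> k = \<gamma> k - avg (\<lambda>a. of_real (K a) * \<gamma> (\<lambda>i. k i + a i))"

text \<open>Since \<open>K\<close> has mean 1, the residual at \<open>k\<close> is, up to sign, a
  mean of differences weighted by \<open>K\<close>, so one order of differences is exchanged for the
  first moment \<open>e\<close>. At higher orders the residual commutes with differencing.\<close>

lemma residual_diffs:
  "grid_diffs (Suc j) M \<gamma> \<Longrightarrow> 0 \<le> M \<Longrightarrow> grid_diffs j (M * e) (residual \<gamma>)"
proof (induction j arbitrary: M \<gamma>)
  case 0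
  have "norm (residual \<gamma> k) \<le> M * e" for k
  proof -
    have "residual \<gamma> k = avg (\<lambda>a. of_real (K a)) * \<gamma> k - avg (\<lambda>a. of_real (K a) * \<gamma> (\<lambda>i. k i + a i))"
      by (simp add: residual_def avg_of_real mean)
    also have "\<dots> = - avg (\<lambda>a. of_real (K a) * (\<gamma> (\<lambda>i. k i + a i) - \<gamma> k))"
      using avg_cmult[of "\<gamma> k" "\<lambda>a. of_real (K a)"] by (simp add: right_diff_distrib avg_diff mult.commute)
    finally have "norm (residual \<gamma> k) = norm (avg (\<lambda>a. of_real (K a) * (\<gamma> (\<lambda>i. k i + a i) - \<gamma> k)))"
      by simp
    also have "\<dots> \<le> avg (\<lambda>a. M * (K a * width a))"
    proof (rule norm_avg_le)
      fix a
      have "norm (\<gamma> (\<lambda>i. k i + a i) - \<gamma> k) \<le> M * width a" using 0 by simp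
      then have "K a * norm (\<gamma> (\<lambda>i. k i + a i) - \<gamma> k) \<le> K a * (M * width a)"
        by (rule mult_left_mono[OF _ nonneg])
      then show "norm (of_real (K a) * (\<gamma> (\<lambda>i. k i + a i) - \<gamma> k)) \<le> M * (K a * width a)"
        using nonneg[of a] by (simp add: norm_mult mult_ac)
    qed
    also have "\<dots> \<le> M * e"
      unfolding avg_cmult using first_moment 0(2) by (rule mult_left_mono)
    finally show ?thesis .
  qed
  then show ?case by simp
next
  case (Suc j)
  have "grid_diffs j (M * e * width b) (\<lambda>k. residual \<gamma> (\<lambda>i. k i + b i) - residual \<gamma> k)" for b
  proof -
    have "grid_diffs (Suc j) (M * width b) (\<lambda>k. \<gamma> (\<lambda>i. k i + b i) - \<gamma> k)"
      using Suc.prems(1) by (simp only: grid_diffs.simps(2)[of "Suc j"])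
    then have "grid_diffs j (M * width b * e) (residual (\<lambda>k. \<gamma> (\<lambda>i. k i + b i) - \<gamma> k))"
      using Suc.prems(2) width_nonneg by (intro Suc.IH) auto
    moreover have "residual (\<lambda>k. \<gamma> (\<lambda>i. k i + b i) - \<gamma> k) =
        (\<lambda>k. residual \<gamma> (\<lambda>i. k i + b i) - residual \<gamma> k)"
      by (rule ext) (simp add: residual_def right_diff_distrib avg_diff add_ac)
    ultimately show ?thesis by (simp add: mult_ac)
  qed
  then show ?case by simp
qed

lemma norm_residual_power:
  assumes "grid_diffs p M \<gamma>" "0 \<le> M" "0 \<le> e"
  shows "norm ((residual ^^ p) \<gamma> k) \<le> M * e ^ p"
proof -
  have "grid_diffs j (M * e ^ i) ((residual ^^ i) \<gamma>)" if "i + j = p" for i j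
    using that
  proof (induction i arbitrary: j)
    case 0
    then show ?case using assms by simp
  next
    case (Suc i)
    have "grid_diffs (Suc j) (M * e ^ i) ((residual ^^ i) \<gamma>)"
      by (rule Suc.IH) (use Suc.prems in simp)
    from residual_diffs[OF this] show ?case using assms by (simp add: mult_ac)
  qed
  from this[of p 0] show ?thesis by simp
qed

text \<open>Each step multiplies the coefficient at \<open>m\<close> in \<open>B\<close> by
  \<open>1 - \<kappa> m\<close> and changes no other frequency; what has been removed is a
  trigonometric polynomial with frequencies in \<open>B\<close>.\<close>

lemma residual_power:
  assumes "periodic \<gamma>"
  shows "(residual ^^ j) \<gamma> =
    (\<lambda>k. \<gamma> k - (\<Sum>m\<in>B. of_real (1 - (1 - \<kappa> m) ^ j) * coef \<gamma> m * cnj (chr m k)))"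
proof (induction j)
  case 0
  then show ?case by simp
next
  case (Suc j)
  have fin: "finite B" using orth by (simp add: orthogonal_frequencies_def)
  let ?b = "\<lambda>m. of_real (1 - (1 - \<kappa> m) ^ j) * coef \<gamma> m"
  let ?\<rho> = "\<lambda>k. \<gamma> k - (\<Sum>m\<in>B. ?b m * cnj (chr m k))"
  have per: "periodic ?\<rho>"
  proof -
    have "periodic (\<lambda>k. \<Sum>m\<in>B. ?b m * cnj (chr m k))"
    proof (rule periodicI)
      fix k k' assume *: "\<And>i. i < d \<Longrightarrow> k i mod N = k' i mod N"
      show "(\<Sum>m\<in>B. ?b m * cnj (chr m k)) = (\<Sum>m\<in>B. ?b m * cnj (chr m k'))"
        by (simp only: periodicD[OF periodic_chr *])
    qed
    then show ?thesis by (rule periodic_binop[OF assms])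
  qed
  have coef_\<rho>: "coef ?\<rho> m = of_real ((1 - \<kappa> m) ^ j) * coef \<gamma> m" if m: "m \<in> B" for m
  proof -
    have "coef ?\<rho> m = avg (\<lambda>k. \<gamma> k * chr m k - (\<Sum>m'\<in>B. ?b m' * (cnj (chr m' k) * chr m k)))"
      unfolding coef_def[of ?\<rho>] by (simp only: left_diff_distrib sum_distrib_right mult.assoc)
    also have "\<dots> = coef \<gamma> m - (\<Sum>m'\<in>B. ?b m' * avg (\<lambda>k. cnj (chr m' k) * chr m k))"
      by (simp only: avg_diff avg_sum avg_cmult coef_def)
    also have "(\<Sum>m'\<in>B. ?b m' * avg (\<lambda>k. cnj (chr m' k) * chr m k)) = (\<Sum>m'\<in>B. ?b m' * (if m' = m then 1 else 0))"
      using orth m by (intro sum.cong refl) (auto simp: orthogonal_frequencies_def)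
    also have "\<dots> = ?b m" using fin m by (simp add: if_distrib cong: if_cong)
    finally show ?thesis by (simp add: algebra_simps)
  qed
  have "avg (\<lambda>a. of_real (K a) * ?\<rho> (\<lambda>i. k i + a i)) =
      (\<Sum>m\<in>B. of_real (\<kappa> m) * coef ?\<rho> m * cnj (chr m k))" for k
  proof -
    note 1 = avg_chr_mult_shift[OF per]
    have "avg (\<lambda>a. of_real (K a) * ?\<rho> (\<lambda>i. k i + a i)) =
        avg (\<lambda>a. \<Sum>m\<in>B. of_real (\<kappa> m) * (chr m a * ?\<rho> (\<lambda>i. k i + a i)))"
      unfolding expansion sum_distrib_right mult.assoc ..
    then show ?thesis unfolding avg_sum avg_cmult 1 by (simp only: mult.assoc)
  qed
  then have 3: "residual ?\<rho> k = ?\<rho> k - (\<Sum>m\<in>B. of_real (\<kappa> m) * coef ?\<rho> m * cnj (chr m k))" for k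
    by (simp only: residual_def)
  have 4: "(\<Sum>m\<in>B. of_real (\<kappa> m) * coef ?\<rho> m * cnj (chr m k)) =
      (\<Sum>m\<in>B. of_real (\<kappa> m * (1 - \<kappa> m) ^ j) * coef \<gamma> m * cnj (chr m k))" for k
  proof (intro sum.cong refl)
    fix m assume m: "m \<in> B"
    show "of_real (\<kappa> m) * coef ?\<rho> m * cnj (chr m k) =
        of_real (\<kappa> m * (1 - \<kappa> m) ^ j) * coef \<gamma> m * cnj (chr m k)"
      unfolding coef_\<rho>[OF m] by simp
  qed
  \<comment> \<open>Telescoping: 1 - (1 - \<kappa>)^j + \<kappa> (1 - \<kappa>)^j = 1 - (1 -
    \<kappa>)^(j+1).\<close>
  have 5: "?\<rho> k - (\<Sum>m\<in>B. of_real (\<kappa> m * (1 - \<kappa> m) ^ j) * coef \<gamma> m * cnj (chr m k)) =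
      \<gamma> k - (\<Sum>m\<in>B. of_real (1 - (1 - \<kappa> m) ^ Suc j) * coef \<gamma> m * cnj (chr m k))" for k
    by (simp add: sum.distrib[symmetric] algebra_simps)
  show ?case unfolding funpow.simps o_apply Suc by (rule ext) (simp only: 3 4 5)
qed

end

section \<open>The Jackson kernel\<close>

text \<open>The coefficients of n times the Fejer kernel; the square modulus of this polynomial is,
  up to normalisation, the Jackson kernel.\<close>

definition tent :: "nat \<Rightarrow> int \<Rightarrow> real" where
  "tent n j = of_int (max 0 (int n - \<bar>j\<bar>))"

definition tent_mass :: "nat \<Rightarrow> real" where
  "tent_mass n = (\<Sum>j\<in>{- int n..int n}. (tent n j)\<^sup>2)"

definition tent_corr :: "nat \<Rightarrow> int \<Rightarrow> real" where
  "tent_corr n m = (\<Sum>j\<in>{- int n..int n}. tent n j * tent n (j - m)) / tent_mass n"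

lemma tent_nonneg: "0 \<le> tent n j"
  by (simp add: tent_def)

lemma tent_eq_0: "int n \<le> \<bar>j\<bar> \<Longrightarrow> tent n j = 0"
  by (simp add: tent_def)

lemma sum_tent_squares:
  assumes "finite A" "{- int n<..<int n} \<subseteq> A"
  shows "(\<Sum>j\<in>A. (tent n j)\<^sup>2) = tent_mass n"
proof -
  have "(\<Sum>j\<in>A. (tent n j)\<^sup>2) = (\<Sum>j\<in>{- int n<..<int n}. (tent n j)\<^sup>2)"
    using assms by (intro sum.mono_neutral_right) (auto simp: tent_eq_0)
  also have "\<dots> = tent_mass n"
    unfolding tent_mass_def by (intro sum.mono_neutral_left) (auto simp: tent_eq_0)
  finally show ?thesis .
qed

lemma sum_tent_squares_shift:
  "(\<Sum>j\<in>{- int n..int n}. (tent n (j - m))\<^sup>2) = (\<Sum>j\<in>{- int n - m..int n - m}. (tent n j)\<^sup>2)"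
  by (rule sum.reindex_bij_witness[of _ "\<lambda>j. j + m" "\<lambda>j. j - m"]) auto

lemma sum_tent_squares_le: "(\<Sum>j\<in>{- int n..int n}. (tent n (j - m))\<^sup>2) \<le> tent_mass n"
proof -
  let ?A = "{- int n - m..int n - m}"
  have "(\<Sum>j\<in>?A. (tent n j)\<^sup>2) \<le> (\<Sum>j\<in>?A \<union> {- int n<..<int n}. (tent n j)\<^sup>2)"
    by (rule sum_mono2) auto
  then show ?thesis
    unfolding sum_tent_squares_shift by (subst (asm) sum_tent_squares) auto
qed

lemma sum_squares_ge_cube: "real n ^ 3 \<le> 3 * (\<Sum>i\<le>n. (real i)\<^sup>2)"
proof (induction n)
  case 0
  then show ?case by simp
next
  case (Suc n)
  have "real (Suc n) ^ 3 = real n ^ 3 + 3 * (real n)\<^sup>2 + 3 * real n + 1"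
    by (simp add: power3_eq_cube power2_eq_square algebra_simps)
  also have "\<dots> \<le> 3 * (\<Sum>i\<le>n. (real i)\<^sup>2) + 3 * (real (Suc n))\<^sup>2"
    using Suc by (simp add: power2_eq_square algebra_simps)
  finally show ?case by simp
qed

lemma tent_mass_ge: "real n ^ 3 / 3 \<le> tent_mass n"
proof -
  have "(\<Sum>i\<le>n. (real i)\<^sup>2) = (\<Sum>j\<in>{0..int n}. (tent n j)\<^sup>2)"
    by (rule sum.reindex_bij_witness[of _ "\<lambda>j. n - nat j" "\<lambda>i. int (n - i)"])
      (auto simp: tent_def of_nat_diff)
  also have "\<dots> \<le> tent_mass n"
    unfolding tent_mass_def by (rule sum_mono2) auto
  finally show ?thesis using sum_squares_ge_cube[of n] by simp
qed

lemma tent_mass_pos: "1 \<le> n \<Longrightarrow> 0 < tent_mass n"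
  by (rule less_le_trans[OF _ tent_mass_ge]) simp

lemma tent_corr_nonneg: "0 \<le> tent_corr n m"
  unfolding tent_corr_def tent_mass_def
  by (intro divide_nonneg_nonneg sum_nonneg mult_nonneg_nonneg tent_nonneg) auto

lemma tent_corr_0: "1 \<le> n \<Longrightarrow> tent_corr n 0 = 1"
  using tent_mass_pos[of n] by (simp add: tent_corr_def tent_mass_def power2_eq_square)

lemma tent_corr_le_1:
  assumes "1 \<le> n"
  shows "tent_corr n m \<le> 1"
proof -
  have "(\<Sum>j\<in>{- int n..int n}. tent n j * tent n (j - m)) \<le>
      (\<Sum>j\<in>{- int n..int n}. ((tent n j)\<^sup>2 + (tent n (j - m))\<^sup>2) / 2)"
  proof (rule sum_mono)
    fix j
    have "0 \<le> (tent n j - tent n (j - m))\<^sup>2" by simp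
    then show "tent n j * tent n (j - m) \<le> ((tent n j)\<^sup>2 + (tent n (j - m))\<^sup>2) / 2"
      by (simp add: power2_diff)
  qed
  also have "\<dots> = (tent_mass n + (\<Sum>j\<in>{- int n..int n}. (tent n (j - m))\<^sup>2)) / 2"
    by (simp add: tent_mass_def sum.distrib sum_divide_distrib add_divide_distrib)
  also have "\<dots> \<le> tent_mass n" using sum_tent_squares_le[of n m] by simp
  finally show ?thesis using tent_mass_pos[OF assms] by (simp add: tent_corr_def)
qed

text \<open>The defect is half the sum of the squared increments of the tent, divided by its mass.
  The increments are at most 1 at 2n + 1 \<le> 3n points and the mass is at least n^3/3. The
  resulting order n^-2 is responsible for a first moment of order 1/n.\<close>

lemma tent_corr_1:
  assumes n: "1 \<le> n"
  shows "1 - tent_corr n 1 \<le> 9 / (2 * (real n)\<^sup>2)"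
proof -
  let ?I = "{- int n..int n}" and ?c = "tent_mass n"
  have "(\<Sum>j\<in>?I. (tent n (j - 1))\<^sup>2) = ?c"
    unfolding sum_tent_squares_shift by (rule sum_tent_squares) auto
  then have "(\<Sum>j\<in>?I. (tent n j - tent n (j - 1))\<^sup>2) = 2 * ?c - 2 * (\<Sum>j\<in>?I. tent n j * tent n (j - 1))"
    by (simp add: power2_diff sum.distrib sum_subtractf tent_mass_def[symmetric] sum_distrib_left mult.assoc)
  also have "(\<Sum>j\<in>?I. tent n j * tent n (j - 1)) = ?c * tent_corr n 1"
    using tent_mass_pos[OF n] by (simp add: tent_corr_def)
  finally have "2 * ?c * (1 - tent_corr n 1) = (\<Sum>j\<in>?I. (tent n j - tent n (j - 1))\<^sup>2)"
    by (simp add: algebra_simps)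
  also have "\<dots> \<le> (\<Sum>j\<in>?I. 1)"
  proof (rule sum_mono)
    fix j
    have "\<bar>max 0 (int n - \<bar>j\<bar>) - max 0 (int n - \<bar>j - 1\<bar>)\<bar> \<le> 1" by linarith
    then have "\<bar>tent n j - tent n (j - 1)\<bar> \<le> 1"
      unfolding tent_def by (metis of_int_1 of_int_abs of_int_diff of_int_le_iff)
    then show "(tent n j - tent n (j - 1))\<^sup>2 \<le> 1" by (simp add: abs_square_le_1)
  qed
  also have "\<dots> \<le> 3 * real n" using n by simp
  finally have *: "2 * ?c * (1 - tent_corr n 1) \<le> 3 * real n" .
  have "2 * (real n ^ 3 / 3) * (1 - tent_corr n 1) \<le> 2 * ?c * (1 - tent_corr n 1)"
    using tent_mass_ge[of n] tent_corr_le_1[OF n, of 1] by (intro mult_right_mono) auto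
  with * have "2 * (real n ^ 3 / 3) * (1 - tent_corr n 1) \<le> 3 * real n" by linarith
  then have "real n * (2 * (real n)\<^sup>2 * (1 - tent_corr n 1)) \<le> real n * 9"
    by (simp add: power3_eq_cube power2_eq_square algebra_simps)
  then have "2 * (real n)\<^sup>2 * (1 - tent_corr n 1) \<le> 9"
    using n by simp
  then show ?thesis using n by (simp add: field_simps)
qed

text \<open>Groups the double sum of the square modulus by the frequency m = j - l; the tent
  vanishes outside its range, so every inner sum extends to |m| \<le> 2n.\<close>

lemma tent_kernel_expansion:
  "of_real ((norm (\<Sum>j\<in>{- int n..int n}. of_real (tent n j) * cis (of_int j * \<theta>)))\<^sup>2 / tent_mass n) =
    (\<Sum>m\<in>{- 2 * int n..2 * int n}. of_real (tent_corr n m) * cis (of_int m * \<theta>))"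
proof -
  let ?I = "{- int n..int n}" and ?J = "{- 2 * int n..2 * int n}"
  have inner: "(\<Sum>l\<in>?I. of_real (tent n l) * cis (of_int (j - l) * \<theta>)) =
      (\<Sum>m\<in>?J. of_real (tent n (j - m)) * cis (of_int m * \<theta>))" if "j \<in> ?I" for j
  proof -
    have "(\<Sum>l\<in>?I. of_real (tent n l) * cis (of_int (j - l) * \<theta>)) =
        (\<Sum>m\<in>{j - int n..j + int n}. of_real (tent n (j - m)) * cis (of_int m * \<theta>))"
      by (rule sum.reindex_bij_witness[of _ "\<lambda>m. j - m" "\<lambda>l. j - l"]) auto
    also have "\<dots> = (\<Sum>m\<in>?J. of_real (tent n (j - m)) * cis (of_int m * \<theta>))"
      using that by (intro sum.mono_neutral_left) (auto simp: tent_eq_0)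
    finally show ?thesis .
  qed
  have "complex_of_real ((norm (\<Sum>j\<in>?I. of_real (tent n j) * cis (of_int j * \<theta>)))\<^sup>2) =
      (\<Sum>j\<in>?I. \<Sum>l\<in>?I. of_real (tent n j) * (of_real (tent n l) * cis (of_int (j - l) * \<theta>)))"
    unfolding complex_norm_square cnj_sum sum_product
    by (intro sum.cong refl) (simp add: cis_cnj cis_mult algebra_simps)
  also have "\<dots> = (\<Sum>j\<in>?I. \<Sum>m\<in>?J. of_real (tent n j) * (of_real (tent n (j - m)) * cis (of_int m * \<theta>)))"
    unfolding sum_distrib_left[symmetric] by (intro sum.cong refl arg_cong2[of _ _ _ _ "(*)"] inner)
  also have "\<dots> = (\<Sum>m\<in>?J. (\<Sum>j\<in>?I. of_real (tent n j * tent n (j - m))) * cis (of_int m * \<theta>))"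
    by (subst sum.swap) (simp add: sum_distrib_right mult.assoc)
  finally have eq: "complex_of_real ((norm (\<Sum>j\<in>?I. of_real (tent n j) * cis (of_int j * \<theta>)))\<^sup>2) = \<dots>" .
  have "(\<Sum>m\<in>?J. (\<Sum>j\<in>?I. of_real (tent n j * tent n (j - m))) * cis (of_int m * \<theta>)) / of_real (tent_mass n) =
      (\<Sum>m\<in>?J. of_real (tent_corr n m) * cis (of_int m * \<theta>))"
    unfolding sum_divide_distrib[of _ ?J] by (intro sum.cong refl) (simp add: tent_corr_def)
  then show ?thesis unfolding of_real_divide eq .
qed

lemma abs_sin_ge:
  assumes "\<bar>x\<bar> \<le> pi / 2"
  shows "2 / pi * \<bar>x\<bar> \<le> \<bar>sin x\<bar>"
proof -
  have pos: "2 / pi * y \<le> sin y" if y: "0 \<le> y" "y \<le> pi / 2" for y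
  proof -
    have "concave_on {0..pi} sin"
    proof (rule f''_le0_imp_concave)
      fix x show "(sin has_real_derivative cos x) (at x)" by (rule DERIV_sin)
      show "(cos has_real_derivative - sin x) (at x)" by (rule DERIV_cos)
      show "- sin x \<le> 0" if "x \<in> {0..pi}" using that sin_ge_zero[of x] by simp
    qed simp
    then have "(1 - 2 / pi * y) * sin 0 + (2 / pi * y) * sin (pi / 2) \<le>
        sin ((1 - 2 / pi * y) *\<^sub>R 0 + (2 / pi * y) *\<^sub>R (pi / 2))"
      using y pi_gt_zero by (intro concave_onD) (auto simp: field_simps)
    then show ?thesis by simp
  qed
  show ?thesis
    using pos[of "\<bar>x\<bar>"] assms by (cases "0 \<le> x") auto
qed

text \<open>Lets the second moment of a kernel be read off from its first Fourier
  coefficient.\<close>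

lemma square_le_one_minus_cos:
  assumes "\<bar>y\<bar> \<le> pi"
  shows "y\<^sup>2 \<le> pi\<^sup>2 / 2 * (1 - cos y)"
proof -
  have "2 / pi * \<bar>y / 2\<bar> \<le> \<bar>sin (y / 2)\<bar>" by (rule abs_sin_ge) (use assms in auto)
  then have "(2 / pi * \<bar>y / 2\<bar>)\<^sup>2 \<le> \<bar>sin (y / 2)\<bar>\<^sup>2" by (intro power_mono) auto
  then have "y\<^sup>2 \<le> pi\<^sup>2 * (sin (y / 2))\<^sup>2"
    using pi_gt_zero by (simp add: power_mult_distrib power_divide pos_divide_le_eq mult.commute)
  moreover have "cos y = 1 - 2 * (sin (y / 2))\<^sup>2"
    using cos_double_sin[of "y / 2"] by simp
  ultimately show ?thesis by simp
qed

lemma cis_sum: "cis (\<Sum>i\<in>I. f i) = (\<Prod>i\<in>I. cis (f i))"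
  by (induction I rule: infinite_finite_induct) (simp_all add: cis_mult[symmetric])

section \<open>The product kernel and its moments\<close>

context grid
begin

definition freqs :: "nat \<Rightarrow> (nat \<Rightarrow> int) set" where
  "freqs n = PiE {..<d} (\<lambda>_. {- 2 * int n..2 * int n})"

definition jackson :: "nat \<Rightarrow> (nat \<Rightarrow> int) \<Rightarrow> real" where
  "jackson n a = (\<Prod>i<d. (norm (\<Sum>j\<in>{- int n..int n}.
     of_real (tent n j) * cis (of_int j * (2 * pi / of_int N * of_int (a i)))))\<^sup>2 / tent_mass n)"

definition jackson_coef :: "nat \<Rightarrow> (nat \<Rightarrow> int) \<Rightarrow> real" where
  "jackson_coef n m = (\<Prod>i<d. tent_corr n (m i))"

lemma jackson_expansion:
  "of_real (jackson n a) = (\<Sum>m\<in>freqs n. of_real (jackson_coef n m) * chr m a)"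
proof -
  let ?t = "\<lambda>i. 2 * pi / of_int N * of_int (a i)"
  have "of_real (jackson n a) =
      (\<Prod>i<d. \<Sum>m\<in>{- 2 * int n..2 * int n}. of_real (tent_corr n m) * cis (of_int m * ?t i))"
    unfolding jackson_def of_real_prod tent_kernel_expansion ..
  also have "\<dots> = (\<Sum>m\<in>freqs n. \<Prod>i<d. of_real (tent_corr n (m i)) * cis (of_int (m i) * ?t i))"
    unfolding freqs_def by (rule prod_sum_PiE) auto
  also have "\<dots> = (\<Sum>m\<in>freqs n. of_real (jackson_coef n m) * chr m a)"
    by (intro sum.cong refl)
      (simp add: prod.distrib jackson_coef_def chr_def sum_distrib_left cis_sum mult_ac)
  finally show ?thesis .
qed

lemma finite_freqs: "finite (freqs n)"
  by (auto simp: freqs_def intro!: finite_PiE)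

lemma avg_chr:
  assumes "\<And>i. i < d \<Longrightarrow> \<bar>m i\<bar> < N"
  shows "avg (chr m) = (if \<forall>i<d. m i = 0 then 1 else 0)"
proof (cases "\<forall>i<d. m i = 0")
  case True
  then have "chr m = (\<lambda>_. 1)" by (auto simp: chr_def)
  then show ?thesis using True by (simp add: avg_const)
next
  case False
  then obtain i where i: "i < d" "m i \<noteq> 0" by blast
  have "\<not> N dvd m i"
  proof
    assume "N dvd m i"
    from dvd_imp_le_int[OF i(2) this] assms[OF i(1)] N_pos show False by simp
  qed
  then show ?thesis using False avg_chr_eq_0[OF i(1)] by auto
qed

text \<open>Frequencies differ by at most 4n \<le> 2H < N in each coordinate, so distinct ones are
  not aliased on the grid.\<close>

lemma orthogonal_freqs:
  assumes "2 * n \<le> H"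
  shows "orthogonal_frequencies (freqs n)"
  unfolding orthogonal_frequencies_def
proof (intro conjI ballI finite_freqs)
  fix m m' assume m: "m \<in> freqs n" "m' \<in> freqs n"
  have "(\<lambda>k. cnj (chr m k) * chr m' k) = chr (\<lambda>i. - m i + m' i)"
    by (rule ext) (simp only: cnj_chr chr_add_left)
  moreover have "avg (chr (\<lambda>i. - m i + m' i)) = (if \<forall>i<d. - m i + m' i = 0 then 1 else 0)"
  proof (rule avg_chr)
    fix i assume "i < d"
    with m have "m i \<in> {- 2 * int n..2 * int n}" "m' i \<in> {- 2 * int n..2 * int n}"
      by (auto simp: freqs_def PiE_iff)
    moreover have "2 * int n \<le> int H" using assms by linarith
    ultimately show "\<bar>- m i + m' i\<bar> < N" unfolding N_def abs_less_iff by auto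
  qed
  moreover have "(\<forall>i<d. - m i + m' i = 0) \<longleftrightarrow> m = m'"
  proof
    assume *: "\<forall>i<d. - m i + m' i = 0"
    show "m = m'"
      using m unfolding freqs_def by (rule PiE_ext) (use * in auto)
  qed auto
  ultimately show "avg (\<lambda>k. cnj (chr m k) * chr m' k) = (if m = m' then 1 else 0)" by simp
qed

text \<open>Averaging against a conjugate character extracts one coefficient. It is applied to e = 0
  for the mean and to unit vectors for the second moment, so |e i| \<le> 1 suffices; this keeps m -
  e below N.\<close>

lemma avg_jackson_chr:
  assumes "2 * n \<le> H" "1 \<le> n" "\<And>i. i < d \<Longrightarrow> \<bar>e i\<bar> \<le> 1"
  shows "avg (\<lambda>a. of_real (jackson n a) * chr (\<lambda>i. - e i) a) = of_real (\<Prod>i<d. tent_corr n (e i))"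
proof -
  let ?e = "\<lambda>i\<in>{..<d}. e i"
  have e: "?e \<in> freqs n" using assms(2,3) by (fastforce simp: freqs_def abs_le_iff)
  have "avg (\<lambda>a. of_real (jackson n a) * chr (\<lambda>i. - e i) a) =
      avg (\<lambda>a. \<Sum>m\<in>freqs n. of_real (jackson_coef n m) * chr (\<lambda>i. m i + - e i) a)"
    by (simp only: jackson_expansion sum_distrib_right chr_add_left mult.assoc)
  also have "\<dots> = (\<Sum>m\<in>freqs n. of_real (jackson_coef n m) * avg (chr (\<lambda>i. m i + - e i)))"
    by (simp only: avg_sum avg_cmult)
  also have "\<dots> = (\<Sum>m\<in>freqs n. if m = ?e then of_real (jackson_coef n m) else 0)"
  proof (rule sum.cong[OF refl])
    fix m assume m: "m \<in> freqs n"
    have "avg (chr (\<lambda>i. m i + - e i)) = (if \<forall>i<d. m i + - e i = 0 then 1 else 0)"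
    proof (rule avg_chr)
      fix i assume "i < d"
      with m have "m i \<in> {- 2 * int n..2 * int n}" by (auto simp: freqs_def PiE_iff)
      moreover have "2 * int n \<le> int H" "1 \<le> int n" using assms(1,2) by linarith+
      ultimately show "\<bar>m i + - e i\<bar> < N"
        using assms(3)[OF \<open>i < d\<close>] unfolding N_def abs_less_iff abs_le_iff by auto
    qed
    moreover have "(\<forall>i<d. m i + - e i = 0) \<longleftrightarrow> m = ?e"
    proof
      assume *: "\<forall>i<d. m i + - e i = 0"
      show "m = ?e"
        using m e unfolding freqs_def by (rule PiE_ext) (use * in auto)
    qed auto
    ultimately show "of_real (jackson_coef n m) * avg (chr (\<lambda>i. m i + - e i)) =
        (if m = ?e then of_real (jackson_coef n m) else 0)" by simp
  qed
  also have "\<dots> = of_real (jackson_coef n ?e)"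
    using e finite_freqs by simp
  finally show ?thesis by (simp add: jackson_coef_def)
qed

lemma avg_jackson:
  assumes "2 * n \<le> H" "1 \<le> n"
  shows "avg (jackson n) = 1"
proof -
  have "chr (\<lambda>i. - 0) a = 1" for a by (simp add: chr_def)
  then have "complex_of_real (avg (jackson n)) = 1"
    using avg_jackson_chr[OF assms, of "\<lambda>_. 0"] assms(2) by (simp add: tent_corr_0 avg_of_real)
  then show ?thesis by simp
qed

lemma jackson_nonneg: "0 \<le> jackson n a"
  unfolding jackson_def tent_mass_def by (intro prod_nonneg) (auto intro!: divide_nonneg_nonneg sum_nonneg)

text \<open>On the box the angle lies in [-\<pi>, \<pi>], so its square is dominated by 1 - cos,
  whose mean against the kernel is \<open>1 - tent_corr n 1\<close>.\<close>

lemma jackson_second_moment: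
  assumes "2 * n \<le> H" "1 \<le> n" "i < d"
  shows "avg (\<lambda>a. jackson n a * (2 * pi / of_int N * of_int (a i))\<^sup>2) \<le> 25 / (real n)\<^sup>2"
proof -
  let ?t = "\<lambda>a. 2 * pi / of_int N * of_int (a i)"
  let ?e = "\<lambda>j. if j = i then 1 else 0 :: int"
  have "chr (\<lambda>j. - ?e j) a = cis (- ?t a)" for a
  proof -
    have "(\<Sum>j<d. real_of_int (- ?e j) * of_int (a j)) = (\<Sum>j<d. if j = i then - of_int (a j) else 0)"
      by (rule sum.cong) auto
    also have "\<dots> = - of_int (a i)" using assms(3) by simp
    finally show ?thesis unfolding chr_def by (simp only: mult_minus_right)
  qed
  moreover have "(\<Prod>j<d. tent_corr n (?e j)) = tent_corr n 1"
    using assms(2,3) by (simp add: if_distrib tent_corr_0 cong: if_cong)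
  ultimately have "avg (\<lambda>a. of_real (jackson n a) * cis (- ?t a)) = of_real (tent_corr n 1)"
    using avg_jackson_chr[OF assms(1,2), of ?e] by simp
  then have "Re (avg (\<lambda>a. of_real (jackson n a) * cis (- ?t a))) = tent_corr n 1" by simp
  then have cos: "avg (\<lambda>a. jackson n a * cos (?t a)) = tent_corr n 1"
    by (simp add: avg_Re)
  have "avg (\<lambda>a. jackson n a * (?t a)\<^sup>2) \<le> avg (\<lambda>a. pi\<^sup>2 / 2 * (jackson n a - jackson n a * cos (?t a)))"
  proof (rule avg_mono)
    fix a assume "a \<in> box"
    then have "a i \<in> {- int H..int H}" using assms(3) by (auto simp: box_def PiE_iff)
    then have "\<bar>a i\<bar> \<le> int H" by auto
    then have "2 * \<bar>real_of_int (a i)\<bar> \<le> of_int N" by (simp add: N_def)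
    then have "2 * \<bar>real_of_int (a i)\<bar> / of_int N \<le> 1" using N_pos by simp
    then have "pi * (2 * \<bar>real_of_int (a i)\<bar> / of_int N) \<le> pi * 1" by (intro mult_left_mono) auto
    then have "\<bar>?t a\<bar> \<le> pi" using N_pos by (simp add: abs_mult mult_ac)
    from mult_left_mono[OF square_le_one_minus_cos[OF this] jackson_nonneg[of n a]]
    show "jackson n a * (?t a)\<^sup>2 \<le> pi\<^sup>2 / 2 * (jackson n a - jackson n a * cos (?t a))"
      by (simp add: algebra_simps)
  qed
  also have "\<dots> = pi\<^sup>2 / 2 * (1 - tent_corr n 1)"
    unfolding avg_cmult avg_diff cos using avg_jackson[OF assms(1,2)] by simp
  also have "\<dots> \<le> 10 / 2 * (9 / (2 * (real n)\<^sup>2))"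
  proof (intro mult_mono tent_corr_1 assms(2))
    have "pi\<^sup>2 \<le> (3.15::real)\<^sup>2" using pi_approx(2) by (intro power_mono) auto
    then show "pi\<^sup>2 / 2 \<le> 10 / 2" by (simp add: power2_eq_square)
  qed (use tent_corr_le_1[OF assms(2), of 1] in auto)
  \<comment> \<open>5 x 9/2 is rounded up to 25, a square, so that the first moment gets the
    constant 5.\<close>
  also have "\<dots> \<le> 25 / (real n)\<^sup>2" using assms(2) by (simp add: field_simps)
  finally show ?thesis .
qed

text \<open>Cauchy-Schwarz in the form width \<le> (width^2 + \<sigma>^2) / (2 \<sigma>), with
  \<sigma> the root of the second moment bound. The \<open>d\<close> coordinates add up under the
  root, which gives sqrt(d).\<close>

lemma jackson_first_moment:
  assumes "2 * n \<le> H" "1 \<le> n" "1 \<le> d"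
  shows "avg (\<lambda>a. jackson n a * width a) \<le> 5 * sqrt (real d) / real n"
proof -
  define \<sigma> where "\<sigma> = 5 * sqrt (real d) / real n"
  have \<sigma>: "0 < \<sigma>" using assms by (simp add: \<sigma>_def)
  have sq: "\<sigma>\<^sup>2 = real d * (25 / (real n)\<^sup>2)"
    by (simp add: \<sigma>_def power_divide power_mult_distrib)
  have width2: "(width a)\<^sup>2 = (\<Sum>i<d. (2 * pi / of_int N * of_int (a i))\<^sup>2)" for a
    unfolding width_def L2_set_def by (rule real_sqrt_pow2) (simp add: sum_nonneg)
  have "avg (\<lambda>a. jackson n a * width a) \<le>
      avg (\<lambda>a. 1 / (2 * \<sigma>) * (jackson n a * (width a)\<^sup>2) + \<sigma> / 2 * jackson n a)"
  proof (rule avg_mono)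
    fix a
    have "0 \<le> (width a - \<sigma>)\<^sup>2" by simp
    then have "2 * \<sigma> * width a \<le> (width a)\<^sup>2 + \<sigma>\<^sup>2" by (simp add: power2_diff algebra_simps)
    then have "width a \<le> ((width a)\<^sup>2 + \<sigma>\<^sup>2) / (2 * \<sigma>)"
      using \<sigma> by (subst pos_le_divide_eq) (auto simp: mult_ac)
    also have "\<dots> = 1 / (2 * \<sigma>) * (width a)\<^sup>2 + \<sigma> / 2"
      using \<sigma> by (simp add: add_divide_distrib power2_eq_square)
    finally have "jackson n a * width a \<le> jackson n a * (1 / (2 * \<sigma>) * (width a)\<^sup>2 + \<sigma> / 2)"
      using jackson_nonneg by (rule mult_left_mono)
    then show "jackson n a * width a \<le> 1 / (2 * \<sigma>) * (jackson n a * (width a)\<^sup>2) + \<sigma> / 2 * jackson n a"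
      by (simp only: distrib_left mult_ac)
  qed
  also have "\<dots> = 1 / (2 * \<sigma>) * avg (\<lambda>a. jackson n a * (width a)\<^sup>2) + \<sigma> / 2"
    unfolding avg_add avg_cmult using avg_jackson[OF assms(1,2)] by simp
  also have "avg (\<lambda>a. jackson n a * (width a)\<^sup>2) =
      (\<Sum>i<d. avg (\<lambda>a. jackson n a * (2 * pi / of_int N * of_int (a i))\<^sup>2))"
    unfolding width2 sum_distrib_left avg_sum ..
  also have "1 / (2 * \<sigma>) * \<dots> + \<sigma> / 2 \<le> 1 / (2 * \<sigma>) * (\<Sum>i<d. 25 / (real n)\<^sup>2) + \<sigma> / 2"
    using \<sigma> assms by (intro add_right_mono mult_left_mono sum_mono jackson_second_moment) auto
  also have "(\<Sum>i<d. 25 / (real n)\<^sup>2) = \<sigma>\<^sup>2" unfolding sq by simp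
  also have "1 / (2 * \<sigma>) * \<sigma>\<^sup>2 + \<sigma> / 2 = \<sigma>"
    using \<sigma> by (simp only: power2_eq_square) (simp add: field_simps)
  finally show ?thesis unfolding \<sigma>_def .
qed

lemma kernel_jackson:
  assumes "2 * n \<le> H" "1 \<le> n" "1 \<le> d"
  shows "kernel d H (jackson n) (jackson_coef n) (freqs n) (5 * sqrt (real d) / real n)"
proof
  show "orthogonal_frequencies (freqs n)" by (rule orthogonal_freqs[OF assms(1)])
  show "0 \<le> jackson n a" for a by (rule jackson_nonneg)
  show "avg (jackson n) = 1" by (rule avg_jackson[OF assms(1,2)])
  show "avg (\<lambda>a. jackson n a * width a) \<le> 5 * sqrt (real d) / real n"
    by (rule jackson_first_moment[OF assms])
  show "of_real (jackson n a) = (\<Sum>m\<in>freqs n. of_real (jackson_coef n m) * chr m a)" for a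
    by (rule jackson_expansion)
  show "0 \<le> jackson_coef n m" for m
    unfolding jackson_coef_def by (intro prod_nonneg) (simp add: tent_corr_nonneg)
  show "jackson_coef n m \<le> 1" for m
    unfolding jackson_coef_def by (intro prod_le_1) (simp add: tent_corr_nonneg tent_corr_le_1[OF assms(2)])
qed

end

section \<open>Approximation by trigonometric polynomials\<close>

lemma sum_power_le:
  fixes a :: "nat \<Rightarrow> real"
  assumes "\<And>i. i < d \<Longrightarrow> 0 \<le> a i" "1 \<le> p"
  shows "(\<Sum>i<d. a i) ^ p \<le> real d ^ (p - 1) * (\<Sum>i<d. a i ^ p)"
proof (cases "d = 0")
  case True
  then show ?thesis using assms(2) by (simp add: power_0_left)
next
  case False
  have conv: "convex_on {0::real..} (\<lambda>x. x ^ p)"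
    using convex_power_odd[of p] convex_on_subset[OF convex_power_even[of p], of "{0..}"] by (cases "even p") auto
  have "(\<lambda>x. x ^ p) (\<Sum>i<d. (1 / real d) *\<^sub>R a i) \<le> (\<Sum>i<d. (1 / real d) * a i ^ p)"
    using False assms(1) by (intro convex_on_sum[OF _ _ conv]) auto
  then have "((\<Sum>i<d. a i) / real d) ^ p \<le> (\<Sum>i<d. a i ^ p) / real d"
    by (simp add: sum_divide_distrib)
  then have "(\<Sum>i<d. a i) ^ p \<le> real d ^ p * ((\<Sum>i<d. a i ^ p) / real d)"
    using False by (simp add: power_divide pos_divide_le_eq mult.commute)
  also have "\<dots> = real d ^ (p - 1) * (\<Sum>i<d. a i ^ p)"
    using False assms(2) by (cases p) auto
  finally show ?thesis .
qed

lemma norm_cis_minus_1: "(norm (cis t - 1))\<^sup>2 = 2 * (1 - cos t)"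
proof -
  have "(norm (cis t - 1))\<^sup>2 = (cos t - 1)\<^sup>2 + (sin t)\<^sup>2"
    by (simp add: cmod_power2)
  also have "\<dots> = 2 * (1 - cos t)"
    using sin_cos_squared_add[of t] by (simp add: power2_diff)
  finally show ?thesis .
qed

lemma norm_cis_diff_le: "norm (cis a - cis b) \<le> \<bar>a - b\<bar>"
proof -
  define t where "t = a - b"
  have "\<bar>sin (t / 2)\<bar>\<^sup>2 \<le> \<bar>t / 2\<bar>\<^sup>2" by (intro power_mono abs_sin_x_le_abs_x) auto
  moreover have "cos t = 1 - 2 * (sin (t / 2))\<^sup>2"
    using cos_double_sin[of "t / 2"] by simp
  ultimately have "(norm (cis t - 1))\<^sup>2 \<le> \<bar>t\<bar>\<^sup>2"
    by (simp add: norm_cis_minus_1 power_divide)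
  then have "norm (cis t - 1) \<le> \<bar>t\<bar>" by (rule power2_le_imp_le) simp
  moreover have "cis a - cis b = cis b * (cis t - 1)"
    by (simp add: right_diff_distrib cis_mult t_def)
  ultimately show ?thesis by (simp add: norm_mult t_def)
qed

lemma norm_cis_minus_1_ge:
  assumes "\<bar>t\<bar> \<le> pi"
  shows "2 / pi * \<bar>t\<bar> \<le> norm (cis t - 1)"
proof (rule power2_le_imp_le)
  have "(2 / pi)\<^sup>2 * t\<^sup>2 \<le> (2 / pi)\<^sup>2 * (pi\<^sup>2 / 2 * (1 - cos t))"
    by (intro mult_left_mono square_le_one_minus_cos assms) auto
  also have "\<dots> = 2 * (1 - cos t)" by (simp add: power2_eq_square)
  finally show "(2 / pi * \<bar>t\<bar>)\<^sup>2 \<le> (norm (cis t - 1))\<^sup>2"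
    by (simp only: norm_cis_minus_1 power_mult_distrib power2_abs)
qed simp

section \<open>Coefficients of sampled functions\<close>

context grid
begin

definition sample :: "((nat \<Rightarrow> real) \<Rightarrow> real) \<Rightarrow> (nat \<Rightarrow> int) \<Rightarrow> complex" where
  "sample v k = of_real (v (\<lambda>i. 2 * pi / of_int N * of_int (k i)))"

lemma periodic_sample:
  assumes "periodic_2pi d v"
  shows "periodic (sample v)"
proof (rule periodicI)
  fix k k' :: "nat \<Rightarrow> int" assume *: "\<And>i. i < d \<Longrightarrow> k i mod N = k' i mod N"
  have "v (\<lambda>i. 2 * pi / of_int N * of_int (k i)) = v (\<lambda>i. 2 * pi / of_int N * of_int (k' i))"
  proof (rule assms[unfolded periodic_2pi_def, rule_format])
    fix i assume "i < d"
    then have "N dvd k i - k' i" using * by (simp add: mod_eq_dvd_iff)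
    then obtain z where "k i - k' i = N * z" by (elim dvdE)
    then have "k i = k' i + N * z" by simp
    then have "2 * pi / of_int N * of_int (k i) = 2 * pi / of_int N * of_int (k' i) + 2 * pi * of_int z"
      using N_pos by (simp add: field_simps)
    then show "\<exists>z::int. 2 * pi / of_int N * of_int (k i) = 2 * pi / of_int N * of_int (k' i) + 2 * pi * of_int z"
      by blast
  qed
  then show "sample v k = sample v k'" by (simp add: sample_def)
qed

lemma grid_diffs_sample: "bdd_diffs d p M v \<Longrightarrow> grid_diffs p M (sample v)"
proof (induction p arbitrary: M v)
  case 0
  then show ?case by (simp add: sample_def)
next
  case (Suc p)
  have "grid_diffs p (M * width a) (\<lambda>k. sample v (\<lambda>i. k i + a i) - sample v k)" for a
  proof -
    let ?h = "\<lambda>i. 2 * pi / of_int N * of_int (a i)"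
    have "bdd_diffs d p (M * width a) (\<lambda>x. v (\<lambda>i. x i + ?h i) - v x)"
      using Suc.prems by (simp add: width_def)
    then have "grid_diffs p (M * width a) (sample (\<lambda>x. v (\<lambda>i. x i + ?h i) - v x))"
      by (rule Suc.IH)
    also have "sample (\<lambda>x. v (\<lambda>i. x i + ?h i) - v x) = (\<lambda>k. sample v (\<lambda>i. k i + a i) - sample v k)"
      by (rule ext) (simp add: sample_def distrib_left)
    finally show ?thesis .
  qed
  then show ?case by simp
qed

text \<open>The unit shift along \<open>j\<close> moves the character at \<open>m\<close> by at
  least 4 |m j| / N, because |m j| \<le> 2n \<le> H, and has width 2 \<pi> / N. The grid spacing
  cancels, leaving (\<pi>/2)^p \<le> 2^p uniformly in \<open>H\<close>.\<close>

lemma coef_coordinate_power: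
  assumes nH: "2 * n \<le> H" and j: "j < d" and per: "periodic \<gamma>" and diffs: "grid_diffs p M \<gamma>" and M: "0 \<le> M"
  shows "(\<Sum>m\<in>freqs n. (norm (coef \<gamma> m) * \<bar>of_int (m j)\<bar> ^ p)\<^sup>2) \<le> (M * 2 ^ p)\<^sup>2"
proof -
  let ?N = "real_of_int N" and ?e = "\<lambda>i. if i = j then 1 else 0 :: int"
  have N: "0 < ?N" using N_pos by simp
  have w: "width ?e = 2 * pi / ?N"
  proof -
    have "width ?e = sqrt (\<Sum>i<d. if i = j then (2 * pi / ?N)\<^sup>2 else 0)"
      unfolding width_def L2_set_def by (intro arg_cong[of _ _ sqrt] sum.cong) auto
    then show ?thesis using j N by simp
  qed
  have low: "4 / ?N * \<bar>of_int (m j)\<bar> \<le> norm (chr m ?e - 1)" if "m \<in> freqs n" for m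
  proof -
    have "m j \<in> {- 2 * int n..2 * int n}" using that j by (auto simp: freqs_def PiE_iff)
    moreover have "2 * int n \<le> int H" using nH by linarith
    ultimately have "2 * \<bar>m j\<bar> \<le> N" unfolding N_def by auto
    then have "2 * \<bar>real_of_int (m j)\<bar> \<le> ?N" by linarith
    then have "2 * \<bar>real_of_int (m j)\<bar> / ?N \<le> 1" using N by simp
    then have "pi * (2 * \<bar>real_of_int (m j)\<bar> / ?N) \<le> pi * 1" by (intro mult_left_mono) auto
    then have "\<bar>2 * pi / ?N * of_int (m j)\<bar> \<le> pi" using N by (simp add: abs_mult mult_ac)
    from norm_cis_minus_1_ge[OF this] show ?thesis
      using N unfolding chr_unit[OF j] by (simp add: abs_mult)
  qed
  let ?s = "(?N / 4) ^ p"
  have "(\<Sum>m\<in>freqs n. (norm (coef \<gamma> m) * (4 / ?N * \<bar>of_int (m j)\<bar>) ^ p)\<^sup>2)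
      \<le> (\<Sum>m\<in>freqs n. (norm (coef \<gamma> m) * norm (chr m ?e - 1) ^ p)\<^sup>2)"
    using N low by (intro sum_mono power_mono mult_left_mono) auto
  also have "\<dots> \<le> (M * width ?e ^ p)\<^sup>2"
    by (rule coef_power_difference[OF orthogonal_freqs[OF nH] per diffs])
  finally have "?s\<^sup>2 * (\<Sum>m\<in>freqs n. (norm (coef \<gamma> m) * (4 / ?N * \<bar>of_int (m j)\<bar>) ^ p)\<^sup>2) \<le>
      ?s\<^sup>2 * (M * (2 * pi / ?N) ^ p)\<^sup>2"
    unfolding w by (rule mult_left_mono) simp
  moreover have "?s\<^sup>2 * (c * (4 / ?N * a) ^ p)\<^sup>2 = (c * a ^ p)\<^sup>2" for a c :: real
  proof -
    have "?s * (c * (4 / ?N * a) ^ p) = c * (?N / 4 * (4 / ?N * a)) ^ p"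
      unfolding power_mult_distrib by simp
    also have "?N / 4 * (4 / ?N * a) = a" using N by simp
    finally have "(?s * (c * (4 / ?N * a) ^ p))\<^sup>2 = (c * a ^ p)\<^sup>2" by (simp only:)
    then show ?thesis by (simp only: power_mult_distrib[where n = 2])
  qed
  moreover have "?s\<^sup>2 * (M * (2 * pi / ?N) ^ p)\<^sup>2 = (M * (pi / 2) ^ p)\<^sup>2"
  proof -
    have "?s * (M * (2 * pi / ?N) ^ p) = M * (?N / 4 * (2 * pi / ?N)) ^ p"
      unfolding power_mult_distrib by simp
    also have "?N / 4 * (2 * pi / ?N) = pi / 2" using N by simp
    finally have "(?s * (M * (2 * pi / ?N) ^ p))\<^sup>2 = (M * (pi / 2) ^ p)\<^sup>2" by (simp only:)
    then show ?thesis by (simp only: power_mult_distrib[where n = 2])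
  qed
  ultimately have "(\<Sum>m\<in>freqs n. (norm (coef \<gamma> m) * \<bar>of_int (m j)\<bar> ^ p)\<^sup>2) \<le> (M * (pi / 2) ^ p)\<^sup>2"
    by (simp only: sum_distrib_left)
  also have "\<dots> \<le> (M * 2 ^ p)\<^sup>2"
    using M pi_less_4 by (intro power_mono mult_left_mono) auto
  finally show ?thesis .
qed

text \<open>Convexity reduces |m|^(2p) to the coordinates with a factor d^(p-1), and summing over
  the coordinates adds one more d: hence sqrt(d)^p after the root. Cauchy-Schwarz costs the root of
  the number (4n+1)^d \<le> (5n)^d of frequencies.\<close>

lemma sum_coef_norm_power:
  assumes nH: "2 * n \<le> H" and n: "1 \<le> n" and p: "1 \<le> p" and d: "1 \<le> d"
    and per: "periodic \<gamma>" and diffs: "grid_diffs p M \<gamma>" and M: "0 \<le> M"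
  shows "(\<Sum>m\<in>freqs n. norm (coef \<gamma> m) * norm_Rd d (\<lambda>i. of_int (m i)) ^ p) \<le>
    sqrt ((5 * real n) ^ d) * ((2 * sqrt (real d)) ^ p * M)"
proof -
  let ?c = "\<lambda>m. norm (coef \<gamma> m)" and ?r = "\<lambda>m. norm_Rd d (\<lambda>i. real_of_int (m i))"
  have r: "(?r m ^ p)\<^sup>2 \<le> real d ^ (p - 1) * (\<Sum>j<d. (\<bar>of_int (m j)\<bar> ^ p)\<^sup>2)" for m :: "nat \<Rightarrow> int"
  proof -
    have "(?r m ^ p)\<^sup>2 = ((?r m)\<^sup>2) ^ p" by (simp add: power_mult[symmetric] mult.commute)
    also have "(?r m)\<^sup>2 = (\<Sum>j<d. (real_of_int (m j))\<^sup>2)"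
      unfolding L2_set_def by (rule real_sqrt_pow2) (simp add: sum_nonneg)
    also have "\<dots> ^ p \<le> real d ^ (p - 1) * (\<Sum>j<d. ((real_of_int (m j))\<^sup>2) ^ p)"
      by (rule sum_power_le) (use p in auto)
    also have "(\<Sum>j<d. ((real_of_int (m j))\<^sup>2) ^ p) = (\<Sum>j<d. (\<bar>of_int (m j)\<bar> ^ p)\<^sup>2)"
      by (intro sum.cong refl) (metis power2_abs power_commutes power_mult mult.commute)
    finally show ?thesis .
  qed
  have "(\<Sum>m\<in>freqs n. (?c m * ?r m ^ p)\<^sup>2) \<le>
      (\<Sum>m\<in>freqs n. (?c m)\<^sup>2 * (real d ^ (p - 1) * (\<Sum>j<d. (\<bar>of_int (m j)\<bar> ^ p)\<^sup>2)))"
    unfolding power_mult_distrib[of "?c _"] by (intro sum_mono mult_left_mono r) auto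
  also have "\<dots> = real d ^ (p - 1) * (\<Sum>j<d. \<Sum>m\<in>freqs n. (?c m * \<bar>of_int (m j)\<bar> ^ p)\<^sup>2)"
    by (subst sum.swap) (simp add: sum_distrib_left power_mult_distrib mult_ac)
  also have "\<dots> \<le> real d ^ (p - 1) * (\<Sum>j<d. (M * 2 ^ p)\<^sup>2)"
    by (intro mult_left_mono sum_mono coef_coordinate_power nH per diffs M) auto
  also have "\<dots> = real d ^ p * (M * 2 ^ p)\<^sup>2"
    using p by (cases p) auto
  also have "\<dots> = ((2 * sqrt (real d)) ^ p * M)\<^sup>2"
  proof -
    have "(sqrt (real d) ^ p)\<^sup>2 = ((sqrt (real d))\<^sup>2) ^ p"
      by (simp only: power_mult[symmetric] mult.commute)
    then have "real d ^ p = (sqrt (real d) ^ p)\<^sup>2" by simp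
    then show ?thesis by (simp only: power_mult_distrib) (simp only: mult_ac)
  qed
  finally have sq: "(\<Sum>m\<in>freqs n. (?c m * ?r m ^ p)\<^sup>2) \<le> ((2 * sqrt (real d)) ^ p * M)\<^sup>2" .
  have card: "real (card (freqs n)) \<le> (5 * real n) ^ d"
  proof -
    have "nat (4 * int n + 1) = 4 * n + 1" by linarith
    then have "card (freqs n) = (4 * n + 1) ^ d" by (simp add: freqs_def card_PiE)
    moreover have "(real (4 * n + 1)) ^ d \<le> (5 * real n) ^ d" using n by (intro power_mono) auto
    ultimately show ?thesis by (simp only: of_nat_power)
  qed
  have "(\<Sum>m\<in>freqs n. 1 * (?c m * ?r m ^ p))\<^sup>2 \<le> (\<Sum>m\<in>freqs n. 1\<^sup>2) * (\<Sum>m\<in>freqs n. (?c m * ?r m ^ p)\<^sup>2)"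
    by (rule Cauchy_Schwarz_ineq_sum)
  also have "\<dots> \<le> (5 * real n) ^ d * ((2 * sqrt (real d)) ^ p * M)\<^sup>2"
    using card by (intro mult_mono sq) (auto intro: sum_nonneg)
  also have "\<dots> = (sqrt ((5 * real n) ^ d) * ((2 * sqrt (real d)) ^ p * M))\<^sup>2"
    by (simp add: power_mult_distrib)
  finally have "(\<Sum>m\<in>freqs n. 1 * (?c m * ?r m ^ p)) \<le>
      sqrt ((5 * real n) ^ d) * ((2 * sqrt (real d)) ^ p * M)"
    by (rule power2_le_imp_le) (use M in simp)
  then show ?thesis by (simp only: mult_1)
qed

text \<open>The polynomial is what the p-th power of the residual operator removes from
  \<open>\<gamma>\<close>; its filter factors lie in [0,1], so the coefficient estimates for
  \<open>\<gamma>\<close> carry over.\<close>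

lemma approximation_at_grid_point:
  assumes nH: "2 * n \<le> H" and n: "1 \<le> n" and d: "1 \<le> d"
    and per: "periodic \<gamma>" and diffs: "grid_diffs p M \<gamma>" and M: "0 \<le> M"
  obtains b where
    "\<And>k. norm (\<gamma> k - (\<Sum>m\<in>freqs n. b m * cnj (chr m k))) \<le> M * (5 * sqrt (real d) / real n) ^ p"
    "\<And>m. norm (b m) \<le> norm (coef \<gamma> m)"
proof -
  interpret kernel d H "jackson n" "jackson_coef n" "freqs n" "5 * sqrt (real d) / real n"
    by (rule kernel_jackson[OF nH n d])
  let ?b = "\<lambda>m. of_real (1 - (1 - jackson_coef n m) ^ p) * coef \<gamma> m"
  show ?thesis
  proof (rule that[of ?b])
    fix k
    have "norm ((residual ^^ p) \<gamma> k) \<le> M * (5 * sqrt (real d) / real n) ^ p"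
      by (rule norm_residual_power[OF diffs M]) simp
    then show "norm (\<gamma> k - (\<Sum>m\<in>freqs n. ?b m * cnj (chr m k))) \<le> M * (5 * sqrt (real d) / real n) ^ p"
      unfolding residual_power[OF per] .
  next
    fix m
    have "0 \<le> (1 - jackson_coef n m) ^ p" "(1 - jackson_coef n m) ^ p \<le> 1"
      using \<kappa>_bounds[of m] by (auto intro: power_le_one)
    then have "\<bar>1 - (1 - jackson_coef n m) ^ p\<bar> * norm (coef \<gamma> m) \<le> 1 * norm (coef \<gamma> m)"
      by (intro mult_right_mono) auto
    then show "norm (?b m) \<le> norm (coef \<gamma> m)"
      by (simp only: norm_mult norm_of_real mult_1)
  qed
qed

end

text \<open>The estimate at grid points extends to all points by Lipschitz continuity. The set of
  frequencies does not depend on the grid and the coefficients are bounded by \<open>V\<close>, so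
  the polynomial has a Lipschitz constant independent of the grid, which is then refined until the
  extra error is at most \<eta>.\<close>

lemma trigonometric_approximation:
  fixes v :: "(nat \<Rightarrow> real) \<Rightarrow> real" and d n :: nat
  defines "F \<equiv> PiE {..<d} (\<lambda>_. {- 2 * int n..2 * int n})"
  assumes n: "1 \<le> n" and d: "1 \<le> d" and p: "1 \<le> p" and M: "0 \<le> M" and \<eta>: "0 < \<eta>"
    and per: "periodic_2pi d v"
    and diffs: "bdd_diffs d p M v"
    and lip: "\<And>x h. \<bar>v (\<lambda>i. x i + h i) - v x\<bar> \<le> L * norm_Rd d h"
    and bd: "\<And>x. \<bar>v x\<bar> \<le> V"
  obtains b :: "(nat \<Rightarrow> int) \<Rightarrow> complex" where
    "\<And>x. \<bar>v x - Re (\<Sum>m\<in>F. b m * cis (- (\<Sum>i<d. of_int (m i) * x i)))\<bar> \<le>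
      M * (5 * sqrt (real d) / real n) ^ p + \<eta>"
    "(\<Sum>m\<in>F. norm (b m) * norm_Rd d (\<lambda>i. of_int (m i)) ^ p) \<le>
      sqrt ((5 * real n) ^ d) * ((2 * sqrt (real d)) ^ p * M)"
proof -
  \<comment> \<open>A nearest grid point is within \<pi>/N in each coordinate. \<open>Q / N\<close>
    bounds the resulting variation of \<open>v\<close> and of the polynomial, whose frequencies are
    at most 2n.\<close>
  define Q where "Q = (\<bar>L\<bar> + real (card F) * V * (2 * real n)) * (real d * pi)"
  define H where "H = max (2 * n) (nat \<lceil>Q / \<eta>\<rceil>)"
  interpret grid d H .
  have F: "F = freqs n" by (simp add: F_def freqs_def)
  have finF: "finite F" unfolding F by (rule finite_freqs)
  have V: "0 \<le> V" using bd[of "\<lambda>_. 0"] by linarith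
  have nH: "2 * n \<le> H" by (simp add: H_def)
  let ?N = "real_of_int N"
  have N: "0 < ?N" using N_pos by simp
  have "Q / \<eta> \<le> real (nat \<lceil>Q / \<eta>\<rceil>)" by (rule real_nat_ceiling_ge)
  also have "\<dots> \<le> real H" by (simp add: H_def)
  also have "\<dots> \<le> ?N" by (simp add: N_def)
  finally have QN: "Q / ?N \<le> \<eta>" using \<eta> N by (simp add: field_simps)
  let ?\<gamma> = "sample v"
  have per\<gamma>: "periodic ?\<gamma>" by (rule periodic_sample[OF per])
  have diffs\<gamma>: "grid_diffs p M ?\<gamma>" by (rule grid_diffs_sample[OF diffs])
  obtain b where b: "\<And>k. norm (?\<gamma> k - (\<Sum>m\<in>F. b m * cnj (chr m k))) \<le> M * (5 * sqrt (real d) / real n) ^ p"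
    "\<And>m. norm (b m) \<le> norm (coef ?\<gamma> m)"
    by (rule approximation_at_grid_point[OF nH n d per\<gamma> diffs\<gamma> M, folded F]) (rule that)
  have bV: "norm (b m) \<le> V" for m
  proof -
    have "norm (coef ?\<gamma> m) \<le> avg (\<lambda>_. V)"
      unfolding coef_def by (rule norm_avg_le) (simp add: norm_mult norm_chr sample_def bd)
    then show ?thesis using b(2)[of m] by (simp add: avg_const)
  qed
  let ?s = "\<lambda>x. \<Sum>m\<in>F. b m * cis (- (\<Sum>i<d. of_int (m i) * x i))"
  show ?thesis
  proof (rule that[of b])
    fix x :: "nat \<Rightarrow> real"
    define k where "k = (\<lambda>i. round (?N * x i / (2 * pi)))"
    define y where "y = (\<lambda>i. 2 * pi / ?N * of_int (k i))"
    have xy: "\<bar>x i - y i\<bar> \<le> pi / ?N" for i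
    proof -
      have "\<bar>of_int (k i) - ?N * x i / (2 * pi)\<bar> \<le> 1 / 2"
        unfolding k_def by (rule of_int_round_abs_le)
      then have "2 * pi / ?N * \<bar>of_int (k i) - ?N * x i / (2 * pi)\<bar> \<le> 2 * pi / ?N * (1 / 2)"
        using N by (intro mult_left_mono) auto
      moreover have "2 * pi / ?N * \<bar>of_int (k i) - ?N * x i / (2 * pi)\<bar> = \<bar>y i - x i\<bar>"
      proof -
        have "2 * pi / ?N * \<bar>of_int (k i) - ?N * x i / (2 * pi)\<bar> =
            \<bar>2 * pi / ?N * (of_int (k i) - ?N * x i / (2 * pi))\<bar>"
          using N by (simp add: abs_mult)
        also have "2 * pi / ?N * (of_int (k i) - ?N * x i / (2 * pi)) = y i - x i"
          using N by (simp add: y_def right_diff_distrib)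
        finally show ?thesis .
      qed
      ultimately show ?thesis by (simp add: abs_minus_commute)
    qed
    have nxy: "(\<Sum>i<d. \<bar>x i - y i\<bar>) \<le> real d * pi / ?N"
      using sum_mono[of "{..<d}" "\<lambda>i. \<bar>x i - y i\<bar>" "\<lambda>_. pi / ?N"] xy by simp
    have 1: "\<bar>v x - v y\<bar> \<le> \<bar>L\<bar> * (real d * pi / ?N)"
    proof -
      have "\<bar>v (\<lambda>i. y i + (x i - y i)) - v y\<bar> \<le> L * norm_Rd d (\<lambda>i. x i - y i)" by (rule lip)
      also have "\<dots> \<le> \<bar>L\<bar> * norm_Rd d (\<lambda>i. x i - y i)" by (intro mult_right_mono) auto
      also have "\<dots> \<le> \<bar>L\<bar> * (real d * pi / ?N)"
        by (intro mult_left_mono order_trans[OF L2_set_le_sum_abs nxy]) auto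
      finally show ?thesis by simp
    qed
    have 2: "norm (?s y - ?s x) \<le> real (card F) * V * (2 * real n) * (real d * pi / ?N)"
    proof -
      have "norm (?s y - ?s x) \<le> (\<Sum>m\<in>F. V * (2 * real n * (real d * pi / ?N)))"
        unfolding sum_subtractf[symmetric]
      proof (rule order_trans[OF norm_sum sum_mono])
        fix m assume m: "m \<in> F"
        have "norm (cis (- (\<Sum>i<d. of_int (m i) * y i)) - cis (- (\<Sum>i<d. of_int (m i) * x i))) \<le>
            \<bar>(\<Sum>i<d. of_int (m i) * (x i - y i))\<bar>"
          using norm_cis_diff_le[of "- (\<Sum>i<d. of_int (m i) * y i)" "- (\<Sum>i<d. of_int (m i) * x i)"]
          by (simp add: right_diff_distrib sum_subtractf)
        also have "\<dots> \<le> (\<Sum>i<d. 2 * real n * \<bar>x i - y i\<bar>)"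
        proof (rule order_trans[OF sum_abs sum_mono])
          fix i assume "i \<in> {..<d}"
          then have "m i \<in> {- 2 * int n..2 * int n}" using m by (auto simp: F_def PiE_iff)
          then have "\<bar>m i\<bar> \<le> 2 * int n" by auto
          then have "\<bar>real_of_int (m i)\<bar> \<le> 2 * real n" by linarith
          then show "\<bar>of_int (m i) * (x i - y i)\<bar> \<le> 2 * real n * \<bar>x i - y i\<bar>"
            by (simp add: abs_mult mult_right_mono)
        qed
        also have "\<dots> \<le> 2 * real n * (real d * pi / ?N)"
          unfolding sum_distrib_left[symmetric] using nxy by (intro mult_left_mono) auto
        finally have "norm (b m) * norm (cis (- (\<Sum>i<d. of_int (m i) * y i)) - cis (- (\<Sum>i<d. of_int (m i) * x i))) \<le>
            V * (2 * real n * (real d * pi / ?N))"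
          using bV V by (intro mult_mono) auto
        then show "norm (b m * cis (- (\<Sum>i<d. of_int (m i) * y i)) - b m * cis (- (\<Sum>i<d. of_int (m i) * x i))) \<le>
            V * (2 * real n * (real d * pi / ?N))"
          by (simp only: right_diff_distrib[symmetric] norm_mult)
      qed
      then show ?thesis by (simp add: mult.assoc)
    qed
    have "cnj (chr m k) = cis (- (\<Sum>i<d. of_int (m i) * y i))" for m
      unfolding chr_def cis_cnj y_def by (simp add: sum_distrib_left mult_ac)
    then have "norm (of_real (v y) - ?s y) \<le> M * (5 * sqrt (real d) / real n) ^ p"
      using b(1)[of k] by (simp add: sample_def y_def)
    then have 3: "\<bar>v y - Re (?s y)\<bar> \<le> M * (5 * sqrt (real d) / real n) ^ p"
      using abs_Re_le_cmod[of "of_real (v y) - ?s y"] by simp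
    have 4: "\<bar>Re (?s y) - Re (?s x)\<bar> \<le> real (card F) * V * (2 * real n) * (real d * pi / ?N)"
      using order_trans[OF abs_Re_le_cmod 2] by simp
    have "\<bar>L\<bar> * (real d * pi / ?N) + real (card F) * V * (2 * real n) * (real d * pi / ?N) = Q / ?N"
      by (simp add: Q_def distrib_right add_divide_distrib)
    with 1 3 4 QN show "\<bar>v x - Re (?s x)\<bar> \<le> M * (5 * sqrt (real d) / real n) ^ p + \<eta>"
      by linarith
  next
    have "(\<Sum>m\<in>F. norm (b m) * norm_Rd d (\<lambda>i. of_int (m i)) ^ p) \<le>
        (\<Sum>m\<in>F. norm (coef ?\<gamma> m) * norm_Rd d (\<lambda>i. of_int (m i)) ^ p)"
      by (intro sum_mono mult_right_mono b(2)) auto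
    also have "\<dots> \<le> sqrt ((5 * real n) ^ d) * ((2 * sqrt (real d)) ^ p * M)"
      unfolding F by (rule sum_coef_norm_power[OF nH n p d per\<gamma> diffs\<gamma> M])
    finally show "(\<Sum>m\<in>F. norm (b m) * norm_Rd d (\<lambda>i. of_int (m i)) ^ p) \<le>
      sqrt ((5 * real n) ^ d) * ((2 * sqrt (real d)) ^ p * M)" .
  qed
qed

section \<open>Measures on the unit ball\<close>

lemma norm_Rd_1: "norm_Rd 1 z = \<bar>z 0\<bar>"
  by (simp add: L2_set_def lessThan_Suc)

lemma zolotarev_test_1:
  fixes F :: "nat \<Rightarrow> real \<Rightarrow> real"
  assumes deriv: "\<And>k t. (F k has_real_derivative F (Suc k) t) (at t)" and bound: "\<And>t. \<bar>F p t\<bar> \<le> 1"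
  shows "(\<lambda>y. F 0 (y 0)) \<in> zolotarev_test 1 p"
proof -
  have pd: "partial_deriv 0 (\<lambda>y. F k (y 0)) = (\<lambda>y. F (Suc k) (y 0))" for k
    unfolding partial_deriv_def by (rule ext) (simp add: DERIV_imp_deriv[OF deriv])
  have diff: "differentiable_Rd 1 (\<lambda>y. F k (y 0)) x" for k x
    unfolding differentiable_Rd_def
  proof (rule exI[of _ "\<lambda>_. F (Suc k) (x 0)"], intro allI impI)
    fix \<epsilon> :: real assume "0 < \<epsilon>"
    moreover have "(F k has_derivative (*) (F (Suc k) (x 0))) (at (x 0))"
      using deriv[of k "x 0"] by (simp add: has_field_derivative_def)
    ultimately obtain \<delta> where "0 < \<delta>" "\<And>y. \<bar>y - x 0\<bar> < \<delta> \<Longrightarrow>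
        \<bar>F k y - F k (x 0) - F (Suc k) (x 0) * (y - x 0)\<bar> \<le> \<epsilon> * \<bar>y - x 0\<bar>"
      unfolding has_derivative_at_alt by (auto simp del: has_derivative_at_alt)
    then show "\<exists>\<delta>>0. \<forall>y\<in>space (Rd 1). norm_Rd 1 (\<lambda>i. y i - x i) < \<delta> \<longrightarrow>
        \<bar>F k (y 0) - F k (x 0) - (\<Sum>i<1. F (Suc k) (x 0) * (y i - x i))\<bar> \<le>
          \<epsilon> * norm_Rd 1 (\<lambda>i. y i - x i)"
      unfolding norm_Rd_1 by (intro exI[of _ \<delta>]) (auto simp: lessThan_Suc)
  qed
  have td: "times_differentiable 1 n (\<lambda>y. F k (y 0))" for n k
  proof (induction n arbitrary: k)
    case (Suc n)
    then show ?case using diff pd by simp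
  qed simp
  have "foldr partial_deriv js (\<lambda>y. F 0 (y 0)) = (\<lambda>y. F (length js) (y 0))" if "set js \<subseteq> {..<1}" for js
    using that by (induction js) (auto simp: pd)
  then show ?thesis using td bound by (simp add: zolotarev_test_def)
qed

locale ball_measures =
  fixes d :: nat and \<mu> \<nu> :: "(nat \<Rightarrow> real) measure"
  assumes prob: "prob_space \<mu>" "prob_space \<nu>"
    and sets_eq: "sets \<mu> = sets (Rd d)" "sets \<nu> = sets (Rd d)"
    and supp: "AE x in \<mu>. x \<in> unit_ball d" "AE x in \<nu>. x \<in> unit_ball d"
begin

text \<open>Test functions are neither bounded nor given as measurable; boundedness on the ball,
  which carries both measures, is enough for integrability.\<close>

definition nice :: "((nat \<Rightarrow> real) \<Rightarrow> real) \<Rightarrow> bool" where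
  "nice g \<longleftrightarrow> g \<in> borel_measurable (Rd d) \<and> (\<exists>B. \<forall>x\<in>unit_ball d. \<bar>g x\<bar> \<le> B)"

definition \<Lambda> :: "((nat \<Rightarrow> real) \<Rightarrow> real) \<Rightarrow> real" where
  "\<Lambda> g = (\<integral>x. g x \<partial>\<mu>) - (\<integral>x. g x \<partial>\<nu>)"

lemma nice_integrable:
  assumes "nice g"
  shows "integrable \<mu> g" "integrable \<nu> g"
proof -
  obtain B where B: "\<And>x. x \<in> unit_ball d \<Longrightarrow> \<bar>g x\<bar> \<le> B" and g: "g \<in> borel_measurable (Rd d)"
    using assms by (auto simp: nice_def)
  have int: "integrable m g" if "prob_space m" "sets m = sets (Rd d)" "AE x in m. x \<in> unit_ball d" for m
  proof -
    interpret prob_space m by fact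
    show ?thesis
    proof (rule integrable_const_bound[of _ B])
      show "AE x in m. norm (g x) \<le> B" using that(3) by eventually_elim (use B in auto)
      show "g \<in> borel_measurable m" using g measurable_cong_sets[OF that(2) refl] by blast
    qed
  qed
  show "integrable \<mu> g" "integrable \<nu> g"
    using int prob sets_eq supp by auto
qed

lemma \<Lambda>_cmult: "\<Lambda> (\<lambda>x. c * f x) = c * \<Lambda> f"
  by (simp add: \<Lambda>_def right_diff_distrib)

lemma \<Lambda>_const: "\<Lambda> (\<lambda>_. c) = 0"
proof -
  interpret \<mu>: prob_space \<mu> by (rule prob)
  interpret \<nu>: prob_space \<nu> by (rule prob)
  show ?thesis by (simp add: \<Lambda>_def \<mu>.prob_space \<nu>.prob_space)
qed

lemma \<Lambda>_sum: "(\<And>i. i \<in> I \<Longrightarrow> nice (f i)) \<Longrightarrow> \<Lambda> (\<lambda>x. \<Sum>i\<in>I. f i x) = (\<Sum>i\<in>I. \<Lambda> (f i))"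
  by (simp add: \<Lambda>_def nice_integrable sum_subtractf)

lemma \<Lambda>_bound:
  assumes "nice g" "\<And>x. x \<in> unit_ball d \<Longrightarrow> \<bar>g x\<bar> \<le> B"
  shows "\<bar>\<Lambda> g\<bar> \<le> 2 * B"
proof -
  have int: "\<bar>\<integral>x. g x \<partial>m\<bar> \<le> B" if "prob_space m" "integrable m g" "AE x in m. x \<in> unit_ball d" for m
  proof -
    interpret prob_space m by fact
    have ae: "AE x in m. \<bar>g x\<bar> \<le> B" using that(3) by eventually_elim (use assms(2) in auto)
    have "\<bar>\<integral>x. g x \<partial>m\<bar> \<le> (\<integral>x. \<bar>g x\<bar> \<partial>m)" by (rule integral_abs_bound)
    also have "\<dots> \<le> (\<integral>x. B \<partial>m)"
      using that(2) ae by (intro integral_mono_AE) auto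
    finally show ?thesis by (simp add: prob_space)
  qed
  show ?thesis
    using int[OF prob(1) nice_integrable(1)[OF assms(1)] supp(1)]
      int[OF prob(2) nice_integrable(2)[OF assms(1)] supp(2)]
    unfolding \<Lambda>_def by linarith
qed

lemma nice_const: "nice (\<lambda>_. c)"
  by (auto simp: nice_def)

lemma nice_coord: "i < d \<Longrightarrow> nice (\<lambda>x. x i)"
  unfolding nice_def unit_ball_def
  by (auto intro!: exI[of _ 1] measurable_component_singleton order_trans[OF coord_le_norm_Rd])

lemma nice_add:
  assumes "nice f" "nice g"
  shows "nice (\<lambda>x. f x + g x)"
proof -
  obtain B B' where "\<forall>x\<in>unit_ball d. \<bar>f x\<bar> \<le> B" "\<forall>x\<in>unit_ball d. \<bar>g x\<bar> \<le> B'"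
    using assms by (auto simp: nice_def)
  then have "\<forall>x\<in>unit_ball d. \<bar>f x + g x\<bar> \<le> B + B'"
    by (auto intro: order_trans[OF abs_triangle_ineq add_mono])
  then show ?thesis using assms by (auto simp: nice_def)
qed

lemma nice_mult:
  assumes "nice f" "nice g"
  shows "nice (\<lambda>x. f x * g x)"
proof -
  obtain B B' where "\<forall>x\<in>unit_ball d. \<bar>f x\<bar> \<le> B" "\<forall>x\<in>unit_ball d. \<bar>g x\<bar> \<le> B'"
    using assms by (auto simp: nice_def)
  then have "\<forall>x\<in>unit_ball d. \<bar>f x * g x\<bar> \<le> B * B'"
    unfolding abs_mult by (intro ballI mult_mono) (auto intro: order_trans[OF abs_ge_zero])
  then show ?thesis using assms by (auto simp: nice_def)
qed

lemma nice_sum: "(\<And>i. i \<in> I \<Longrightarrow> nice (f i)) \<Longrightarrow> nice (\<lambda>x. \<Sum>i\<in>I. f i x)"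
  by (induction I rule: infinite_finite_induct) (auto intro: nice_add nice_const)

lemma nice_diff: "nice f \<Longrightarrow> nice g \<Longrightarrow> nice (\<lambda>x. f x - g x)"
  using nice_add[OF _ nice_mult[OF nice_const[of "-1"]], of f g] by simp

lemma \<Lambda>_diff: "nice f \<Longrightarrow> nice g \<Longrightarrow> \<Lambda> (\<lambda>x. f x - g x) = \<Lambda> f - \<Lambda> g"
  by (simp add: \<Lambda>_def nice_integrable)

lemma nice_power: "nice f \<Longrightarrow> nice (\<lambda>x. f x ^ k)"
  by (induction k) (simp_all add: nice_mult nice_const)

lemma nice_cos:
  assumes "nice f"
  shows "nice (\<lambda>x. cos (f x))"
proof -
  have "(cos :: real \<Rightarrow> real) \<in> borel_measurable borel"
    by (intro borel_measurable_continuous_onI continuous_intros)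
  then have "(\<lambda>x. cos (f x)) \<in> borel_measurable (Rd d)"
    using assms measurable_compose[of f "Rd d" borel cos borel] by (simp add: nice_def)
  moreover have "\<forall>x\<in>unit_ball d. \<bar>cos (f x)\<bar> \<le> 1" by simp
  ultimately show ?thesis unfolding nice_def by blast
qed

definition dot :: "(nat \<Rightarrow> real) \<Rightarrow> (nat \<Rightarrow> real) \<Rightarrow> real" where
  "dot x t = (\<Sum>j<d. x j * t j)"

lemma nice_dot: "nice (\<lambda>x. dot x t)"
  unfolding dot_def by (intro nice_sum nice_mult nice_coord nice_const) auto

lemma nice_hom_poly: "nice (hom_poly d k c)"
proof (induction k arbitrary: c)
  case 0
  have "hom_poly d 0 c = (\<lambda>_. c [])" by (rule ext) simp
  then show ?case by (simp only: nice_const)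
next
  case (Suc k)
  have "hom_poly d (Suc k) c = (\<lambda>x. \<Sum>j<d. x j * hom_poly d k (\<lambda>js. c (j # js)) x)"
    by (rule ext) simp
  moreover have "nice (\<lambda>x. \<Sum>j<d. x j * hom_poly d k (\<lambda>js. c (j # js)) x)"
    by (intro nice_sum nice_mult nice_coord Suc) auto
  ultimately show ?case by (simp only:)
qed

lemma taylor_eq: "taylor d n c = (\<lambda>x. \<Sum>k<n. 1 / fact k * hom_poly d k c x)"
  by (rule ext) (simp add: taylor_def)

lemma nice_taylor: "nice (taylor d n c)"
  unfolding taylor_eq by (intro nice_sum nice_mult nice_const nice_hom_poly)

text \<open>Boundedness on the ball comes from splitting into Taylor polynomial and bounded
  remainder, measurability from continuity, which p \<ge> 1 guarantees.\<close>

lemma nice_test: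
  assumes u: "u \<in> zolotarev_test d p" and p: "1 \<le> p"
  shows "nice u"
proof -
  obtain c v where v: "\<And>x. norm_Rd d x \<le> 1 \<Longrightarrow> v x = u (trunc d x) - taylor d p c x"
      "\<And>x. norm_Rd d x \<le> 1 \<Longrightarrow> \<bar>v x\<bar> \<le> sqrt (real d) ^ p"
    by (rule periodic_extension_of_test_function[OF u p]) (rule that)
  obtain B where B: "\<forall>x\<in>unit_ball d. \<bar>taylor d p c x\<bar> \<le> B"
    using nice_taylor unfolding nice_def by blast
  have "\<bar>u x\<bar> \<le> sqrt (real d) ^ p + B" if "x \<in> unit_ball d" for x
  proof -
    have x: "norm_Rd d x \<le> 1" "trunc d x = x" using that trunc_space by (auto simp: unit_ball_def)
    have "\<bar>taylor d p c x\<bar> \<le> B" using B that by blast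
    moreover have "v x = u x - taylor d p c x" using v(1)[OF x(1)] unfolding x(2) .
    ultimately show ?thesis using v(2)[OF x(1)] by linarith
  qed
  moreover have "u \<in> borel_measurable (Rd d)"
  proof -
    obtain p' where p': "p = Suc p'" using p by (cases p) auto
    have "continuous_on UNIV (\<lambda>x::nat \<Rightarrow> real. u (trunc d x))"
      using u by (intro continuous_on_trunc) (auto simp: zolotarev_test_def p')
    then have "(\<lambda>x::nat \<Rightarrow> real. u (trunc d x)) \<in> borel_measurable borel"
      by (rule borel_measurable_continuous_onI)
    then have 1: "(\<lambda>x::nat \<Rightarrow> real. u (trunc d x)) \<in> borel_measurable (PiM UNIV (\<lambda>_. borel))"
      using measurable_cong_sets[OF sets_PiM_equal_borel refl] by blast
    \<comment> \<open>Padding with zeros embeds the finite product into the countable one, where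
      product and Borel sigma-algebra coincide.\<close>
    have 2: "(\<lambda>x i. if i < d then x i else 0) \<in> Rd d \<rightarrow>\<^sub>M PiM UNIV (\<lambda>_. borel :: real measure)"
    proof (rule measurable_PiM_single')
      fix i :: nat
      show "(\<lambda>x. if i < d then x i else 0) \<in> Rd d \<rightarrow>\<^sub>M borel"
        by (cases "i < d") (auto intro: measurable_component_singleton)
    qed auto
    have "(\<lambda>x. u (trunc d (\<lambda>i. if i < d then x i else 0))) \<in> borel_measurable (Rd d)"
      using measurable_compose[OF 2 1] .
    moreover have "trunc d (\<lambda>i. if i < d then x i else 0) = x" if "x \<in> space (Rd d)" for x :: "nat \<Rightarrow> real"
    proof -
      have "trunc d (\<lambda>i. if i < d then x i else 0) = trunc d x" by (rule restrict_ext) simp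
      then show ?thesis using trunc_space[OF that] by simp
    qed
    ultimately show ?thesis by (subst measurable_cong[of _ _ "\<lambda>x. u (trunc d (\<lambda>i. if i < d then x i else 0))"]) auto
  qed
  ultimately show ?thesis unfolding nice_def by blast
qed

text \<open>A ridge function integrates as its profile does against the projected measure.\<close>

lemma \<Lambda>_ridge:
  assumes Z: "zolotarev 1 p (proj_measure d \<theta> \<mu>) (proj_measure d \<theta> \<nu>) \<le> ennreal Z" "0 \<le> Z"
    and deriv: "\<And>k t. (F k has_real_derivative F (Suc k) t) (at t)" and bound: "\<And>t. \<bar>F p t\<bar> \<le> 1"
  shows "\<bar>\<Lambda> (\<lambda>x. F 0 (dot x \<theta>))\<bar> \<le> Z"
proof -
  let ?u = "\<lambda>y::nat \<Rightarrow> real. F 0 (y 0)"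
  have "continuous_on UNIV (F 0)" using deriv by (meson DERIV_continuous_on)
  then have "F 0 \<in> borel_measurable borel" by (rule borel_measurable_continuous_onI)
  moreover have "(\<lambda>y. y 0) \<in> borel_measurable (Rd 1)" by (rule measurable_component_singleton) simp
  ultimately have u: "?u \<in> borel_measurable (Rd 1)" by (rule measurable_compose[rotated])
  have proj: "(\<lambda>x. \<lambda>i\<in>{..<1}. \<Sum>j<d. x j * \<theta> j) \<in> Rd d \<rightarrow>\<^sub>M Rd 1"
    by (intro measurable_restrict borel_measurable_sum borel_measurable_times measurable_component_singleton) auto
  have int: "(\<integral>y. ?u y \<partial>proj_measure d \<theta> m) = (\<integral>x. F 0 (dot x \<theta>) \<partial>m)" if "sets m = sets (Rd d)" for m
  proof -
    have "(\<lambda>x. \<lambda>i\<in>{..<1}. \<Sum>j<d. x j * \<theta> j) \<in> m \<rightarrow>\<^sub>M Rd 1"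
      using proj measurable_cong_sets[OF that refl] by blast
    from integral_distr[OF this u] show ?thesis by (simp add: proj_measure_def dot_def)
  qed
  have "ennreal \<bar>\<Lambda> (\<lambda>x. F 0 (dot x \<theta>))\<bar> \<le> zolotarev 1 p (proj_measure d \<theta> \<mu>) (proj_measure d \<theta> \<nu>)"
    unfolding zolotarev_def \<Lambda>_def int[OF sets_eq(1), symmetric] int[OF sets_eq(2), symmetric]
    by (rule SUP_upper) (rule zolotarev_test_1[OF deriv bound])
  with Z show ?thesis by (metis ennreal_le_iff order_trans)
qed

end

section \<open>Consequences of bounded projected distances\<close>

locale ball_measures_bounded = ball_measures +
  fixes p :: nat and Z :: real
  assumes p: "1 \<le> p" and Z0: "0 \<le> Z"
    and Z: "\<And>\<theta>. \<theta> \<in> unit_sphere d \<Longrightarrow> zolotarev 1 p (proj_measure d \<theta> \<mu>) (proj_measure d \<theta> \<nu>) \<le> ennreal Z"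
begin

lemma direction:
  obtains (zero) "norm_Rd d t = 0" "\<And>x. dot x t = 0"
  | (unit) \<theta> where "0 < norm_Rd d t" "\<theta> \<in> unit_sphere d" "\<And>x. dot x t = norm_Rd d t * dot x \<theta>"
proof (cases "norm_Rd d t = 0")
  case True
  have "t j = 0" if "j < d" for j using coord_le_norm_Rd[OF that, of t] True by simp
  then have "dot x t = 0" for x by (simp add: dot_def)
  with True show ?thesis by (rule zero)
next
  case False
  then have r: "0 < norm_Rd d t" by (simp add: less_le)
  let ?\<theta> = "trunc d (\<lambda>i. 1 / norm_Rd d t * t i)"
  have "norm_Rd d ?\<theta> = norm_Rd d (\<lambda>i. 1 / norm_Rd d t * t i)" by (rule norm_Rd_cong) simp
  also have "\<dots> = 1" unfolding norm_Rd_scale using r by simp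
  finally have "?\<theta> \<in> unit_sphere d" unfolding unit_sphere_def using trunc_in_space by blast
  moreover have "dot x t = norm_Rd d t * dot x ?\<theta>" for x
    unfolding dot_def sum_distrib_left using r by (intro sum.cong) auto
  ultimately show ?thesis using unit r by blast
qed

text \<open>The phase is carried along so that complex coefficients can be treated as real
  amplitudes with a shift.\<close>

lemma \<Lambda>_cos: "\<bar>\<Lambda> (\<lambda>x. cos (dot x t + \<phi>))\<bar> \<le> Z * norm_Rd d t ^ p"
proof (cases t rule: direction)
  case zero
  then show ?thesis using p Z0 by (simp add: \<Lambda>_const)
next
  case (unit \<theta>)
  let ?r = "norm_Rd d t"
  \<comment> \<open>Each derivative shifts the phase by \<pi>/2 and multiplies by r; dividing by r^p
    makes the p-th derivative a plain cosine, which is bounded by 1.\<close>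
  let ?F = "\<lambda>k s. ?r ^ k / ?r ^ p * cos (?r * s + \<phi> + real k * (pi / 2))"
  have "\<bar>\<Lambda> (\<lambda>x. ?F 0 (dot x \<theta>))\<bar> \<le> Z"
  proof (rule \<Lambda>_ridge[OF Z[OF unit(2)] Z0, of ?F])
    fix k s
    have "?r * s + \<phi> + real (Suc k) * (pi / 2) = (?r * s + \<phi> + real k * (pi / 2)) + pi / 2"
      by (simp add: distrib_right)
    then have "cos (?r * s + \<phi> + real (Suc k) * (pi / 2)) = - sin (?r * s + \<phi> + real k * (pi / 2))"
      by (simp only: cos_add cos_pi_half sin_pi_half)
    then have "?F (Suc k) s = ?r ^ k / ?r ^ p * (- sin (?r * s + \<phi> + real k * (pi / 2)) * ?r)"
      by (simp only: power_Suc) simp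
    moreover have "(?F k has_real_derivative ?r ^ k / ?r ^ p * (- sin (?r * s + \<phi> + real k * (pi / 2)) * ?r)) (at s)"
      by (rule DERIV_cmult) (auto intro!: derivative_eq_intros)
    ultimately show "(?F k has_real_derivative ?F (Suc k) s) (at s)" by (simp only:)
  next
    fix s
    have "?r ^ p / ?r ^ p = 1" using unit(1) by simp
    then show "\<bar>?F p s\<bar> \<le> 1" by (simp only: mult_1 abs_cos_le_one)
  qed
  moreover have "\<Lambda> (\<lambda>x. ?F 0 (dot x \<theta>)) = 1 / ?r ^ p * \<Lambda> (\<lambda>x. cos (dot x t + \<phi>))"
    unfolding \<Lambda>_cmult[symmetric] unit(3) by simp
  ultimately show ?thesis using unit(1) by (simp add: abs_mult pos_divide_le_eq)
qed

text \<open>Every multiple of s^n with n < p is a test function, since its p-th derivative is zero;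
  a finite \<open>Z\<close> then forces the difference of moments to vanish.\<close>

lemma \<Lambda>_dot_power:
  assumes "n < p"
  shows "\<Lambda> (\<lambda>x. dot x t ^ n) = 0"
proof (cases t rule: direction)
  case zero
  then show ?thesis by (simp add: \<Lambda>_const)
next
  case (unit \<theta>)
  have "\<bar>m * \<Lambda> (\<lambda>x. dot x \<theta> ^ n)\<bar> \<le> Z" for m
  proof -
    \<comment> \<open>For k > n the product contains the factor with i = n, which is 0, so the
      truncated exponent n - k does no harm.\<close>
    let ?F = "\<lambda>k s. m * (\<Prod>i<k. real (n - i)) * s ^ (n - k)"
    have "\<bar>\<Lambda> (\<lambda>x. ?F 0 (dot x \<theta>))\<bar> \<le> Z"
    proof (rule \<Lambda>_ridge[OF Z[OF unit(2)] Z0, of ?F])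
      fix k s
      have "(?F k has_real_derivative m * (\<Prod>i<k. real (n - i)) * (real (n - k) * s ^ (n - k - 1))) (at s)"
        by (auto intro!: derivative_eq_intros)
      then show "(?F k has_real_derivative ?F (Suc k) s) (at s)"
        by (simp add: mult.assoc)
    next
      fix s
      have zero: "(\<Prod>i<p. real (n - i)) = 0"
        using assms by (intro prod_zero bexI[of _ n]) auto
      show "\<bar>?F p s\<bar> \<le> 1" unfolding zero by simp
    qed
    then show ?thesis by (simp add: \<Lambda>_cmult)
  qed
  \<comment> \<open>This multiple would make the left side Z + 1, unless the difference of moments
    is 0.\<close>
  from this[of "(Z + 1) / \<Lambda> (\<lambda>x. dot x \<theta> ^ n)"] have "\<Lambda> (\<lambda>x. dot x \<theta> ^ n) = 0"
    using Z0 by (cases "\<Lambda> (\<lambda>x. dot x \<theta> ^ n) = 0") auto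
  then show ?thesis unfolding unit(3) power_mult_distrib \<Lambda>_cmult by simp
qed

lemma nice_prod_list: "nice (\<lambda>x. prod_list (map (dot x) hs))"
  by (induction hs) (auto intro: nice_mult nice_dot nice_const)

text \<open>Polarisation: \<open>s \<mapsto> \<langle>x, t + s h\<rangle>\<^sup>m\<close> is annihilated for every \<open>s\<close>, hence so is its linear coefficient.\<close>

lemma \<Lambda>_prod_dot_power:
  "length hs + m < p \<Longrightarrow> \<Lambda> (\<lambda>x. prod_list (map (dot x) hs) * dot x t ^ m) = 0"
proof (induction hs arbitrary: m t)
  case Nil
  then show ?case by (simp add: \<Lambda>_dot_power)
next
  case (Cons h hs)
  let ?P = "\<lambda>x. prod_list (map (dot x) hs)"
  let ?f = "\<lambda>i x. ?P x * (dot x h ^ i * dot x t ^ (Suc m - i))"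
  let ?a = "\<lambda>i. real (Suc m choose i) * \<Lambda> (?f i)"
  have "(\<Sum>i\<le>Suc m. ?a i * s ^ i) = 0" for s
  proof -
    have "?P x * dot x (\<lambda>j. t j + s * h j) ^ Suc m =
        (\<Sum>i\<le>Suc m. (real (Suc m choose i) * s ^ i) * ?f i x)" for x
    proof -
      have "dot x (\<lambda>j. t j + s * h j) = s * dot x h + dot x t"
        by (simp add: dot_def distrib_left sum.distrib sum_distrib_left mult_ac)
      then have "dot x (\<lambda>j. t j + s * h j) ^ Suc m =
          (\<Sum>i\<le>Suc m. real (Suc m choose i) * (s * dot x h) ^ i * dot x t ^ (Suc m - i))"
        by (simp only: binomial_ring)
      then show ?thesis by (simp only: sum_distrib_left power_mult_distrib mult_ac)
    qed
    then have "\<Lambda> (\<lambda>x. ?P x * dot x (\<lambda>j. t j + s * h j) ^ Suc m) =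
        \<Lambda> (\<lambda>x. \<Sum>i\<le>Suc m. (real (Suc m choose i) * s ^ i) * ?f i x)"
      by (simp only:)
    also have "\<dots> = (\<Sum>i\<le>Suc m. \<Lambda> (\<lambda>x. (real (Suc m choose i) * s ^ i) * ?f i x))"
      by (intro \<Lambda>_sum nice_mult nice_const nice_prod_list nice_power nice_dot)
    also have "\<dots> = (\<Sum>i\<le>Suc m. ?a i * s ^ i)"
      unfolding \<Lambda>_cmult by (simp only: mult_ac)
    finally show ?thesis using Cons.IH[of "Suc m" "\<lambda>j. t j + s * h j"] Cons.prems by simp
  qed
  then have "?a 1 = 0"
    using polyfun_eq_0[of ?a "Suc m"] by auto
  then have "\<Lambda> (?f 1) = 0" by simp
  moreover have "?f 1 = (\<lambda>x. prod_list (map (dot x) (h # hs)) * dot x t ^ m)"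
    by (rule ext) (simp add: mult_ac)
  ultimately show ?case by (simp only:)
qed

text \<open>Writing x_j as the product with the j-th unit vector moves one index of the form into
  the list. The total degree stays below p, and the polarised moments apply once no index is
  left.\<close>

lemma \<Lambda>_prod_hom_poly:
  "length hs + k < p \<Longrightarrow> \<Lambda> (\<lambda>x. prod_list (map (dot x) hs) * hom_poly d k c x) = 0"
proof (induction k arbitrary: hs c)
  case 0
  have "\<Lambda> (\<lambda>x. c [] * prod_list (map (dot x) hs)) = 0"
    using \<Lambda>_prod_dot_power[of hs 0] 0 by (simp add: \<Lambda>_cmult)
  then show ?case by (simp add: mult.commute)
next
  case (Suc k)
  let ?e = "\<lambda>j i. if i = j then 1 else 0 :: real"
  let ?g = "\<lambda>j x. prod_list (map (dot x) (?e j # hs)) * hom_poly d k (\<lambda>js. c (j # js)) x"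
  have "dot x (?e j) = x j" if "j < d" for x j
    using that by (simp add: dot_def if_distrib cong: if_cong)
  then have "prod_list (map (dot x) hs) * hom_poly d (Suc k) c x = (\<Sum>j<d. ?g j x)" for x
    unfolding hom_poly.simps sum_distrib_left by (intro sum.cong) (auto simp: mult_ac)
  then have "\<Lambda> (\<lambda>x. prod_list (map (dot x) hs) * hom_poly d (Suc k) c x) = \<Lambda> (\<lambda>x. \<Sum>j<d. ?g j x)"
    by (simp only:)
  also have "\<dots> = (\<Sum>j<d. \<Lambda> (?g j))"
    by (intro \<Lambda>_sum nice_mult nice_prod_list nice_hom_poly)
  also have "\<dots> = 0"
    using Suc.prems by (intro sum.neutral ballI Suc.IH) simp
  finally show ?case .
qed

lemma \<Lambda>_taylor: "\<Lambda> (taylor d p c) = 0"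
proof -
  have "\<Lambda> (taylor d p c) = (\<Sum>k<p. \<Lambda> (\<lambda>x. 1 / fact k * hom_poly d k c x))"
    unfolding taylor_eq by (intro \<Lambda>_sum nice_mult nice_const nice_hom_poly)
  also have "\<dots> = 0"
  proof (rule sum.neutral, rule ballI)
    fix k assume "k \<in> {..<p}"
    then have "\<Lambda> (hom_poly d k c) = 0" using \<Lambda>_prod_hom_poly[of "[]" k c] by simp
    then show "\<Lambda> (\<lambda>x. 1 / fact k * hom_poly d k c x) = 0" by (simp only: \<Lambda>_cmult)
  qed
  finally show ?thesis .
qed

text \<open>The first bound is for distances of order one, the second for small ones. 255 = 51 x 5
  combines smoothness of \<open>v\<close> with the kernel moment, 102 = 51 x 2 with the coefficient
  estimate; the factor 2 counts the two measures. The error \<epsilon> from sampling is removed at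
  the end.\<close>

lemma test_function_bounds:
  assumes u: "u \<in> zolotarev_test d p" and d: "1 \<le> d"
  shows "\<bar>\<Lambda> u\<bar> \<le> 2 * sqrt (real d) ^ p"
    and "1 \<le> n \<Longrightarrow> \<bar>\<Lambda> u\<bar> \<le> 2 * (255 * real d / real n) ^ p + Z * sqrt ((5 * real n) ^ d) * (102 * real d) ^ p"
proof -
  obtain c v L V where
    v: "\<And>x. norm_Rd d x \<le> 1 \<Longrightarrow> v x = u (trunc d x) - taylor d p c x"
    and v_bound: "\<And>x. norm_Rd d x \<le> 1 \<Longrightarrow> \<bar>v x\<bar> \<le> sqrt (real d) ^ p"
    and per: "periodic_2pi d v"
    and diffs: "bdd_diffs d p ((51 * sqrt (real d)) ^ p) v"
    and lip: "\<And>x h. \<bar>v (\<lambda>i. x i + h i) - v x\<bar> \<le> L * norm_Rd d h"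
    and bd: "\<And>x. \<bar>v x\<bar> \<le> V"
    by (rule periodic_extension_of_test_function[OF u p]) (rule that)
  let ?w = "\<lambda>x. u x - taylor d p c x"
  have w: "nice ?w" by (intro nice_diff nice_test[OF u p] nice_taylor)
  have wv: "?w x = v x" "norm_Rd d x \<le> 1" if "x \<in> unit_ball d" for x
    using that v[of x] trunc_space[of x d] by (auto simp: unit_ball_def)
  have \<Lambda>w: "\<Lambda> ?w = \<Lambda> u"
    by (simp add: \<Lambda>_diff nice_test[OF u p] nice_taylor \<Lambda>_taylor)
  show "\<bar>\<Lambda> u\<bar> \<le> 2 * sqrt (real d) ^ p"
    unfolding \<Lambda>w[symmetric] by (rule \<Lambda>_bound[OF w]) (simp add: wv v_bound)
  let ?M = "(51 * sqrt (real d)) ^ p"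
  assume n: "1 \<le> n"
  have "\<bar>\<Lambda> u\<bar> \<le> (2 * (255 * real d / real n) ^ p + Z * sqrt ((5 * real n) ^ d) * (102 * real d) ^ p) + \<epsilon>"
    if \<epsilon>: "0 < \<epsilon>" for \<epsilon>
  proof -
    have M0: "0 \<le> ?M" and e2: "0 < \<epsilon> / 2" using \<epsilon> by simp_all
    let ?F = "PiE {..<d} (\<lambda>_. {- 2 * int n..2 * int n})"
    obtain b :: "(nat \<Rightarrow> int) \<Rightarrow> complex" where
      b: "\<And>x. \<bar>v x - Re (\<Sum>m\<in>?F. b m * cis (- (\<Sum>i<d. of_int (m i) * x i)))\<bar> \<le>
        ?M * (5 * sqrt (real d) / real n) ^ p + \<epsilon> / 2"
      "(\<Sum>m\<in>?F. norm (b m) * norm_Rd d (\<lambda>i. of_int (m i)) ^ p) \<le>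
        sqrt ((5 * real n) ^ d) * ((2 * sqrt (real d)) ^ p * ?M)"
      by (rule trigonometric_approximation[OF n d p M0 e2 per diffs lip bd]) (rule that)
    let ?t = "\<lambda>m i. - real_of_int (m i)"
    \<comment> \<open>Polar form turns every complex term into a phase-shifted cosine, to which
      \<open>\<Lambda>_cos\<close> applies.\<close>
    have Re_b: "Re (b m * cis (- (\<Sum>i<d. of_int (m i) * x i))) =
        norm (b m) * cos (dot x (?t m) + Arg (b m))" for m x
    proof -
      have "- (\<Sum>i<d. of_int (m i) * x i) = dot x (?t m)"
        by (simp add: dot_def sum_negf mult.commute)
      moreover have "b m = of_real (norm (b m)) * cis (Arg (b m))"
        using rcis_cmod_Arg[of "b m"] by (simp add: rcis_def)
      ultimately have "b m * cis (- (\<Sum>i<d. of_int (m i) * x i)) =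
          of_real (norm (b m)) * cis (dot x (?t m) + Arg (b m))"
        by (metis cis_mult mult.assoc mult.commute)
      then show ?thesis by simp
    qed
    let ?g = "\<lambda>x. \<Sum>m\<in>?F. norm (b m) * cos (dot x (?t m) + Arg (b m))"
    have nice1: "nice (\<lambda>x. norm (b m) * cos (dot x (?t m) + Arg (b m)))" for m
      by (intro nice_mult nice_const nice_cos nice_add nice_dot)
    have g: "nice ?g" by (intro nice_sum nice1)
    have approx: "\<bar>?w x - ?g x\<bar> \<le> ?M * (5 * sqrt (real d) / real n) ^ p + \<epsilon> / 2" if "x \<in> unit_ball d" for x
      using b(1)[of x] wv[OF that] by (simp only: Re_sum Re_b)
    have M: "?M * (5 * sqrt (real d) / real n) ^ p = (255 * real d / real n) ^ p"
    proof -
      have "51 * sqrt (real d) * (5 * sqrt (real d) / real n) = 255 * (sqrt (real d) * sqrt (real d)) / real n"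
        by simp
      then show ?thesis unfolding power_mult_distrib[symmetric] by simp
    qed
    have "\<bar>\<Lambda> (\<lambda>x. ?w x - ?g x)\<bar> \<le> 2 * ((255 * real d / real n) ^ p + \<epsilon> / 2)"
      using approx unfolding M by (intro \<Lambda>_bound nice_diff w g)
    moreover have "\<bar>\<Lambda> ?g\<bar> \<le> Z * sqrt ((5 * real n) ^ d) * (102 * real d) ^ p"
    proof -
      have "\<bar>\<Lambda> ?g\<bar> \<le> (\<Sum>m\<in>?F. \<bar>\<Lambda> (\<lambda>x. norm (b m) * cos (dot x (?t m) + Arg (b m)))\<bar>)"
        unfolding \<Lambda>_sum[OF nice1] by (rule sum_abs)
      also have "\<dots> \<le> (\<Sum>m\<in>?F. Z * (norm (b m) * norm_Rd d (\<lambda>i. of_int (m i)) ^ p))"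
      proof (rule sum_mono)
        fix m
        have "norm_Rd d (?t m) = norm_Rd d (\<lambda>i. of_int (m i))" by (simp add: L2_set_def)
        then have "norm (b m) * \<bar>\<Lambda> (\<lambda>x. cos (dot x (?t m) + Arg (b m)))\<bar> \<le>
            norm (b m) * (Z * norm_Rd d (\<lambda>i. of_int (m i)) ^ p)"
          using \<Lambda>_cos[of "?t m" "Arg (b m)"] by (intro mult_left_mono) auto
        then show "\<bar>\<Lambda> (\<lambda>x. norm (b m) * cos (dot x (?t m) + Arg (b m)))\<bar> \<le>
            Z * (norm (b m) * norm_Rd d (\<lambda>i. of_int (m i)) ^ p)"
          by (simp add: \<Lambda>_cmult abs_mult mult_ac)
      qed
      also have "\<dots> \<le> Z * (sqrt ((5 * real n) ^ d) * ((2 * sqrt (real d)) ^ p * ?M))"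
        unfolding sum_distrib_left[symmetric] by (rule mult_left_mono[OF b(2) Z0])
      also have "(2 * sqrt (real d)) ^ p * ?M = (102 * real d) ^ p"
      proof -
        have "2 * sqrt (real d) * (51 * sqrt (real d)) = 102 * (sqrt (real d) * sqrt (real d))" by simp
        then show ?thesis unfolding power_mult_distrib[symmetric] by simp
      qed
      finally show ?thesis by (simp only: mult.assoc)
    qed
    moreover have "\<Lambda> u = \<Lambda> (\<lambda>x. ?w x - ?g x) + \<Lambda> ?g"
      unfolding \<Lambda>_diff[OF w g] \<Lambda>w by simp
    moreover have "\<bar>l\<bar> \<le> 2 * a + z + \<epsilon>"
      if "\<bar>x\<bar> \<le> 2 * (a + \<epsilon> / 2)" "\<bar>y\<bar> \<le> z" "l = x + y" for a l x y z :: real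
      using that by (auto simp: abs_le_iff)
    ultimately show ?thesis by blast
  qed
  then show "\<bar>\<Lambda> u\<bar> \<le> 2 * (255 * real d / real n) ^ p + Z * sqrt ((5 * real n) ^ d) * (102 * real d) ^ p"
    by (rule field_le_epsilon)
qed

end

section \<open>Choice of the scale and conclusion\<close>

lemma ennreal_powr_le_imp_le:
  assumes "ennreal_powr z a \<le> ennreal s" "0 < a" "0 \<le> s"
  shows "z \<le> ennreal (s powr (1 / a))"
proof -
  have fin: "z \<noteq> \<infinity>" using assms(1) by (auto simp: ennreal_powr_def top_unique)
  then have "enn2real z powr a \<le> s"
    using assms by (simp add: ennreal_powr_def)
  then have "(enn2real z powr a) powr (1 / a) \<le> s powr (1 / a)"
    using assms by (intro powr_mono2) auto
  then have "enn2real z \<le> s powr (1 / a)"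
    using assms(2) by (simp add: powr_powr)
  moreover have "z = ennreal (enn2real z)"
    using fin by (simp add: less_top)
  ultimately show ?thesis by (metis ennreal_leI)
qed

text \<open>
  Optimisation of the scale: the error term \<open>n\<^sup>-\<^sup>p\<close> balances \<open>Z n\<^sup>d\<^sup>/\<^sup>2\<close> when
  \<open>n\<close> is of the order of \<open>s\<^sup>-\<^sup>1\<^sup>/\<^sup>p\<close>, where \<open>Z = s\<^sup>1\<^sup>+\<^sup>d\<^sup>/\<^sup>2\<^sup>p\<close>.
\<close>

lemma optimise_scale:
  fixes s y :: real and d p :: nat
  defines "Z \<equiv> s powr (1 / (2 / (2 + real d / real p)))"
  assumes d: "1 \<le> d" and p: "1 \<le> p" and s: "0 \<le> s"
    and trivial: "y \<le> 2 * sqrt (real d) ^ p"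
    and scale: "\<And>n. 1 \<le> n \<Longrightarrow>
      y \<le> 2 * (255 * real d / real n) ^ p + Z * sqrt ((5 * real n) ^ d) * (102 * real d) ^ p"
  shows "y \<le> (10200 * real d) ^ p * s"
proof (cases "s = 0")
  case True
  \<comment> \<open>Here Z = 0, so only the first term is left and n may tend to infinity.\<close>
  have "y \<le> 2 * (255 * real d) ^ p * (1 / real (Suc n))" for n
  proof -
    have "y \<le> 2 * (255 * real d / real (Suc n)) ^ p"
      using scale[of "Suc n"] True by (simp add: Z_def)
    also have "\<dots> = 2 * (255 * real d) ^ p * (1 / real (Suc n)) ^ p"
      by (simp add: power_divide)
    also have "(1 / real (Suc n)) ^ p \<le> (1 / real (Suc n)) ^ 1"
      using p by (intro power_decreasing) auto
    finally show ?thesis by (simp add: mult_left_mono)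
  qed
  moreover have "(\<lambda>n. 2 * (255 * real d) ^ p * (1 / real (Suc n))) \<longlonglongrightarrow> 2 * (255 * real d) ^ p * 0"
    by (intro tendsto_mult_left LIMSEQ_Suc[OF lim_1_over_n])
  ultimately have "y \<le> 2 * (255 * real d) ^ p * 0"
    by (intro LIMSEQ_le_const) auto
  with True show ?thesis by simp
next
  case False
  with s have s: "0 < s" by simp
  define x where "x = s powr (1 / real p)"
  have x: "0 < x" using s by (simp add: x_def)
  have xp: "x ^ p = s"
    using s p by (simp add: x_def powr_realpow[symmetric] powr_powr)
  have Z: "Z = s * sqrt (x ^ d)"
  proof -
    have "1 / (2 / (2 + real d / real p)) = 1 + 1 / real p * real d * (1 / 2)"
      using p by (simp add: field_simps)
    then have "Z = s powr (1 + 1 / real p * real d * (1 / 2))"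
      unfolding Z_def by (simp only:)
    then have "Z = s * ((s powr (1 / real p)) powr real d) powr (1 / 2)"
      using s by (simp add: powr_add powr_powr)
    then show ?thesis using x by (simp add: x_def[symmetric] powr_realpow powr_half_sqrt)
  qed
  show ?thesis
  proof (cases "1 \<le> 5 * x")
    case True
    \<comment> \<open>Here s \<ge> 5^-p is not small, so the trivial bound is enough at the price of
      a factor (5x)^p \<ge> 1.\<close>
    have "y \<le> 2 * sqrt (real d) ^ p" by (rule trivial)
    also have "\<dots> \<le> 2 ^ p * real d ^ p"
    proof (rule mult_mono)
      show "(2::real) \<le> 2 ^ p" using p by (cases p) auto
      have "sqrt (real d) \<le> real d" using d real_sqrt_le_mono[of "real d" "real d * real d"] by simp
      then show "sqrt (real d) ^ p \<le> real d ^ p" by (rule power_mono) simp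
    qed auto
    also have "\<dots> \<le> 2 ^ p * real d ^ p * (5 * x) ^ p"
      using mult_left_mono[OF one_le_power[OF True, of p], of "2 ^ p * real d ^ p"] by simp
    also have "\<dots> = (10 * real d) ^ p * s"
      unfolding xp[symmetric] power_mult_distrib[symmetric] by (simp add: mult_ac)
    also have "\<dots> \<le> (10200 * real d) ^ p * s"
      using s by (intro mult_right_mono power_mono) auto
    finally show ?thesis .
  next
    case False
    then have big: "1 < 1 / (5 * x)" using x by simp
    \<comment> \<open>The largest integer with 5 n x \<le> 1, so the roots in the second term
      multiply to at most 1. Rounding down costs at most a factor 2, whence 1/n \<le> 10 x.\<close>
    define n where "n = nat \<lfloor>1 / (5 * x)\<rfloor>"
    have n1: "1 \<le> n" unfolding n_def by (rule le_nat_floor) (use big in simp)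
    have n_le: "real n \<le> 1 / (5 * x)"
      unfolding n_def by (rule of_nat_floor) (use x in simp)
    have "1 / (5 * x) < real n + 1" using big by (simp add: n_def) linarith
    then have "1 / (5 * x) \<le> 2 * real n" using n1 by simp
    then have n_ge: "1 / real n \<le> 10 * x" using x n1 by (simp add: field_simps)
    have "y \<le> 2 * (255 * real d / real n) ^ p + Z * sqrt ((5 * real n) ^ d) * (102 * real d) ^ p"
      by (rule scale[OF n1])
    \<comment> \<open>5100 = 255 x 10 x 2, the last factor absorbing 2 \<le> 2^p; adding the two
      terms doubles it once more to 10200.\<close>
    also have "2 * (255 * real d / real n) ^ p \<le> (5100 * real d) ^ p * s"
    proof -
      have "255 * real d * (1 / real n) \<le> 255 * real d * (10 * x)"
        by (rule mult_left_mono[OF n_ge]) simp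
      then have "(255 * real d / real n) ^ p \<le> (2550 * real d * x) ^ p"
        by (intro power_mono) auto
      moreover have "(2::real) \<le> 2 ^ p" using p by (cases p) auto
      ultimately have "2 * (255 * real d / real n) ^ p \<le> 2 ^ p * (2550 * real d * x) ^ p"
        by (intro mult_mono) auto
      also have "\<dots> = (5100 * real d) ^ p * s"
        unfolding xp[symmetric] power_mult_distrib[symmetric] by (simp add: mult_ac)
      finally show ?thesis .
    qed
    also have "Z * sqrt ((5 * real n) ^ d) * (102 * real d) ^ p \<le> (5100 * real d) ^ p * s"
    proof -
      have "x * (5 * real n) \<le> 1" using n_le x by (simp add: field_simps)
      then have "(x * (5 * real n)) ^ d \<le> 1" using x by (intro power_le_one) auto
      then have "sqrt ((x * (5 * real n)) ^ d) \<le> 1" by (simp only: real_sqrt_le_1_iff)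
      then have le1: "sqrt (x ^ d) * sqrt ((5 * real n) ^ d) \<le> 1"
        by (simp only: power_mult_distrib[of x] real_sqrt_mult)
      have "s * (sqrt (x ^ d) * sqrt ((5 * real n) ^ d)) * (102 * real d) ^ p \<le> s * 1 * (5100 * real d) ^ p"
      proof (rule mult_mono)
        show "(102 * real d) ^ p \<le> (5100 * real d) ^ p" by (rule power_mono) auto
        show "s * (sqrt (x ^ d) * sqrt ((5 * real n) ^ d)) \<le> s * 1"
          by (rule mult_left_mono) (use le1 s in auto)
      qed (use s in auto)
      then show ?thesis unfolding Z by (simp only: mult_1_right mult_ac)
    qed
    also have "(5100 * real d) ^ p * s + (5100 * real d) ^ p * s = 2 * ((5100 * real d) ^ p * s)" by simp
    also have "\<dots> \<le> 2 ^ p * ((5100 * real d) ^ p * s)"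
    proof (rule mult_right_mono)
      show "(2::real) \<le> 2 ^ p" using p by (cases p) auto
    qed (use s in simp)
    also have "\<dots> = (10200 * real d) ^ p * s"
      unfolding mult.assoc[symmetric] power_mult_distrib[symmetric] by simp
    finally show ?thesis by simp
  qed
qed

theorem corollary1p3:
  shows "\<exists>c::real. c > 0 \<and>
    (\<forall>(d::nat) (p::nat) (\<mu> :: (nat \<Rightarrow> real) measure) (\<nu> :: (nat \<Rightarrow> real) measure).
       d \<ge> 1 \<longrightarrow> p \<ge> 1 \<longrightarrow>
       prob_space \<mu> \<longrightarrow> sets \<mu> = sets (Rd d) \<longrightarrow> (AE x in \<mu>. x \<in> unit_ball d) \<longrightarrow>
       prob_space \<nu> \<longrightarrow> sets \<nu> = sets (Rd d) \<longrightarrow> (AE x in \<nu>. x \<in> unit_ball d) \<longrightarrow>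
       zolotarev d p \<mu> \<nu> \<le>
         ennreal ((c * real d) ^ p) *
         (SUP \<theta>\<in>unit_sphere d.
            ennreal_powr (zolotarev 1 p (proj_measure d \<theta> \<mu>) (proj_measure d \<theta> \<nu>))
              (2 / (2 + real d / real p))))"
proof (rule exI[of _ 10200], intro conjI allI impI)
  fix d p :: nat and \<mu> \<nu> :: "(nat \<Rightarrow> real) measure"
  assume d: "d \<ge> 1" and p: "p \<ge> 1"
    and \<mu>: "prob_space \<mu>" "sets \<mu> = sets (Rd d)" "AE x in \<mu>. x \<in> unit_ball d"
    and \<nu>: "prob_space \<nu>" "sets \<nu> = sets (Rd d)" "AE x in \<nu>. x \<in> unit_ball d"
  let ?\<beta> = "2 / (2 + real d / real p)"
  let ?\<zeta> = "\<lambda>\<theta>. zolotarev 1 p (proj_measure d \<theta> \<mu>) (proj_measure d \<theta> \<nu>)"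
  let ?S = "SUP \<theta>\<in>unit_sphere d. ennreal_powr (?\<zeta> \<theta>) ?\<beta>"
  have \<beta>: "0 < ?\<beta>" by (rule divide_pos_pos) (auto intro: add_pos_nonneg)
  show "zolotarev d p \<mu> \<nu> \<le> ennreal ((10200 * real d) ^ p) * ?S"
  proof (cases "?S = \<top>")
    case True
    \<comment> \<open>The factor must be positive, since 0 times \<infinity> is 0 in
      \<open>ennreal\<close>.\<close>
    have "d \<noteq> 0" using d by simp
    then show ?thesis unfolding True by (simp add: ennreal_mult_top)
  next
    case False
    then obtain s where s: "0 \<le> s" "?S = ennreal s" by (cases ?S) auto
    \<comment> \<open>Inverting the power for each \<theta> separately bounds all projected
      distances by one finite number, so power and supremum need not be exchanged.\<close>
    let ?Z = "s powr (1 / ?\<beta>)"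
    have Zle: "?\<zeta> \<theta> \<le> ennreal ?Z" if "\<theta> \<in> unit_sphere d" for \<theta>
    proof -
      have "ennreal_powr (?\<zeta> \<theta>) ?\<beta> \<le> ennreal s"
        unfolding s(2)[symmetric] using that by (rule SUP_upper)
      then show ?thesis using \<beta> s(1) by (rule ennreal_powr_le_imp_le)
    qed
    have bounded: "ball_measures_bounded d \<mu> \<nu> p ?Z"
      by (rule ball_measures_bounded.intro[OF ball_measures.intro[OF \<mu>(1) \<nu>(1) \<mu>(2) \<nu>(2) \<mu>(3) \<nu>(3)]
            ball_measures_bounded_axioms.intro[OF p powr_ge_zero Zle]])
    show ?thesis
      unfolding zolotarev_def[of d p]
    proof (rule SUP_least)
      fix u assume u: "u \<in> zolotarev_test d p"
      let ?\<Lambda> = "(\<integral>x. u x \<partial>\<mu>) - (\<integral>x. u x \<partial>\<nu>)"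
      note bounds = ball_measures_bounded.test_function_bounds[OF bounded u d,
          unfolded ball_measures.\<Lambda>_def[OF ball_measures_bounded.axioms(1)[OF bounded]]]
      have "\<bar>?\<Lambda>\<bar> \<le> (10200 * real d) ^ p * s"
        by (rule optimise_scale[OF d p s(1) bounds])
      then have "ennreal \<bar>?\<Lambda>\<bar> \<le> ennreal ((10200 * real d) ^ p) * ennreal s"
        using s(1) by (simp add: ennreal_mult'[symmetric] ennreal_leI)
      then show "ennreal \<bar>?\<Lambda>\<bar> \<le> ennreal ((10200 * real d) ^ p) * ?S"
        by (simp only: s(2))
    qed
  qed
qed simp

end
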